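(* Let $\eta$ be an $\mathrm{ATL}^{+}$ state formula (in negation normal form) and let $\mathcal{T}^{\eta}$ be the final tableau produced for $\eta$ by the tableau procedure described in the context. If $\eta$ is satisfiable (i.e. there exist a concurrent game model $\mathcal{M}$ and a state $s$ of $\mathcal{M}$ with $\mathcal{M},s\models\eta$), then $\mathcal{T}^{\eta}$ is open, i.e. some state of $\mathcal{T}^{\eta}$ contains $\eta$.
   Context: Agents and models. Fix a finite non-empty set of agents $\mathbb{A}=\{1,\dots,k\}$ and a set $\mathrm{Prop}$ of atomic propositions. A concurrent game model (CGM) is $\mathcal{M}=(\mathbb{A},\mathsf{St},\{\mathsf{Act}_a\}_{a},\{\mathsf{act}_a\}_{a},\mathsf{out},\mathrm{Prop},L)$ where $\mathsf{St}$ is a non-empty set of states, $\mathsf{act}_a(s)\subseteq\mathsf{Act}_a$ is the non-empty set of actions available to $a$ at $s$, $\mathsf{out}(s,\sigma)$ is the unique successor state of $s$ under an action profile $\sigma$ (one available action per agent), and $L:\mathsf{St}\to\mathcal{P}(\mathrm{Prop})$. For $A\subseteq\mathbb{A}$ an $A$-action at $s$ is a tuple of available actions of the agents in $A$. Plays are infinite sequences of states each obtained from the previous one by some action profile; histories are finite prefixes. A (perfect-recall) strategy of $A$ assigns to every history $h$ an $A$-action available at its last state; a play $\lambda$ is consistent with it if each step $\lambda_i\to\lambda_{i+1}$ is produced by an action profile extending the $A$-action prescribed for $\lambda_0\dots\lambda_i$. An $A$-co-strategy assigns to each history $h$ and each strategy $F_A$ of $A$ an action tuple of $\mathbb{A}\setminus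 A$ available at the last state of $h$; a play is consistent with a co-strategy $F^c$ if for some strategy $F_A$ of $A$ each step is produced by the profile combining $F_A(\lambda_{\le i})$ and $F^c(\lambda_{\le i},F_A)$. Syntax (negation normal form). State formulae: $\varphi::=l\mid\varphi\vee\varphi\mid\varphi\wedge\varphi\mid\langle\langle A\rangle\rangle\Phi\mid[[A]]\Phi$ with $l$ a literal ($p$ or $\neg p$, $p\in\mathrm{Prop}$) and $A\subseteq\mathbb{A}$; path formulae: $\Phi::=\varphi\mid\bigcirc\varphi\mid\Box\varphi\mid\varphi\,\mathcal{U}\,\varphi\mid\Phi\vee\Phi\mid\Phi\wedge\Phi$. $\top$ abbreviates $p\vee\neg p$, $\bot$ its negation. Semantics is standard: $\mathcal{M},s\models\langle\langle A\rangle\rangle\Phi$ iff some strategy of $A$ makes every consistent play from $s$ satisfy $\Phi$; $\mathcal{M},s\models[[A]]\Phi$ iff some $A$-co-strategy makes every consistent play from $s$ satisfy $\Phi$; a state formula holds on a play iff it holds at its first state; $\bigcirc,\Box,\mathcal{U}$, $\wedge$, $\vee$ on plays are as in LTL. Decomposition. For path formulae define $\mathsf{dec}(\Phi)$, a set of pairs (state formula, path formula): $\mathsf{dec}(\varphi)=\{\langle\varphi,\top\rangle\}$ for a state formula $\varphi$; $\mathsf{dec}(\bigcirc\varphi)=\{\langle\top,\varphi\rangle\}$; $\mathsf{dec}(\Box\varphi)=\{\langle\varphi,\Box\varphi\rangle\}$; $\mathsf{dec}(\varphi\,\mathcal{U}\,\psi)=\{\langle\varphi,\varphi\,\mathcal{U}\,\psi\rangle,\langle\psi,\top\rangle\}$;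 $\mathsf{dec}(\Phi_1\wedge\Phi_2)=\{\langle\psi_i\wedge\psi_j,\Psi_i\wedge\Psi_j\rangle:\langle\psi_i,\Psi_i\rangle\in\mathsf{dec}(\Phi_1),\langle\psi_j,\Psi_j\rangle\in\mathsf{dec}(\Phi_2)\}$; $\mathsf{dec}(\Phi_1\vee\Phi_2)=\mathsf{dec}(\Phi_1)\cup\mathsf{dec}(\Phi_2)\cup\{\langle\psi_i\wedge\psi_j,\Psi_i\vee\Psi_j\rangle:\langle\psi_i,\Psi_i\rangle\in\mathsf{dec}(\Phi_1),\langle\psi_j,\Psi_j\rangle\in\mathsf{dec}(\Phi_2),\Psi_i\neq\top\neq\Psi_j\}$. A $\gamma$-formula is one of the form $\langle\langle A\rangle\rangle\Phi$ or $[[A]]\Phi$ where the main operator of $\Phi$ is not $\bigcirc$; its $\gamma$-components are, for $\langle\psi,\Psi\rangle\in\mathsf{dec}(\Phi)$: $\psi$ if $\Psi=\top$, and otherwise $\psi\wedge\langle\langle A\rangle\rangle\bigcirc\langle\langle A\rangle\rangle\Psi$ (resp. $\psi\wedge[[A]]\bigcirc[[A]]\Psi$). Other components: $\varphi\wedge\psi$ has $\alpha$-components $\varphi,\psi$; $[[\mathbb{A}]]\bigcirc\psi$ has $\alpha$-component $\langle\langle\emptyset\rangle\rangle\bigcirc\psi$; $\varphi\vee\psi$ has $\beta$-components $\varphi,\psi$; $\langle\langle A\rangle\rangle\bigcirc\psi$ and $[[A]]\bigcirc\psi$ ($A\neq\mathbb{A}$) have successor component $\psi$ and are called primitive successor formulae.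 The closure $cl(\eta)$ is the least set containing $\eta,\top,\bot$ and closed under taking all these components. Full expansions. For a set $\Gamma$ of state formulae, a full expansion of $\Gamma$ is a set $\Delta$ with $\Gamma\subseteq\Delta\subseteq cl(\Gamma)$, not containing $\bot$ nor any pair $\varphi,\neg\varphi$, such that: $\varphi\wedge\psi\in\Delta$ implies $\varphi,\psi\in\Delta$; $\varphi\vee\psi\in\Delta$ implies $\varphi\in\Delta$ or $\psi\in\Delta$; every $\gamma$-formula $\xi\in\Delta$ has at least one $\gamma$-component in $\Delta$, and exactly one of them, denoted $\gamma(\xi,\Delta)$, is designated as linked to $\xi$. Tableau procedure for input $\eta$. Pretableau: nodes are prestates (sets of formulae) and states (full expansions), identified with their labels; start with the prestate $\{\eta\}$ and apply the two rules until saturation. (SR) For a prestate $\Gamma$ and each full expansion $\Delta$ of $\Gamma$: if $\Delta$ contains no formula of the form $\langle\langle A\rangle\rangle\bigcirc\varphi$ or $[[A]]\bigcirc\varphi$, add $\langle\langle\mathbb{A}\rangle\rangle\bigcirc\top$ to it; add the state $\Delta$ (or reuse an existing state with the same label) and an edge $\Gamma\Rightarrow\Delta$. (Next) For a state $\Delta$, list its primitive successor formulae as $\langle\langle A_0\rangle\rangle\bigcirc\varphi_0,\dots,\langle\langle A_{m-1}\rangle\rangle\bigcirc\varphi_{m-1},[[A'_0]]\bigcirc\psi_0,\dots,[[A'_{l-1}]]\bigcirc\psi_{l-1}$ (with $A'_q\neq\mathbb{A}$); let $r=m+l$ and $D(\Delta)=\{0,\dots,r-1\}^{\mathbb{A}}$.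 For $\sigma\in D(\Delta)$ let $N(\sigma)=\{a:\sigma_a\ge m\}$ and $\mathrm{co}(\sigma)=(\sum_{a\in N(\sigma)}(\sigma_a-m))\bmod l$. Create the prestate $\Gamma_\sigma=\{\varphi_p:\sigma_a=p\text{ for all }a\in A_p\}\cup\{\psi_q:\mathrm{co}(\sigma)=q,\ \mathbb{A}\setminus A'_q\subseteq N(\sigma)\}$ (adding $\top$ if it is empty, reusing an existing identical prestate) and an edge $\Delta\xrightarrow{\sigma}\Gamma_\sigma$. Initial tableau: delete all prestates, putting $\Delta\xrightarrow{\sigma}\Delta'$ whenever $\Delta\xrightarrow{\sigma}\Gamma\Rightarrow\Delta'$. Elimination: repeatedly delete one state $\Delta$ from the current tableau if (ER1) for some $\sigma\in D(\Delta)$ no remaining state $\Delta'$ has $\Delta\xrightarrow{\sigma}\Delta'$, or (ER2) $\Delta$ contains a potential eventuality (i.e. a $\gamma$-formula) not realized at $\Delta$ in the current tableau. Realization: define $Real(\Phi,\Theta)$ for a path formula $\Phi$ and a set $\Theta$ by $Real(\Phi\wedge\Psi)=Real(\Phi)\wedge Real(\Psi)$, $Real(\Phi\vee\Psi)=Real(\Phi)\vee Real(\Psi)$, $Real(\varphi,\Theta)$ iff $\varphi\in\Theta$ ($\varphi$ a state formula), $Real(\bigcirc\varphi,\Theta)=$ false, $Real(\Box\varphi,\Theta)$ iff $\varphi\in\Theta$, $Real(\varphi\,\mathcal{U}\,\psi,\Theta)$ iff $\psi\in\Theta$. Realization is defined inductively: $\xi=\langle\langle A\rangle\rangle\Phi$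 (resp. $[[A]]\Phi$) in $\Delta$ is realized at $\Delta$ if $Real(\Phi,\Delta)$ holds, or if $\gamma(\xi,\Delta)$ is $\psi\wedge\langle\langle A\rangle\rangle\bigcirc\xi'$ (resp. $\psi\wedge[[A]]\bigcirc\xi'$) and for every $\sigma\in D(\Delta)$ with $\sigma_a=p$ for all $a\in A$, where $\langle\langle A\rangle\rangle\bigcirc\xi'$ is the $p$-th listed formula (resp. every $\sigma$ with $\mathrm{co}(\sigma)=q$ and $\mathbb{A}\setminus A\subseteq N(\sigma)$, where $[[A]]\bigcirc\xi'$ is the $q$-th listed unavoidable formula), some remaining $\Delta'$ with $\Delta\xrightarrow{\sigma}\Delta'$ has $\xi'$ realized at $\Delta'$. When no elimination applies, the result is the final tableau; it is open if some of its states contains $\eta$, closed otherwise.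
   Formalization: A γ-formula also counts as realized if its linked component comes from a pair ⟨ψ,⊤⟩ (else valid ⟨⟨A⟩⟩(○⊤∨○⊤) gets a closed tableau); [[𝔸]]○ξ' is realized via its α-component ⟨⟨∅⟩⟩○ξ', which full expansions must contain; states with the same set but different linkings are distinct. *)

theory Defs
  imports Main "HOL-Library.FuncSet"
begin

text \<open>
  The set of agents is the universe of the type \<open>'ag\<close> (of class \<^class>\<open>finite\<close> in the theorem), the
  set of atomic propositions is the universe of \<open>'p\<close>.
\<close>

section \<open>Syntax (negation normal form)\<close>

datatype ('ag, 'p) sform =
    Lit 'p
  | NLit 'p
  | Or "('ag, 'p) sform" "('ag, 'p) sform"
  | And "('ag, 'p) sform" "('ag, 'p) sform"
  | Coop "'ag set" "('ag, 'p) pform"  \<comment> \<open>\<open>\<langle>\<langle>A\<rangle>\<rangle>\<Phi>\<close>\<close>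
  | Unav "'ag set" "('ag, 'p) pform"  \<comment> \<open>\<open>[[A]]\<Phi>\<close>\<close>
and ('ag, 'p) pform =
    PState "('ag, 'p) sform"
  | Next "('ag, 'p) sform"
  | Always "('ag, 'p) sform"
  | Until "('ag, 'p) sform" "('ag, 'p) sform"
  | POr "('ag, 'p) pform" "('ag, 'p) pform"
  | PAnd "('ag, 'p) pform" "('ag, 'p) pform"

text \<open>\<open>\<top>\<close> abbreviates \<open>p \<or> \<not>p\<close>. The atom \<open>p\<close> is an explicit parameter of everything that mentions \<open>\<top>\<close>.\<close>

abbreviation Top :: "'p \<Rightarrow> ('ag, 'p) sform" where
  "Top p \<equiv> Or (Lit p) (NLit p)"

abbreviation Bot :: "'p \<Rightarrow> ('ag, 'p) sform" where
  "Bot p \<equiv> And (NLit p) (Lit p)"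


section \<open>Concurrent game models and semantics\<close>

record ('ag, 'p, 's, 'c) cgm =
  St :: "'s set"
  Act :: "'ag \<Rightarrow> 'c set"
  act :: "'ag \<Rightarrow> 's \<Rightarrow> 'c set"
  out :: "'s \<Rightarrow> ('ag \<Rightarrow> 'c) \<Rightarrow> 's"
  lab :: "'s \<Rightarrow> 'p set"

definition actions :: "('ag, 'p, 's, 'c) cgm \<Rightarrow> 'ag set \<Rightarrow> 's \<Rightarrow> ('ag \<Rightarrow> 'c) set" where
  "actions M A s = (\<Pi>\<^sub>E a\<in>A. act M a s)"

abbreviation profiles :: "('ag, 'p, 's, 'c) cgm \<Rightarrow> 's \<Rightarrow> ('ag \<Rightarrow> 'c) set" where
  "profiles M s \<equiv> actions M UNIV s"

definition is_cgm :: "('ag, 'p, 's, 'c) cgm \<Rightarrow> bool" where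
  "is_cgm M \<longleftrightarrow> St M \<noteq> {} \<and>
     (\<forall>s\<in>St M. \<forall>a. act M a s \<noteq> {} \<and> act M a s \<subseteq> Act M a) \<and>
     (\<forall>s\<in>St M. \<forall>\<sigma>\<in>profiles M s. out M s \<sigma> \<in> St M)"

definition plays :: "('ag, 'p, 's, 'c) cgm \<Rightarrow> (nat \<Rightarrow> 's) set" where
  "plays M = {\<pi>. \<pi> 0 \<in> St M \<and> (\<forall>i. \<exists>\<sigma>\<in>profiles M (\<pi> i). \<pi> (Suc i) = out M (\<pi> i) \<sigma>)}"

definition hist :: "(nat \<Rightarrow> 's) \<Rightarrow> nat \<Rightarrow> 's list" where
  "hist \<pi> i = map \<pi> [0..<Suc i]"

definition histories :: "('ag, 'p, 's, 'c) cgm \<Rightarrow> 's list set" where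
  "histories M = {hist \<pi> i | \<pi> i. \<pi> \<in> plays M}"

type_synonym ('ag, 's, 'c) strategy = "'s list \<Rightarrow> 'ag \<Rightarrow> 'c"

definition strategies :: "('ag, 'p, 's, 'c) cgm \<Rightarrow> 'ag set \<Rightarrow> ('ag, 's, 'c) strategy set" where
  "strategies M A = (\<Pi>\<^sub>E h\<in>histories M. actions M A (last h))"

definition costrategies ::
  "('ag, 'p, 's, 'c) cgm \<Rightarrow> 'ag set \<Rightarrow> ('s list \<Rightarrow> ('ag, 's, 'c) strategy \<Rightarrow> 'ag \<Rightarrow> 'c) set" where
  "costrategies M A = (\<Pi>\<^sub>E h\<in>histories M. \<Pi>\<^sub>E F\<in>strategies M A. actions M (- A) (last h))"

definition consistent ::
  "('ag, 'p, 's, 'c) cgm \<Rightarrow> 'ag set \<Rightarrow> ('ag, 's, 'c) strategy \<Rightarrow> (nat \<Rightarrow> 's) \<Rightarrow> bool" where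
  "consistent M A F \<pi> \<longleftrightarrow>
     (\<forall>i. \<exists>\<sigma>\<in>profiles M (\<pi> i). (\<forall>a\<in>A. \<sigma> a = F (hist \<pi> i) a) \<and> \<pi> (Suc i) = out M (\<pi> i) \<sigma>)"

definition co_consistent ::
  "('ag, 'p, 's, 'c) cgm \<Rightarrow> 'ag set \<Rightarrow> ('s list \<Rightarrow> ('ag, 's, 'c) strategy \<Rightarrow> 'ag \<Rightarrow> 'c)
    \<Rightarrow> (nat \<Rightarrow> 's) \<Rightarrow> bool" where
  "co_consistent M A Fc \<pi> \<longleftrightarrow> (\<exists>F\<in>strategies M A. \<forall>i.
     \<pi> (Suc i) = out M (\<pi> i) (\<lambda>a. if a \<in> A then F (hist \<pi> i) a else Fc (hist \<pi> i) F a))"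

primrec sat :: "('ag, 'p, 's, 'c) cgm \<Rightarrow> 's \<Rightarrow> ('ag, 'p) sform \<Rightarrow> bool"
  and psat :: "('ag, 'p, 's, 'c) cgm \<Rightarrow> (nat \<Rightarrow> 's) \<Rightarrow> ('ag, 'p) pform \<Rightarrow> bool" where
  "sat M s (Lit p) \<longleftrightarrow> p \<in> lab M s"
| "sat M s (NLit p) \<longleftrightarrow> p \<notin> lab M s"
| "sat M s (Or \<phi> \<psi>) \<longleftrightarrow> sat M s \<phi> \<or> sat M s \<psi>"
| "sat M s (And \<phi> \<psi>) \<longleftrightarrow> sat M s \<phi> \<and> sat M s \<psi>"
| "sat M s (Coop A \<Phi>) \<longleftrightarrow>
     (\<exists>F\<in>strategies M A. \<forall>\<pi>\<in>plays M. \<pi> 0 = s \<and> consistent M A F \<pi> \<longrightarrow> psat M \<pi> \<Phi>)"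
| "sat M s (Unav A \<Phi>) \<longleftrightarrow>
     (\<exists>Fc\<in>costrategies M A. \<forall>\<pi>\<in>plays M. \<pi> 0 = s \<and> co_consistent M A Fc \<pi> \<longrightarrow> psat M \<pi> \<Phi>)"
| "psat M \<pi> (PState \<phi>) \<longleftrightarrow> sat M (\<pi> 0) \<phi>"
| "psat M \<pi> (Next \<phi>) \<longleftrightarrow> sat M (\<pi> 1) \<phi>"
| "psat M \<pi> (Always \<phi>) \<longleftrightarrow> (\<forall>i. sat M (\<pi> i) \<phi>)"
| "psat M \<pi> (Until \<phi> \<psi>) \<longleftrightarrow> (\<exists>i. sat M (\<pi> i) \<psi> \<and> (\<forall>j<i. sat M (\<pi> j) \<phi>))"
| "psat M \<pi> (POr \<Phi> \<Psi>) \<longleftrightarrow> psat M \<pi> \<Phi> \<or> psat M \<pi> \<Psi>"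
| "psat M \<pi> (PAnd \<Phi> \<Psi>) \<longleftrightarrow> psat M \<pi> \<Phi> \<and> psat M \<pi> \<Psi>"


section \<open>Decomposition, components and cl\<close>

primrec dec :: "'p \<Rightarrow> ('ag, 'p) pform \<Rightarrow> (('ag, 'p) sform \<times> ('ag, 'p) pform) set" where
  "dec p (PState \<phi>) = {(\<phi>, PState (Top p))}"
| "dec p (Next \<phi>) = {(Top p, PState \<phi>)}"
| "dec p (Always \<phi>) = {(\<phi>, Always \<phi>)}"
| "dec p (Until \<phi> \<psi>) = {(\<phi>, Until \<phi> \<psi>), (\<psi>, PState (Top p))}"
| "dec p (PAnd \<Phi>1 \<Phi>2) =
     {(And \<psi>i \<psi>j, PAnd \<Psi>i \<Psi>j) | \<psi>i \<Psi>i \<psi>j \<Psi>j. (\<psi>i, \<Psi>i) \<in> dec p \<Phi>1 \<and> (\<psi>j, \<Psi>j) \<in> dec p \<Phi>2}"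
| "dec p (POr \<Phi>1 \<Phi>2) = dec p \<Phi>1 \<union> dec p \<Phi>2 \<union>
     {(And \<psi>i \<psi>j, POr \<Psi>i \<Psi>j) | \<psi>i \<Psi>i \<psi>j \<Psi>j. (\<psi>i, \<Psi>i) \<in> dec p \<Phi>1 \<and> (\<psi>j, \<Psi>j) \<in> dec p \<Phi>2 \<and>
        \<Psi>i \<noteq> PState (Top p) \<and> \<Psi>j \<noteq> PState (Top p)}"

definition is_next :: "('ag, 'p) pform \<Rightarrow> bool" where
  "is_next \<Phi> \<longleftrightarrow> (\<exists>\<phi>. \<Phi> = Next \<phi>)"

definition gamma_formula :: "('ag, 'p) sform \<Rightarrow> bool" where
  "gamma_formula \<xi> \<longleftrightarrow> (\<exists>A \<Phi>. (\<xi> = Coop A \<Phi> \<or> \<xi> = Unav A \<Phi>) \<and> \<not> is_next \<Phi>)"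

definition gamma_comps :: "'p \<Rightarrow> ('ag, 'p) sform \<Rightarrow> ('ag, 'p) sform set" where
  "gamma_comps p \<xi> = (case \<xi> of
     Coop A \<Phi> \<Rightarrow> if is_next \<Phi> then {} else
       (\<lambda>(\<psi>, \<Psi>). if \<Psi> = PState (Top p) then \<psi> else And \<psi> (Coop A (Next (Coop A \<Psi>)))) ` dec p \<Phi>
   | Unav A \<Phi> \<Rightarrow> if is_next \<Phi> then {} else
       (\<lambda>(\<psi>, \<Psi>). if \<Psi> = PState (Top p) then \<psi> else And \<psi> (Unav A (Next (Unav A \<Psi>)))) ` dec p \<Phi>
   | _ \<Rightarrow> {})"

definition alpha_comps :: "('ag, 'p) sform \<Rightarrow> ('ag, 'p) sform set" where
  "alpha_comps \<xi> = (case \<xi> of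
     And \<phi> \<psi> \<Rightarrow> {\<phi>, \<psi>}
   | Unav A (Next \<psi>) \<Rightarrow> if A = UNIV then {Coop {} (Next \<psi>)} else {}
   | _ \<Rightarrow> {})"

definition beta_comps :: "('ag, 'p) sform \<Rightarrow> ('ag, 'p) sform set" where
  "beta_comps \<xi> = (case \<xi> of Or \<phi> \<psi> \<Rightarrow> {\<phi>, \<psi>} | _ \<Rightarrow> {})"

definition succ_comps :: "('ag, 'p) sform \<Rightarrow> ('ag, 'p) sform set" where
  "succ_comps \<xi> = (case \<xi> of
     Coop A (Next \<psi>) \<Rightarrow> {\<psi>}
   | Unav A (Next \<psi>) \<Rightarrow> if A = UNIV then {} else {\<psi>}
   | _ \<Rightarrow> {})"

inductive_set cl :: "'p \<Rightarrow> ('ag, 'p) sform set \<Rightarrow> ('ag, 'p) sform set"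
  for p :: 'p and \<Gamma> :: "('ag, 'p) sform set" where
  base: "\<phi> \<in> \<Gamma> \<Longrightarrow> \<phi> \<in> cl p \<Gamma>"
| top: "Top p \<in> cl p \<Gamma>"
| bot: "Bot p \<in> cl p \<Gamma>"
| comp: "\<xi> \<in> cl p \<Gamma> \<Longrightarrow>
    \<phi> \<in> alpha_comps \<xi> \<union> beta_comps \<xi> \<union> gamma_comps p \<xi> \<union> succ_comps \<xi> \<Longrightarrow> \<phi> \<in> cl p \<Gamma>"


section \<open>Pretableau\<close>

text \<open>
  A tableau state is a full expansion: a set of formulae together with its linking, a partial map
  \<open>\<gamma>\<close> that designates exactly one \<open>\<gamma>\<close>-component in the set for each \<open>\<gamma>\<close>-formula of the set. The
  linking is part of the state: the same set with two different linkings gives two states.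
  The clause for \<^const>\<open>alpha_comps\<close> covers both conjunctions and \<open>[[\<bbbA>]]\<circle>\<psi>\<close>. In negation normal
  form, complementary pairs are pairs of literals.
\<close>

type_synonym ('ag, 'p) tstate =
  "('ag, 'p) sform set \<times> (('ag, 'p) sform \<Rightarrow> ('ag, 'p) sform option)"

definition full_expansion ::
  "'p \<Rightarrow> ('ag, 'p) sform set \<Rightarrow> ('ag, 'p) tstate \<Rightarrow> bool" where
  "full_expansion p \<Gamma> S \<longleftrightarrow> (case S of (\<Delta>, \<gamma>) \<Rightarrow>
     \<Gamma> \<subseteq> \<Delta> \<and> \<Delta> \<subseteq> cl p \<Gamma> \<and>
     Bot p \<notin> \<Delta> \<and> (\<forall>q. \<not> (Lit q \<in> \<Delta> \<and> NLit q \<in> \<Delta>)) \<and>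
     (\<forall>\<xi>\<in>\<Delta>. alpha_comps \<xi> \<subseteq> \<Delta>) \<and>
     (\<forall>\<phi> \<psi>. Or \<phi> \<psi> \<in> \<Delta> \<longrightarrow> \<phi> \<in> \<Delta> \<or> \<psi> \<in> \<Delta>) \<and>
     dom \<gamma> = {\<xi> \<in> \<Delta>. gamma_formula \<xi>} \<and>
     (\<forall>\<xi> \<chi>. \<gamma> \<xi> = Some \<chi> \<longrightarrow> \<chi> \<in> gamma_comps p \<xi> \<and> \<chi> \<in> \<Delta>))"

definition has_next :: "('ag, 'p) sform set \<Rightarrow> bool" where
  "has_next \<Delta> \<longleftrightarrow> (\<exists>A \<phi>. Coop A (Next \<phi>) \<in> \<Delta> \<or> Unav A (Next \<phi>) \<in> \<Delta>)"

definition sr_complete :: "'p \<Rightarrow> ('ag, 'p) tstate \<Rightarrow> ('ag, 'p) tstate" where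
  "sr_complete p S = (case S of (\<Delta>, \<gamma>) \<Rightarrow>
     (if has_next \<Delta> then \<Delta> else insert (Coop UNIV (Next (Top p))) \<Delta>, \<gamma>))"

definition sr_edge :: "'p \<Rightarrow> ('ag, 'p) sform set \<Rightarrow> ('ag, 'p) tstate \<Rightarrow> bool" where
  "sr_edge p \<Gamma> S \<longleftrightarrow> (\<exists>S0. full_expansion p \<Gamma> S0 \<and> S = sr_complete p S0)"

text \<open>
  A listing of the primitive successor formulae of each state: \<open>(A\<^sub>p, \<phi>\<^sub>p)\<close> in the first list
  stands for \<open>\<langle>\<langle>A\<^sub>p\<rangle>\<rangle>\<circle>\<phi>\<^sub>p\<close>, \<open>(A'\<^sub>q, \<psi>\<^sub>q)\<close> in the second for \<open>[[A'\<^sub>q]]\<circle>\<psi>\<^sub>q\<close>. Only finite sets can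
  be listed; all states of a pretableau are finite (lemma \<open>pretableau_label_finite\<close> below).
\<close>

type_synonym ('ag, 'p) lister =
  "('ag, 'p) tstate \<Rightarrow> ('ag set \<times> ('ag, 'p) sform) list \<times> ('ag set \<times> ('ag, 'p) sform) list"

definition listing :: "('ag, 'p) lister \<Rightarrow> bool" where
  "listing L \<longleftrightarrow> (\<forall>\<Delta> \<gamma>. finite \<Delta> \<longrightarrow>
     (case L (\<Delta>, \<gamma>) of (cs, us) \<Rightarrow>
        distinct cs \<and> set cs = {(A, \<phi>). Coop A (Next \<phi>) \<in> \<Delta>} \<and>
        distinct us \<and> set us = {(A, \<psi>). Unav A (Next \<psi>) \<in> \<Delta> \<and> A \<noteq> UNIV}))"

context
  fixes L :: "('ag, 'p) lister"
begin

abbreviation coops :: "('ag, 'p) tstate \<Rightarrow> ('ag set \<times> ('ag, 'p) sform) list" where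
  "coops S \<equiv> fst (L S)"

abbreviation unavs :: "('ag, 'p) tstate \<Rightarrow> ('ag set \<times> ('ag, 'p) sform) list" where
  "unavs S \<equiv> snd (L S)"

definition moves :: "('ag, 'p) tstate \<Rightarrow> ('ag \<Rightarrow> nat) set" where
  "moves S = {\<sigma>. \<forall>a. \<sigma> a < length (coops S) + length (unavs S)}"

definition neg_agents :: "('ag, 'p) tstate \<Rightarrow> ('ag \<Rightarrow> nat) \<Rightarrow> 'ag set" where
  "neg_agents S \<sigma> = {a. length (coops S) \<le> \<sigma> a}"

definition co :: "('ag, 'p) tstate \<Rightarrow> ('ag \<Rightarrow> nat) \<Rightarrow> nat" where
  "co S \<sigma> = (\<Sum>a\<in>neg_agents S \<sigma>. \<sigma> a - length (coops S)) mod length (unavs S)"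

text \<open>\<open>coop_moves S A n\<close> and \<open>unav_moves S A q\<close> are the moves that activate the \<open>n\<close>-th formula
  \<open>\<langle>\<langle>A\<rangle>\<rangle>\<circle>\<phi>\<close> of the first list and the \<open>q\<close>-th formula \<open>[[A]]\<circle>\<psi>\<close> of the second list.\<close>

definition coop_moves :: "('ag, 'p) tstate \<Rightarrow> 'ag set \<Rightarrow> nat \<Rightarrow> ('ag \<Rightarrow> nat) set" where
  "coop_moves S A n = {\<sigma> \<in> moves S. \<forall>a\<in>A. \<sigma> a = n}"

definition unav_moves :: "('ag, 'p) tstate \<Rightarrow> 'ag set \<Rightarrow> nat \<Rightarrow> ('ag \<Rightarrow> nat) set" where
  "unav_moves S A q = {\<sigma> \<in> moves S. co S \<sigma> = q \<and> - A \<subseteq> neg_agents S \<sigma>}"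

definition next_prestate :: "'p \<Rightarrow> ('ag, 'p) tstate \<Rightarrow> ('ag \<Rightarrow> nat) \<Rightarrow> ('ag, 'p) sform set" where
  "next_prestate p S \<sigma> =
     (let \<Gamma> = {\<phi>. \<exists>n<length (coops S). \<exists>A. coops S ! n = (A, \<phi>) \<and> \<sigma> \<in> coop_moves S A n} \<union>
              {\<psi>. \<exists>q<length (unavs S). \<exists>A. unavs S ! q = (A, \<psi>) \<and> \<sigma> \<in> unav_moves S A q}
      in if \<Gamma> = {} then {Top p} else \<Gamma>)"

inductive prestate :: "'p \<Rightarrow> ('ag, 'p) sform \<Rightarrow> ('ag, 'p) sform set \<Rightarrow> bool"
  and tableau_state :: "'p \<Rightarrow> ('ag, 'p) sform \<Rightarrow> ('ag, 'p) tstate \<Rightarrow> bool"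
  for p :: 'p and \<eta> :: "('ag, 'p) sform" where
  init: "prestate p \<eta> {\<eta>}"
| sr: "prestate p \<eta> \<Gamma> \<Longrightarrow> sr_edge p \<Gamma> S \<Longrightarrow> tableau_state p \<eta> S"
| nxt: "tableau_state p \<eta> S \<Longrightarrow> \<sigma> \<in> moves S \<Longrightarrow> prestate p \<eta> (next_prestate p S \<sigma>)"

definition initial_tableau :: "'p \<Rightarrow> ('ag, 'p) sform \<Rightarrow> ('ag, 'p) tstate set" where
  "initial_tableau p \<eta> = {S. tableau_state p \<eta> S}"

definition edge :: "'p \<Rightarrow> ('ag, 'p) tstate \<Rightarrow> ('ag \<Rightarrow> nat) \<Rightarrow> ('ag, 'p) tstate \<Rightarrow> bool" where
  "edge p S \<sigma> S' \<longleftrightarrow> \<sigma> \<in> moves S \<and> sr_edge p (next_prestate p S \<sigma>) S'"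

end


section \<open>Elimination\<close>

primrec Real :: "('ag, 'p) pform \<Rightarrow> ('ag, 'p) sform set \<Rightarrow> bool" where
  "Real (PAnd \<Phi> \<Psi>) \<Theta> \<longleftrightarrow> Real \<Phi> \<Theta> \<and> Real \<Psi> \<Theta>"
| "Real (POr \<Phi> \<Psi>) \<Theta> \<longleftrightarrow> Real \<Phi> \<Theta> \<or> Real \<Psi> \<Theta>"
| "Real (PState \<phi>) \<Theta> \<longleftrightarrow> \<phi> \<in> \<Theta>"
| "Real (Next \<phi>) \<Theta> \<longleftrightarrow> False"
| "Real (Always \<phi>) \<Theta> \<longleftrightarrow> \<phi> \<in> \<Theta>"
| "Real (Until \<phi> \<psi>) \<Theta> \<longleftrightarrow> \<psi> \<in> \<Theta>"

text \<open>
  Realization in a current tableau \<open>T\<close>. Two points: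

  \<^item> \<open>[[\<bbbA>]]\<circle>\<xi>'\<close> is not itself listed; its \<open>\<alpha>\<close>-component \<open>\<langle>\<langle>\<emptyset>\<rangle>\<rangle>\<circle>\<xi>'\<close> is, and the rule \<open>unav_all\<close>
    uses the position of the latter.

  \<^item> Rule \<open>nothing_left\<close>: the linked component comes from a pair \<open>\<langle>\<psi>, \<top>\<rangle>\<close> of the decomposition, so no path
    obligation is left. It adds something to rule \<open>now\<close> only if \<open>\<circle>\<top>\<close> is a disjunct of \<open>\<Phi>\<close> (lemma
    \<open>nothing_left_redundant\<close> below). Without it, the valid formula \<open>\<langle>\<langle>A\<rangle>\<rangle>(\<circle>\<top> \<or> \<circle>\<top>)\<close>, whose only
    \<open>\<gamma>\<close>-component is \<open>\<top>\<close>, would never be realized and its tableau would be closed.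
\<close>

inductive realized ::
  "('ag, 'p) lister \<Rightarrow> 'p \<Rightarrow> ('ag, 'p) tstate set \<Rightarrow> ('ag, 'p) sform \<Rightarrow> ('ag, 'p) tstate \<Rightarrow> bool"
  for L :: "('ag, 'p) lister" and p :: 'p and T :: "('ag, 'p) tstate set" where
  now: "\<lbrakk>(\<Delta>, \<gamma>) \<in> T; \<xi> \<in> \<Delta>; gamma_formula \<xi>; \<xi> = Coop A \<Phi> \<or> \<xi> = Unav A \<Phi>; Real \<Phi> \<Delta>\<rbrakk>
    \<Longrightarrow> realized L p T \<xi> (\<Delta>, \<gamma>)"
| nothing_left: "\<lbrakk>(\<Delta>, \<gamma>) \<in> T; \<xi> \<in> \<Delta>; gamma_formula \<xi>; \<xi> = Coop A \<Phi> \<or> \<xi> = Unav A \<Phi>;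
      \<gamma> \<xi> = Some \<psi>; (\<psi>, PState (Top p)) \<in> dec p \<Phi>\<rbrakk>
    \<Longrightarrow> realized L p T \<xi> (\<Delta>, \<gamma>)"
| coop: "\<lbrakk>(\<Delta>, \<gamma>) \<in> T; Coop A \<Phi> \<in> \<Delta>; gamma_formula (Coop A \<Phi>);
      \<gamma> (Coop A \<Phi>) = Some (And \<psi> (Coop A (Next \<xi>')));
      n < length (coops L (\<Delta>, \<gamma>)); coops L (\<Delta>, \<gamma>) ! n = (A, \<xi>');
      \<forall>\<sigma>\<in>coop_moves L (\<Delta>, \<gamma>) A n. \<exists>S'\<in>T. edge L p (\<Delta>, \<gamma>) \<sigma> S' \<and> realized L p T \<xi>' S'\<rbrakk>
    \<Longrightarrow> realized L p T (Coop A \<Phi>) (\<Delta>, \<gamma>)"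
| unav: "\<lbrakk>(\<Delta>, \<gamma>) \<in> T; Unav A \<Phi> \<in> \<Delta>; gamma_formula (Unav A \<Phi>);
      \<gamma> (Unav A \<Phi>) = Some (And \<psi> (Unav A (Next \<xi>')));
      q < length (unavs L (\<Delta>, \<gamma>)); unavs L (\<Delta>, \<gamma>) ! q = (A, \<xi>');
      \<forall>\<sigma>\<in>unav_moves L (\<Delta>, \<gamma>) A q. \<exists>S'\<in>T. edge L p (\<Delta>, \<gamma>) \<sigma> S' \<and> realized L p T \<xi>' S'\<rbrakk>
    \<Longrightarrow> realized L p T (Unav A \<Phi>) (\<Delta>, \<gamma>)"
| unav_all: "\<lbrakk>(\<Delta>, \<gamma>) \<in> T; Unav UNIV \<Phi> \<in> \<Delta>; gamma_formula (Unav UNIV \<Phi>);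
      \<gamma> (Unav UNIV \<Phi>) = Some (And \<psi> (Unav UNIV (Next \<xi>')));
      n < length (coops L (\<Delta>, \<gamma>)); coops L (\<Delta>, \<gamma>) ! n = ({}, \<xi>');
      \<forall>\<sigma>\<in>coop_moves L (\<Delta>, \<gamma>) {} n. \<exists>S'\<in>T. edge L p (\<Delta>, \<gamma>) \<sigma> S' \<and> realized L p T \<xi>' S'\<rbrakk>
    \<Longrightarrow> realized L p T (Unav UNIV \<Phi>) (\<Delta>, \<gamma>)"

definition er1 :: "('ag, 'p) lister \<Rightarrow> 'p \<Rightarrow> ('ag, 'p) tstate set \<Rightarrow> ('ag, 'p) tstate \<Rightarrow> bool" where
  "er1 L p T S \<longleftrightarrow> (\<exists>\<sigma>\<in>moves L S. \<not> (\<exists>S'\<in>T. edge L p S \<sigma> S'))"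

definition er2 :: "('ag, 'p) lister \<Rightarrow> 'p \<Rightarrow> ('ag, 'p) tstate set \<Rightarrow> ('ag, 'p) tstate \<Rightarrow> bool" where
  "er2 L p T S \<longleftrightarrow> (\<exists>\<xi>\<in>fst S. gamma_formula \<xi> \<and> \<not> realized L p T \<xi> S)"

definition elim_step ::
  "('ag, 'p) lister \<Rightarrow> 'p \<Rightarrow> ('ag, 'p) tstate set \<Rightarrow> ('ag, 'p) tstate set \<Rightarrow> bool" where
  "elim_step L p T T' \<longleftrightarrow> (\<exists>S\<in>T. (er1 L p T S \<or> er2 L p T S) \<and> T' = T - {S})"

text \<open>\<open>T\<close> results from the initial tableau by deletions in some order and admits no further
  deletion. Such a \<open>T\<close> exists and is unique (lemma \<open>final_tableau_ex1\<close> below).\<close>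

definition final_tableau ::
  "('ag, 'p) lister \<Rightarrow> 'p \<Rightarrow> ('ag, 'p) sform \<Rightarrow> ('ag, 'p) tstate set \<Rightarrow> bool" where
  "final_tableau L p \<eta> T \<longleftrightarrow>
     (elim_step L p)\<^sup>*\<^sup>* (initial_tableau L p \<eta>) T \<and> (\<nexists>T'. elim_step L p T T')"

definition open_tableau :: "('ag, 'p) sform \<Rightarrow> ('ag, 'p) tstate set \<Rightarrow> bool" where
  "open_tableau \<eta> T \<longleftrightarrow> (\<exists>S\<in>T. \<eta> \<in> fst S)"


section \<open>Existence and uniqueness of the final tableau\<close>

lemmas pform_induct [case_names PState Next Always Until POr PAnd] =
  pform.induct[where ?P1.0 = "\<lambda>_. True", simplified]

primrec next_top_disjunct :: "'p \<Rightarrow> ('ag, 'p) pform \<Rightarrow> bool" where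
  "next_top_disjunct p (PState \<phi>) \<longleftrightarrow> False"
| "next_top_disjunct p (Next \<phi>) \<longleftrightarrow> \<phi> = Top p"
| "next_top_disjunct p (Always \<phi>) \<longleftrightarrow> False"
| "next_top_disjunct p (Until \<phi> \<psi>) \<longleftrightarrow> False"
| "next_top_disjunct p (POr \<Phi> \<Psi>) \<longleftrightarrow> next_top_disjunct p \<Phi> \<or> next_top_disjunct p \<Psi>"
| "next_top_disjunct p (PAnd \<Phi> \<Psi>) \<longleftrightarrow> False"

lemma nothing_left_redundant:
  assumes "(\<psi>, PState (Top p)) \<in> dec p \<Phi>" "\<psi> \<in> \<Delta>" "\<not> next_top_disjunct p \<Phi>"
  shows "Real \<Phi> \<Delta>"
  using assms by (induction \<Phi> rule: pform_induct) auto

primrec leaves :: "('ag, 'p) pform \<Rightarrow> ('ag, 'p) sform set" where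
  "leaves (PState \<phi>) = {\<phi>}"
| "leaves (Next \<phi>) = {\<phi>}"
| "leaves (Always \<phi>) = {\<phi>}"
| "leaves (Until \<phi> \<psi>) = {\<phi>, \<psi>}"
| "leaves (POr \<Phi> \<Psi>) = leaves \<Phi> \<union> leaves \<Psi>"
| "leaves (PAnd \<Phi> \<Psi>) = leaves \<Phi> \<union> leaves \<Psi>"

primrec residuals :: "'p \<Rightarrow> ('ag, 'p) pform \<Rightarrow> ('ag, 'p) pform set" where
  "residuals p (PState \<phi>) = {PState \<phi>, PState (Top p)}"
| "residuals p (Next \<phi>) = {Next \<phi>, PState \<phi>, PState (Top p)}"
| "residuals p (Always \<phi>) = {Always \<phi>}"
| "residuals p (Until \<phi> \<psi>) = {Until \<phi> \<psi>, PState (Top p)}"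
| "residuals p (POr \<Phi> \<Psi>) = residuals p \<Phi> \<union> residuals p \<Psi> \<union>
     (\<lambda>(\<Phi>', \<Psi>'). POr \<Phi>' \<Psi>') ` (residuals p \<Phi> \<times> residuals p \<Psi>)"
| "residuals p (PAnd \<Phi> \<Psi>) = (\<lambda>(\<Phi>', \<Psi>'). PAnd \<Phi>' \<Psi>') ` (residuals p \<Phi> \<times> residuals p \<Psi>)"

primrec conds :: "'p \<Rightarrow> ('ag, 'p) pform \<Rightarrow> ('ag, 'p) sform set" where
  "conds p (PState \<phi>) = {\<phi>, Top p}"
| "conds p (Next \<phi>) = {\<phi>, Top p}"
| "conds p (Always \<phi>) = {\<phi>}"
| "conds p (Until \<phi> \<psi>) = {\<phi>, \<psi>, Top p}"
| "conds p (POr \<Phi> \<Psi>) = conds p \<Phi> \<union> conds p \<Psi> \<union>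
     (\<lambda>(\<phi>, \<psi>). And \<phi> \<psi>) ` (conds p \<Phi> \<times> conds p \<Psi>)"
| "conds p (PAnd \<Phi> \<Psi>) = conds p \<Phi> \<union> conds p \<Psi> \<union>
     (\<lambda>(\<phi>, \<psi>). And \<phi> \<psi>) ` (conds p \<Phi> \<times> conds p \<Psi>)"

lemma finite_residuals: "finite (residuals p \<Phi>)"
  by (induction \<Phi> rule: pform_induct) auto

lemma finite_conds: "finite (conds p \<Phi>)"
  by (induction \<Phi> rule: pform_induct) auto

lemma self_residual: "\<Phi> \<in> residuals p \<Phi>"
  by (induction \<Phi> rule: pform_induct) auto

lemma dec_residuals: "\<Psi> \<in> residuals p \<Phi> \<Longrightarrow> dec p \<Psi> \<subseteq> conds p \<Phi> \<times> residuals p \<Phi>"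
proof (induction \<Phi> arbitrary: \<Psi> rule: pform_induct)
  case (POr \<Phi>1 \<Phi>2)
  consider "\<Psi> \<in> residuals p \<Phi>1" | "\<Psi> \<in> residuals p \<Phi>2"
    | \<Psi>1 \<Psi>2 where "\<Psi> = POr \<Psi>1 \<Psi>2" "\<Psi>1 \<in> residuals p \<Phi>1" "\<Psi>2 \<in> residuals p \<Phi>2"
    using POr.prems by auto
  then show ?case
  proof cases
    case 1
    then show ?thesis using POr.IH(1) by fastforce
  next
    case 2
    then show ?thesis using POr.IH(2) by fastforce
  next
    case 3
    have "dec p \<Psi>1 \<subseteq> conds p \<Phi>1 \<times> residuals p \<Phi>1" "dec p \<Psi>2 \<subseteq> conds p \<Phi>2 \<times> residuals p \<Phi>2"
      using POr.IH 3 by auto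
    then show ?thesis using 3 by (auto simp: image_iff)
  qed
next
  case (PAnd \<Phi>1 \<Phi>2)
  then obtain \<Psi>1 \<Psi>2 where 3: "\<Psi> = PAnd \<Psi>1 \<Psi>2" "\<Psi>1 \<in> residuals p \<Phi>1" "\<Psi>2 \<in> residuals p \<Phi>2"
    by auto
  have "dec p \<Psi>1 \<subseteq> conds p \<Phi>1 \<times> residuals p \<Phi>1" "dec p \<Psi>2 \<subseteq> conds p \<Phi>2 \<times> residuals p \<Phi>2"
    using PAnd.IH 3 by auto
  then show ?case using 3 by (auto simp: image_iff)
qed auto

lemma conds_cases:
  "\<phi> \<in> conds p \<Phi> \<Longrightarrow> \<phi> \<in> leaves \<Phi> \<or> \<phi> = Top p \<or> (\<exists>\<phi>1 \<phi>2. \<phi> = And \<phi>1 \<phi>2 \<and> \<phi>1 \<in> conds p \<Phi> \<and> \<phi>2 \<in> conds p \<Phi>)"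
  by (induction \<Phi> rule: pform_induct) auto

definition comps :: "'p \<Rightarrow> ('ag, 'p) sform \<Rightarrow> ('ag, 'p) sform set" where
  "comps p \<xi> = alpha_comps \<xi> \<union> beta_comps \<xi> \<union> gamma_comps p \<xi> \<union> succ_comps \<xi>"

lemma comps_simps:
  "comps p (Lit q) = {}" "comps p (NLit q) = {}"
  "comps p (Or \<phi> \<psi>) = {\<phi>, \<psi>}" "comps p (And \<phi> \<psi>) = {\<phi>, \<psi>}"
  "comps p (Coop A (Next \<phi>)) = {\<phi>}"
  "comps p (Unav A (Next \<phi>)) = (if A = UNIV then {Coop {} (Next \<phi>)} else {\<phi>})"
  by (auto simp: comps_def alpha_comps_def beta_comps_def gamma_comps_def succ_comps_def is_next_def)

lemma comps_Coop:
  "\<not> is_next \<Phi> \<Longrightarrow> comps p (Coop A \<Phi>) =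
    (\<lambda>(\<psi>, \<Psi>). if \<Psi> = PState (Top p) then \<psi> else And \<psi> (Coop A (Next (Coop A \<Psi>)))) ` dec p \<Phi>"
  by (cases \<Phi>)
    (auto simp: comps_def alpha_comps_def beta_comps_def gamma_comps_def succ_comps_def is_next_def)

lemma comps_Unav:
  "\<not> is_next \<Phi> \<Longrightarrow> comps p (Unav A \<Phi>) =
    (\<lambda>(\<psi>, \<Psi>). if \<Psi> = PState (Top p) then \<psi> else And \<psi> (Unav A (Next (Unav A \<Psi>)))) ` dec p \<Phi>"
  by (cases \<Phi>)
    (auto simp: comps_def alpha_comps_def beta_comps_def gamma_comps_def succ_comps_def is_next_def)

definition comp_closed :: "'p \<Rightarrow> ('ag, 'p) sform set \<Rightarrow> bool" where
  "comp_closed p K \<longleftrightarrow> (\<forall>\<xi>\<in>K. comps p \<xi> \<subseteq> K)"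

lemma comp_closed_Un: "comp_closed p K \<Longrightarrow> comp_closed p K' \<Longrightarrow> comp_closed p (K \<union> K')"
  by (auto simp: comp_closed_def)

lemma comp_closed_TopBot: "comp_closed p {Top p, Bot p, Lit p, NLit p}"
  by (auto simp: comp_closed_def comps_simps)

lemma finite_closed_extend:
  fixes C :: "('ag, 'p) pform \<Rightarrow> ('ag, 'p) sform"
  assumes K: "finite K" "comp_closed p K" "leaves \<Phi> \<subseteq> K"
    and C: "C = Coop A \<or> C = Unav A"
  shows "\<exists>K'. finite K' \<and> comp_closed p K' \<and> C \<Phi> \<in> K'"
proof -
  define R where "R = residuals p \<Phi>"
  define Q where "Q = conds p \<Phi>"
  define N where "N = (\<lambda>\<Psi>. C (Next (C \<Psi>))) ` R"
  define K' where "K' = K \<union> {Top p, Bot p, Lit p, NLit p} \<union> Q \<union> C ` R \<union> N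
    \<union> (\<lambda>\<Psi>. Coop {} (Next (C \<Psi>))) ` R \<union> (\<lambda>\<phi>. Coop {} (Next \<phi>)) ` leaves \<Phi>
    \<union> (\<lambda>(q, n). And q n) ` (Q \<times> N)"
  have lv: "finite (leaves \<Phi>)" using K finite_subset by blast
  have fin: "finite K'"
    unfolding K'_def N_def R_def Q_def using K(1) lv finite_residuals[of p \<Phi>] finite_conds[of p \<Phi>] by simp
  have nx: "\<phi> \<in> leaves \<Phi>" if "Next \<phi> \<in> R" for \<phi>
    using that unfolding R_def by (induction \<Phi> rule: pform_induct) auto
  have QK: "comps p \<xi> \<subseteq> K'" if "\<xi> \<in> Q" for \<xi>
  proof -
    from conds_cases[OF that[unfolded Q_def]] consider "\<xi> \<in> leaves \<Phi>" | "\<xi> = Top p"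
      | \<phi>1 \<phi>2 where "\<xi> = And \<phi>1 \<phi>2" "\<phi>1 \<in> Q" "\<phi>2 \<in> Q" unfolding Q_def by blast
    then show ?thesis
    proof cases
      case 1
      then show ?thesis using K(2,3) unfolding comp_closed_def K'_def by blast
    qed (auto simp: comps_simps K'_def)
  qed
  have RK: "comps p (C \<Psi>) \<subseteq> K'" if "\<Psi> \<in> R" for \<Psi>
  proof (cases "is_next \<Psi>")
    case True
    then obtain \<phi> where "\<Psi> = Next \<phi>" by (auto simp: is_next_def)
    then show ?thesis using C nx[of \<phi>] that K(3) by (auto simp: comps_simps K'_def split: if_splits)
  next
    case False
    have d: "dec p \<Psi> \<subseteq> Q \<times> R" using dec_residuals[OF that[unfolded R_def]] unfolding R_def Q_def .
    have "comps p (C \<Psi>) =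
      (\<lambda>(\<psi>, \<Psi>). if \<Psi> = PState (Top p) then \<psi> else And \<psi> (C (Next (C \<Psi>)))) ` dec p \<Psi>"
      using C by (elim disjE) (simp_all only: comps_Coop[OF False] comps_Unav[OF False])
    also have "\<dots> \<subseteq> K'"
    proof (clarsimp, intro conjI impI)
      fix \<psi> \<Psi>' assume "(\<psi>, \<Psi>') \<in> dec p \<Psi>"
      then have m: "\<psi> \<in> Q" "\<Psi>' \<in> R" using d by auto
      then show "\<psi> \<in> K'" by (simp add: K'_def)
      have "C (Next (C \<Psi>')) \<in> N" using m(2) by (simp add: N_def)
      then have "And \<psi> (C (Next (C \<Psi>'))) \<in> (\<lambda>(q, n). And q n) ` (Q \<times> N)" using m(1) by force
      then show "And \<psi> (C (Next (C \<Psi>'))) \<in> K'" by (simp add: K'_def)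
    qed
    finally show ?thesis .
  qed
  have NK: "comps p \<xi> \<subseteq> K'" if "\<xi> \<in> N" for \<xi>
    using that C unfolding N_def K'_def by (auto simp: comps_simps split: if_splits)
  have "comps p \<xi> \<subseteq> K'" if "\<xi> \<in> K'" for \<xi>
  proof -
    from that consider "\<xi> \<in> K \<union> {Top p, Bot p, Lit p, NLit p}" | "\<xi> \<in> Q" | \<Psi> where "\<xi> = C \<Psi>" "\<Psi> \<in> R"
      | "\<xi> \<in> N" | \<Psi> where "\<xi> = Coop {} (Next (C \<Psi>))" "\<Psi> \<in> R"
      | \<phi> where "\<xi> = Coop {} (Next \<phi>)" "\<phi> \<in> leaves \<Phi>"
      | q n where "\<xi> = And q n" "q \<in> Q" "n \<in> N"
      unfolding K'_def by auto
    then show ?thesis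
    proof cases
      case 1
      have "comp_closed p (K \<union> {Top p, Bot p, Lit p, NLit p})"
        using comp_closed_Un[OF K(2) comp_closed_TopBot] .
      then show ?thesis using 1 unfolding comp_closed_def K'_def by blast
    next
      case 6
      then show ?thesis using K(3) by (auto simp: comps_simps K'_def)
    next
      case 7
      then show ?thesis by (auto simp: comps_simps K'_def)
    next
      case 5
      then show ?thesis by (auto simp: comps_simps K'_def)
    qed (use QK RK NK in auto)
  qed
  then have "comp_closed p K'" by (auto simp: comp_closed_def)
  moreover have "C \<Phi> \<in> K'" using self_residual[of \<Phi> p] unfolding K'_def R_def by blast
  ultimately show ?thesis using fin by blast
qed

lemma finite_closed_insert:
  assumes "finite K" "comp_closed p K" "comps p \<xi> \<subseteq> K"
  shows "finite (insert \<xi> K) \<and> comp_closed p (insert \<xi> K) \<and> \<xi> \<in> insert \<xi> K"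
  using assms by (auto simp: comp_closed_def)

lemma finite_closed_ex:
  fixes \<phi> :: "('ag, 'p) sform" and \<Phi> :: "('ag, 'p) pform"
  shows "\<exists>K. finite K \<and> comp_closed p K \<and> \<phi> \<in> K" and "\<exists>K. finite K \<and> comp_closed p K \<and> leaves \<Phi> \<subseteq> K"
proof (induction \<phi> and \<Phi>)
  case (Lit q)
  show ?case by (rule exI[of _ "{Lit q}"]) (auto simp: comp_closed_def comps_simps)
next
  case (NLit q)
  show ?case by (rule exI[of _ "{NLit q}"]) (auto simp: comp_closed_def comps_simps)
next
  case (Or \<phi> \<psi>)
  then obtain K K' where "finite K" "comp_closed p K" "\<phi> \<in> K" "finite K'" "comp_closed p K'" "\<psi> \<in> K'" by blast
  then have "finite (K \<union> K')" "comp_closed p (K \<union> K')" "comps p (Or \<phi> \<psi>) \<subseteq> K \<union> K'"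
    by (auto simp: comp_closed_Un comps_simps)
  from finite_closed_insert[OF this] show ?case by blast
next
  case (And \<phi> \<psi>)
  then obtain K K' where "finite K" "comp_closed p K" "\<phi> \<in> K" "finite K'" "comp_closed p K'" "\<psi> \<in> K'" by blast
  then have "finite (K \<union> K')" "comp_closed p (K \<union> K')" "comps p (And \<phi> \<psi>) \<subseteq> K \<union> K'"
    by (auto simp: comp_closed_Un comps_simps)
  from finite_closed_insert[OF this] show ?case by blast
next
  case (Coop A \<Phi>)
  then show ?case using finite_closed_extend[of _ p \<Phi> "Coop A" A] by blast
next
  case (Unav A \<Phi>)
  then show ?case using finite_closed_extend[of _ p \<Phi> "Unav A" A] by blast
next
  case (Until \<phi> \<psi>)
  then obtain K K' where "finite K" "comp_closed p K" "\<phi> \<in> K" "finite K'" "comp_closed p K'" "\<psi> \<in> K'" by blast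
  then show ?case by (intro exI[of _ "K \<union> K'"]) (auto simp: comp_closed_Un)
next
  case (POr \<Phi> \<Psi>)
  then obtain K K' where "finite K" "comp_closed p K" "leaves \<Phi> \<subseteq> K" "finite K'" "comp_closed p K'" "leaves \<Psi> \<subseteq> K'"
    by blast
  then show ?case by (intro exI[of _ "K \<union> K'"]) (auto simp: comp_closed_Un)
next
  case (PAnd \<Phi> \<Psi>)
  then obtain K K' where "finite K" "comp_closed p K" "leaves \<Phi> \<subseteq> K" "finite K'" "comp_closed p K'" "leaves \<Psi> \<subseteq> K'"
    by blast
  then show ?case by (intro exI[of _ "K \<union> K'"]) (auto simp: comp_closed_Un)
qed auto

lemma cl_subset:
  assumes "comp_closed p K" "\<Gamma> \<subseteq> K" "Top p \<in> K" "Bot p \<in> K"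
  shows "cl p \<Gamma> \<subseteq> K"
proof
  fix \<phi> assume "\<phi> \<in> cl p \<Gamma>"
  then show "\<phi> \<in> K"
    by induction (use assms in \<open>auto simp: comp_closed_def comps_def\<close>)
qed

text \<open>A finite set that contains all formulae the procedure can ever write for \<open>\<eta>\<close>.\<close>

definition universe :: "'p \<Rightarrow> ('ag, 'p) sform \<Rightarrow> ('ag, 'p) sform set \<Rightarrow> bool" where
  "universe p \<eta> K \<longleftrightarrow> finite K \<and> comp_closed p K \<and> \<eta> \<in> K \<and> Top p \<in> K \<and> Bot p \<in> K \<and>
     Coop UNIV (Next (Top p)) \<in> K"

lemma universe_ex: "\<exists>K. universe p \<eta> K"
proof -
  obtain K where K: "finite K" "comp_closed p K" "\<eta> \<in> K" using finite_closed_ex(1)[of p \<eta>] by blast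
  let ?K = "K \<union> {Top p, Bot p, Lit p, NLit p} \<union> {Coop UNIV (Next (Top p))}"
  have "comp_closed p ?K"
    using comp_closed_Un[OF K(2) comp_closed_TopBot] by (auto simp: comp_closed_def comps_simps)
  then show ?thesis using K by (intro exI[of _ ?K]) (auto simp: universe_def)
qed

definition states_over :: "('ag, 'p) sform set \<Rightarrow> ('ag, 'p) tstate set" where
  "states_over K = {(\<Delta>, \<gamma>). \<Delta> \<subseteq> K \<and> dom \<gamma> \<subseteq> K \<and> ran \<gamma> \<subseteq> K}"

lemma finite_states_over:
  assumes "finite K"
  shows "finite (states_over K)"
proof -
  have "states_over K \<subseteq> Pow K \<times> (\<Union>D\<in>Pow K. {\<gamma>. dom \<gamma> = D \<and> ran \<gamma> \<subseteq> K})"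
    by (auto simp: states_over_def)
  moreover have "finite (Pow K \<times> (\<Union>D\<in>Pow K. {\<gamma>. dom \<gamma> = D \<and> ran \<gamma> \<subseteq> K}))"
    using assms by (auto intro!: finite_set_of_finite_maps dest: finite_subset)
  ultimately show ?thesis by (rule finite_subset)
qed

lemma sr_edge_states_over:
  assumes "sr_edge p \<Gamma> S" "\<Gamma> \<subseteq> K" "universe p \<eta> K"
  shows "S \<in> states_over K"
proof -
  obtain \<Delta> \<gamma> where f: "full_expansion p \<Gamma> (\<Delta>, \<gamma>)" and S: "S = sr_complete p (\<Delta>, \<gamma>)"
    using assms(1) by (auto simp: sr_edge_def)
  have "\<Delta> \<subseteq> K"
    using f cl_subset[of p K \<Gamma>] assms(2,3) by (auto simp: full_expansion_def universe_def)
  moreover from this f have "dom \<gamma> \<subseteq> K" "ran \<gamma> \<subseteq> K"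
    unfolding full_expansion_def ran_def by auto
  ultimately show ?thesis
    using assms(3) by (auto simp: S sr_complete_def states_over_def universe_def)
qed

lemma next_prestate_subset:
  assumes "listing L" "S \<in> states_over K" "universe p \<eta> K"
  shows "next_prestate L p S \<sigma> \<subseteq> K"
proof -
  obtain \<Delta> \<gamma> where S: "S = (\<Delta>, \<gamma>)" by fastforce
  obtain cs us where L: "L (\<Delta>, \<gamma>) = (cs, us)" by fastforce
  have D: "\<Delta> \<subseteq> K" "finite \<Delta>" and K: "\<forall>\<xi>\<in>K. comps p \<xi> \<subseteq> K"
    using assms(2,3) S by (auto simp: states_over_def universe_def comp_closed_def dest: finite_subset)
  have sets: "set cs = {(A, \<phi>). Coop A (Next \<phi>) \<in> \<Delta>}"
    "set us = {(A, \<psi>). Unav A (Next \<psi>) \<in> \<Delta> \<and> A \<noteq> UNIV}"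
    using assms(1) D(2) L unfolding listing_def by (metis (mono_tags, lifting) case_prod_conv)+
  have "\<phi> \<in> K" if "(A, \<phi>) \<in> set cs \<or> (A, \<phi>) \<in> set us" for A \<phi>
  proof -
    have "Coop A (Next \<phi>) \<in> K \<or> Unav A (Next \<phi>) \<in> K \<and> A \<noteq> UNIV" using that sets D(1) by auto
    then have "\<phi> \<in> comps p (Coop A (Next \<phi>)) \<and> Coop A (Next \<phi>) \<in> K \<or>
      \<phi> \<in> comps p (Unav A (Next \<phi>)) \<and> Unav A (Next \<phi>) \<in> K"
      by (auto simp: comps_simps)
    then show ?thesis using K by blast
  qed
  then have "\<phi> \<in> K" if "n < length cs \<and> cs ! n = (A, \<phi>) \<or> n < length us \<and> us ! n = (A, \<phi>)" for n A \<phi>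
    using that by (metis nth_mem)
  then show ?thesis
    using assms(3) by (auto simp: next_prestate_def S L universe_def Let_def)
qed

lemma pretableau_over:
  assumes "listing L" "universe p \<eta> K"
  shows "prestate L p \<eta> \<Gamma> \<Longrightarrow> \<Gamma> \<subseteq> K" and "tableau_state L p \<eta> S \<Longrightarrow> S \<in> states_over K"
proof (induction rule: prestate_tableau_state.inducts)
  case init
  show ?case using assms by (auto simp: universe_def)
next
  case (sr \<Gamma> S)
  show ?case using sr_edge_states_over[OF sr(3) sr(2) assms(2)] .
next
  case (nxt S \<sigma>)
  show ?case using next_prestate_subset[OF assms(1) nxt(2) assms(2)] .
qed

lemma pretableau_label_finite:
  assumes "listing L" "tableau_state L p \<eta> S"
  shows "finite (fst S)"
proof -
  obtain K where K: "universe p \<eta> K" using universe_ex[of p \<eta>] by blast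
  have "S \<in> states_over K" using pretableau_over(2)[OF assms(1) K assms(2)] .
  then show ?thesis using K
    by (auto simp: states_over_def universe_def dest: finite_subset)
qed

lemma finite_initial_tableau:
  assumes "listing L"
  shows "finite (initial_tableau L p \<eta>)"
proof -
  obtain K where K: "universe p \<eta> K" using universe_ex[of p \<eta>] by blast
  then have "initial_tableau L p \<eta> \<subseteq> states_over K"
    using pretableau_over(2)[OF assms] by (auto simp: initial_tableau_def)
  then show ?thesis using finite_subset finite_states_over[of K] K
    unfolding universe_def by blast
qed

lemma realized_mono:
  assumes "realized L p T \<xi> S" "T \<subseteq> T'"
  shows "realized L p T' \<xi> S"
  using assms(1)
proof induction
  case (now \<Delta> \<gamma> \<xi> A \<Phi>)
  show ?case by (rule realized.now[OF _ now(2-5)]) (use now(1) assms(2) in blast)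
next
  case (nothing_left \<Delta> \<gamma> \<xi> A \<Phi> \<psi>)
  have "(\<Delta>, \<gamma>) \<in> T'" using nothing_left(1) assms(2) by blast
  then show ?case using nothing_left(2-6) by (rule realized.nothing_left)
next
  case (coop \<Delta> \<gamma> A \<Phi> \<psi> \<xi>' n)
  have "(\<Delta>, \<gamma>) \<in> T'" using coop(1) assms(2) by blast
  moreover have "\<forall>\<sigma>\<in>coop_moves L (\<Delta>, \<gamma>) A n. \<exists>S'\<in>T'. edge L p (\<Delta>, \<gamma>) \<sigma> S' \<and> realized L p T' \<xi>' S'"
    using coop(7) assms(2) by blast
  ultimately show ?case using coop(2-6) by (simp add: realized.coop)
next
  case (unav \<Delta> \<gamma> A \<Phi> \<psi> \<xi>' q)
  have "(\<Delta>, \<gamma>) \<in> T'" using unav(1) assms(2) by blast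
  moreover have "\<forall>\<sigma>\<in>unav_moves L (\<Delta>, \<gamma>) A q. \<exists>S'\<in>T'. edge L p (\<Delta>, \<gamma>) \<sigma> S' \<and> realized L p T' \<xi>' S'"
    using unav(7) assms(2) by blast
  ultimately show ?case using unav(2-6) by (simp add: realized.unav)
next
  case (unav_all \<Delta> \<gamma> \<Phi> \<psi> \<xi>' n)
  have "(\<Delta>, \<gamma>) \<in> T'" using unav_all(1) assms(2) by blast
  moreover have "\<forall>\<sigma>\<in>coop_moves L (\<Delta>, \<gamma>) {} n. \<exists>S'\<in>T'. edge L p (\<Delta>, \<gamma>) \<sigma> S' \<and> realized L p T' \<xi>' S'"
    using unav_all(7) assms(2) by blast
  ultimately show ?case using unav_all(2-6) by (simp add: realized.unav_all)
qed

lemma er_antimono: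
  assumes "er1 L p T' S \<or> er2 L p T' S" "T \<subseteq> T'"
  shows "er1 L p T S \<or> er2 L p T S"
  using assms realized_mono[OF _ assms(2)] unfolding er1_def er2_def by blast

lemma elim_le: "(elim_step L p)\<^sup>*\<^sup>* T T' \<Longrightarrow> T' \<subseteq> T"
  by (induction rule: rtranclp_induct) (auto simp: elim_step_def)

lemma final_below:
  assumes "(elim_step L p)\<^sup>*\<^sup>* T0 T" "F \<subseteq> T0" "\<nexists>F'. elim_step L p F F'"
  shows "F \<subseteq> T"
  using assms(1)
proof (induction rule: rtranclp_induct)
  case base
  show ?case by (fact assms(2))
next
  case (step T T')
  then obtain S where S: "er1 L p T S \<or> er2 L p T S" "T' = T - {S}" by (auto simp: elim_step_def)
  have "S \<notin> F"
    using er_antimono[OF S(1) step.IH] assms(3) unfolding elim_step_def by blast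
  then show ?case using S step.IH by blast
qed

lemma elim_terminates:
  assumes "finite T"
  shows "\<exists>T'. (elim_step L p)\<^sup>*\<^sup>* T T' \<and> (\<nexists>T''. elim_step L p T' T'')"
  using assms
proof (induction T rule: finite_psubset_induct)
  case (psubset T)
  show ?case
  proof (cases "\<exists>T'. elim_step L p T T'")
    case True
    then obtain T' where T': "elim_step L p T T'" by blast
    then have "T' \<subset> T" by (auto simp: elim_step_def)
    from psubset.IH[OF this] show ?thesis
      using T' by (meson converse_rtranclp_into_rtranclp)
  qed blast
qed

lemma final_tableau_ex1:
  assumes "listing L"
  shows "\<exists>!T. final_tableau L p \<eta> T"
proof (rule ex_ex1I)
  show "\<exists>T. final_tableau L p \<eta> T"
    using elim_terminates[OF finite_initial_tableau[OF assms]] by (auto simp: final_tableau_def)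
next
  fix T T' assume "final_tableau L p \<eta> T" "final_tableau L p \<eta> T'"
  then have "T \<subseteq> T'" "T' \<subseteq> T"
    unfolding final_tableau_def by (meson final_below elim_le)+
  then show "T = T'" by blast
qed

lemma listing_ex: "\<exists>L. listing (L :: ('ag, 'p) lister)"
proof -
  define L :: "('ag, 'p) lister" where "L = (\<lambda>(\<Delta>, \<gamma>).
    (SOME cs. distinct cs \<and> set cs = {(A, \<phi>). Coop A (Next \<phi>) \<in> \<Delta>},
     SOME us. distinct us \<and> set us = {(A, \<psi>). Unav A (Next \<psi>) \<in> \<Delta> \<and> A \<noteq> UNIV}))"
  have ex: "\<exists>xs. distinct xs \<and> set xs = X" if "finite X" for X :: "('ag set \<times> ('ag, 'p) sform) set"
    using finite_distinct_list[OF that] by blast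
  have "listing L"
    unfolding listing_def
  proof (intro allI impI)
    fix \<Delta> :: "('ag, 'p) sform set" and \<gamma> assume fin: "finite \<Delta>"
    have "finite ((\<lambda>(A, \<phi>). Coop A (Next \<phi>)) -` \<Delta>)" "finite ((\<lambda>(A, \<phi>). Unav A (Next \<phi>)) -` \<Delta>)"
      using fin by (auto intro!: finite_vimageI injI)
    then have f: "finite {(A, \<phi>). Coop A (Next \<phi>) \<in> \<Delta>}"
      "finite {(A, \<psi>). Unav A (Next \<psi>) \<in> \<Delta> \<and> A \<noteq> UNIV}"
      by - (erule rev_finite_subset, force)+
    show "case L (\<Delta>, \<gamma>) of (cs, us) \<Rightarrow>
        distinct cs \<and> set cs = {(A, \<phi>). Coop A (Next \<phi>) \<in> \<Delta>} \<and>
        distinct us \<and> set us = {(A, \<psi>). Unav A (Next \<psi>) \<in> \<Delta> \<and> A \<noteq> UNIV}"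
      using someI_ex[OF ex[OF f(1)]] someI_ex[OF ex[OF f(2)]] by (simp add: L_def)
  qed
  then show ?thesis by (rule exI[of listing L])
qed

end

theory Submission
  imports Defs
begin

text \<open>
  Fix a model of \<open>\<eta>\<close>. The tableau states whose label holds at some state of the model, whatever their
  linking, are never eliminated. For the move rule, a profile of the model that simulates the votes
  leads to a state where the next prestate holds, and the formulae of the closure that are true there
  form a full expansion. For a \<open>\<gamma>\<close>-formula, always link to the pair of the decomposition with the
  weakest residual. If this never realized the formula, the coalition's strategy would admit a play
  that violates it (for \<open>\<langle>\<langle>A\<rangle>\<rangle>\<close>), or \<open>A\<close> could glue its choices along the tableau into a strategy that
  avoids it (for \<open>[[A]]\<close>): a play that satisfies the path formula is realized from some point on.
\<close>

section \<open>Plays and strategies\<close>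

text \<open>The surviving states carry arbitrary linkings, so the link of a given state may make no
  progress. It is nevertheless a true formula of the label: its residual \<open>C \<Psi>\<close>
  holds at a suitable successor, and there an expansion with the canonical link may be chosen. For
  successors it is therefore enough that some expansion of the prestate realizes
  \<open>C \<Psi>\<close>.

  An argument about single plays does not suffice, since realization is inductive and asks for a
  successor under every vector of votes. Models may branch infinitely, so the number of steps up to
  realization need not be bounded, and the rank is a well-founded derivation
  (\<open>attains\<close>) instead of a number. Each of its steps comes with a target set
  \<open>Y\<close>. The successor chosen in the model has to lie in \<open>Y\<close> and at the same
  time satisfy all other formulae that the votes activate.\<close>

lemma hist_0 [simp]: "hist \<pi> 0 = [\<pi> 0]"
  by (simp add: hist_def)

lemma hist_Suc: "hist \<pi> (Suc i) = hist \<pi> i @ [\<pi> (Suc i)]"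
  by (simp add: hist_def)

lemma last_hist [simp]: "last (hist \<pi> i) = \<pi> i"
  by (simp add: hist_def)

lemma butlast_hist [simp]: "butlast (hist \<pi> i) = map \<pi> [0..<i]"
  by (simp add: hist_def)

lemma length_hist [simp]: "length (hist \<pi> i) = Suc i"
  by (simp add: hist_def)

lemma take_hist: "j \<le> i \<Longrightarrow> take (Suc j) (hist \<pi> i) = hist \<pi> j"
  unfolding hist_def by (simp add: take_map del: upt_Suc)

lemma drop_hist: "j \<le> i \<Longrightarrow> drop j (hist \<pi> i) = hist (\<lambda>n. \<pi> (n + j)) (i - j)"
  unfolding hist_def by (rule nth_equalityI) (auto simp: add.commute simp del: upt_Suc)

lemma hist_case_nat: "hist (case_nat s \<pi>) (Suc i) = s # hist \<pi> i"
  unfolding hist_def by (rule nth_equalityI) (auto simp: nth_Cons split: nat.split simp del: upt_Suc)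

lemma hist_shift_Suc: "hist \<pi> (Suc i) = \<pi> 0 # hist (\<lambda>n. \<pi> (Suc n)) i"
  unfolding hist_def by (rule nth_equalityI) (auto simp: nth_Cons split: nat.split simp del: upt_Suc)

text \<open>\<open>eff_coop\<close> is alpha-effectivity of \<open>A\<close>, and
  \<open>eff_unav\<close> below is beta-effectivity of the complement of \<open>A\<close>. The
  target is a set rather than a formula, because it will also have to express progress towards
  realization.\<close>

definition eff_coop :: "('ag, 'p, 's, 'c) cgm \<Rightarrow> 'ag set \<Rightarrow> 's \<Rightarrow> 's set \<Rightarrow> bool" where
  "eff_coop M A s Y \<longleftrightarrow>
     (\<exists>\<alpha>\<in>actions M A s. \<forall>\<tau>\<in>profiles M s. (\<forall>a\<in>A. \<tau> a = \<alpha> a) \<longrightarrow> out M s \<tau> \<in> Y)"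

definition eff_unav :: "('ag, 'p, 's, 'c) cgm \<Rightarrow> 'ag set \<Rightarrow> 's \<Rightarrow> 's set \<Rightarrow> bool" where
  "eff_unav M A s Y \<longleftrightarrow>
     (\<forall>\<alpha>\<in>actions M A s. \<exists>\<tau>\<in>profiles M s. (\<forall>a\<in>A. \<tau> a = \<alpha> a) \<and> out M s \<tau> \<in> Y)"

lemma actions_mem: "\<alpha> \<in> actions M A s \<Longrightarrow> a \<in> A \<Longrightarrow> \<alpha> a \<in> act M a s"
  by (auto simp: actions_def)

lemma profiles_iff: "\<tau> \<in> profiles M s \<longleftrightarrow> (\<forall>a. \<tau> a \<in> act M a s)"
  by (auto simp: actions_def PiE_iff)

lemma strategies_mem: "F \<in> strategies M A \<Longrightarrow> h \<in> histories M \<Longrightarrow> F h \<in> actions M A (last h)"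
  by (auto simp: strategies_def)

lemma histories_hist: "\<pi> \<in> plays M \<Longrightarrow> hist \<pi> i \<in> histories M"
  by (auto simp: histories_def)

context
  fixes M :: "('ag, 'p, 's, 'c) cgm"
  assumes cgm: "is_cgm M"
begin

lemma act_ne: "s \<in> St M \<Longrightarrow> act M a s \<noteq> {}"
  using cgm by (auto simp: is_cgm_def)

lemma out_St: "s \<in> St M \<Longrightarrow> \<tau> \<in> profiles M s \<Longrightarrow> out M s \<tau> \<in> St M"
  using cgm by (auto simp: is_cgm_def)

lemma play_St: "\<pi> \<in> plays M \<Longrightarrow> \<pi> i \<in> St M"
  by (induction i) (use out_St in \<open>force simp: plays_def\<close>)+

lemma last_history_St: "h \<in> histories M \<Longrightarrow> last h \<in> St M"
  using play_St by (auto simp: histories_def)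

lemma actions_ex: "s \<in> St M \<Longrightarrow> \<exists>\<alpha>. \<alpha> \<in> actions M A s"
  using act_ne by (fastforce simp: actions_def PiE_eq_empty_iff ex_in_conv)

lemma extend_action:
  assumes "s \<in> St M" "\<alpha> \<in> actions M A s"
  shows "\<exists>\<tau>\<in>profiles M s. \<forall>a\<in>A. \<tau> a = \<alpha> a"
proof -
  obtain \<tau> where "\<tau> \<in> profiles M s" using actions_ex[OF assms(1)] by blast
  then have "(\<lambda>a. if a \<in> A then \<alpha> a else \<tau> a) \<in> profiles M s"
    using actions_mem[OF assms(2)] by (simp add: profiles_iff)
  then show ?thesis by (rule bexI[rotated]) simp
qed

section \<open>Existence of plays and closure properties of histories\<close>

lemma play_ex:
  assumes "s \<in> St M"
  shows "\<exists>\<pi>\<in>plays M. \<pi> 0 = s"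
proof -
  have "\<forall>t. \<exists>\<tau>. t \<in> St M \<longrightarrow> \<tau> \<in> profiles M t" using actions_ex by blast
  then obtain P where P: "\<And>t. t \<in> St M \<Longrightarrow> P t \<in> profiles M t" by metis
  define \<pi> where "\<pi> n = ((\<lambda>t. out M t (P t)) ^^ n) s" for n
  have St: "\<pi> n \<in> St M" for n
    by (induction n) (use assms out_St P in \<open>auto simp: \<pi>_def\<close>)
  have "\<pi> (Suc n) = out M (\<pi> n) (P (\<pi> n))" for n by (simp add: \<pi>_def)
  then have "\<pi> \<in> plays M" using St P by (auto simp: plays_def)
  then show ?thesis by (rule bexI[rotated]) (simp add: \<pi>_def)
qed

lemma singleton_history: "s \<in> St M \<Longrightarrow> [s] \<in> histories M"
  using play_ex[of s] histories_hist[of _ M 0] by auto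

lemma play_shift: "\<pi> \<in> plays M \<Longrightarrow> (\<lambda>n. \<pi> (n + j)) \<in> plays M"
  using play_St[of \<pi> j] by (auto simp: plays_def)

lemma play_Cons:
  assumes "\<pi> \<in> plays M" "s \<in> St M" "\<tau> \<in> profiles M s" "\<pi> 0 = out M s \<tau>"
  shows "case_nat s \<pi> \<in> plays M"
  using assms by (auto simp: plays_def split: nat.split)

lemma drop_history:
  assumes "h \<in> histories M" "j < length h"
  shows "drop j h \<in> histories M" "last (drop j h) = last h"
  using assms histories_hist[OF play_shift] by (auto simp: histories_def drop_hist)

text \<open>Histories are by definition prefixes of infinite plays, so one more step needs an
  infinite continuation: an arbitrary play \<rho> from the new state is spliced on.\<close>

lemma history_snoc:
  assumes "h \<in> histories M" "\<tau> \<in> profiles M (last h)"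
  shows "h @ [out M (last h) \<tau>] \<in> histories M"
proof -
  obtain \<pi> i where \<pi>: "\<pi> \<in> plays M" "h = hist \<pi> i" using assms(1) by (auto simp: histories_def)
  have \<tau>: "\<tau> \<in> profiles M (\<pi> i)" using assms(2) \<pi>(2) by simp
  obtain \<rho> where \<rho>: "\<rho> \<in> plays M" "\<rho> 0 = out M (\<pi> i) \<tau>"
    using play_ex[OF out_St[OF play_St[OF \<pi>(1)] \<tau>]] by blast
  define \<kappa> where "\<kappa> n = (if n \<le> i then \<pi> n else \<rho> (n - Suc i))" for n
  have "\<exists>\<sigma>\<in>profiles M (\<kappa> n). \<kappa> (Suc n) = out M (\<kappa> n) \<sigma>" for n
  proof -
    consider "n < i" | "n = i" | "i < n" by linarith
    then show ?thesis
    proof cases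
      case 1
      then show ?thesis using \<pi>(1) by (auto simp: \<kappa>_def plays_def)
    next
      case 2
      then show ?thesis using \<tau> \<rho>(2) by (auto simp: \<kappa>_def)
    next
      case 3
      then have "Suc n - Suc i = Suc (n - Suc i)" by simp
      then show ?thesis using 3 \<rho>(1) by (auto simp: \<kappa>_def plays_def)
    qed
  qed
  moreover have "\<kappa> 0 \<in> St M" using play_St[OF \<pi>(1)] by (simp add: \<kappa>_def)
  ultimately have "\<kappa> \<in> plays M" by (simp add: plays_def)
  moreover have "hist \<kappa> (Suc i) = h @ [out M (last h) \<tau>]"
    by (simp add: \<pi>(2) hist_Suc) (simp add: \<kappa>_def \<rho>(2) hist_def)
  ultimately show ?thesis using histories_hist by metis
qed

text \<open>The iteration runs on histories, not on states, because the profile chosen by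
  \<open>P\<close> may depend on the whole past.\<close>

lemma play_following:
  assumes "s \<in> St M" and P: "\<And>h. h \<in> histories M \<Longrightarrow> P h \<in> profiles M (last h)"
  shows "\<exists>\<pi>\<in>plays M. \<pi> 0 = s \<and> (\<forall>i. \<pi> (Suc i) = out M (\<pi> i) (P (hist \<pi> i)))"
proof -
  define H where "H n = ((\<lambda>h. h @ [out M (last h) (P h)]) ^^ n) [s]" for n
  have H: "H 0 = [s]" "H (Suc n) = H n @ [out M (last (H n)) (P (H n))]" for n
    by (simp_all add: H_def)
  have mem: "H n \<in> histories M" for n
    by (induction n) (use H singleton_history[OF assms(1)] history_snoc P in auto)
  define \<pi> where "\<pi> n = last (H n)" for n
  have hist: "H n = hist \<pi> n" for n
  proof (induction n)
    case 0
    show ?case by (simp add: H \<pi>_def)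
  next
    case (Suc n)
    have "\<pi> (Suc n) = out M (last (H n)) (P (H n))" by (simp add: \<pi>_def H)
    then show ?case using Suc by (simp add: H hist_Suc)
  qed
  have step: "\<pi> (Suc n) = out M (\<pi> n) (P (hist \<pi> n))" for n
  proof -
    have "\<pi> (Suc n) = out M (last (H n)) (P (H n))" by (simp add: \<pi>_def H)
    then show ?thesis by (simp add: hist)
  qed
  moreover have "P (hist \<pi> n) \<in> profiles M (\<pi> n)" for n
    using P[OF mem, of n] by (simp add: hist)
  moreover have "\<pi> 0 = s" by (simp add: \<pi>_def H)
  ultimately have "\<pi> \<in> plays M" using assms(1) by (auto simp: plays_def)
  then show ?thesis using step \<open>\<pi> 0 = s\<close> by blast
qed

text \<open>\<open>F\<close> fixes only the actions of \<open>A\<close> at the first step.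
  Prescribing the whole first profile \<tau> shows that every successor allowed by \<open>F\<close>
  is reached by a consistent play.\<close>

lemma consistent_play_ex:
  assumes "F \<in> strategies M A" "s \<in> St M" "\<tau> \<in> profiles M s" "\<forall>a\<in>A. \<tau> a = F [s] a"
  shows "\<exists>\<pi>\<in>plays M. \<pi> 0 = s \<and> \<pi> 1 = out M s \<tau> \<and> consistent M A F \<pi>"
proof -
  have "\<exists>\<rho>\<in>profiles M (last h). (\<forall>a\<in>A. \<rho> a = F h a) \<and> (h = [s] \<longrightarrow> \<rho> = \<tau>)"
    if "h \<in> histories M" for h
    using extend_action[OF last_history_St strategies_mem, OF that assms(1) that] assms(3,4)
    by (cases "h = [s]") auto
  then obtain P where P: "\<And>h. h \<in> histories M \<Longrightarrow>
      P h \<in> profiles M (last h) \<and> (\<forall>a\<in>A. P h a = F h a) \<and> (h = [s] \<longrightarrow> P h = \<tau>)"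
    by metis
  obtain \<pi> where \<pi>: "\<pi> \<in> plays M" "\<pi> 0 = s" "\<And>i. \<pi> (Suc i) = out M (\<pi> i) (P (hist \<pi> i))"
    using play_following[of s P] P assms(2) by blast
  have "consistent M A F \<pi>"
    unfolding consistent_def using P[OF histories_hist[OF \<pi>(1)]] \<pi>(3) by auto
  moreover have "\<pi> 1 = out M s \<tau>"
    using \<pi>(3)[of 0] \<pi>(2) P[OF singleton_history[OF assms(2)]] by simp
  ultimately show ?thesis using \<pi> by blast
qed

lemma consistent_play_ex0:
  assumes "F \<in> strategies M A" "s \<in> St M"
  shows "\<exists>\<pi>\<in>plays M. \<pi> 0 = s \<and> consistent M A F \<pi>"
  using consistent_play_ex[OF assms]
    extend_action[OF assms(2), of "F [s]" A] strategies_mem[OF assms(1) singleton_history[OF assms(2)]]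
  by auto

section \<open>Construction of strategies by gluing and shifting\<close>

lemma strategyI:
  assumes "\<And>h. h \<in> histories M \<Longrightarrow> f h \<in> actions M A (last h)"
  shows "restrict f (histories M) \<in> strategies M A"
  using assms by (auto simp: strategies_def)

lemma strategies_ex: "\<exists>F. F \<in> strategies M A"
proof -
  have "\<forall>h. \<exists>\<alpha>. h \<in> histories M \<longrightarrow> \<alpha> \<in> actions M A (last h)"
    using actions_ex[OF last_history_St] by blast
  then obtain f where "\<And>h. h \<in> histories M \<Longrightarrow> f h \<in> actions M A (last h)" by metis
  from strategyI[OF this] show ?thesis by blast
qed

text \<open>Follow \<open>f\<close> until the first prefix of the history that satisfies \<open>stop\<close>, then switch to the
  strategy attached to this prefix, which sees only the part of the history from there on.\<close>

lemma glue_strategies: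
  assumes f: "\<And>h. h \<in> histories M \<Longrightarrow> f h \<in> actions M A (last h)"
    and G: "\<And>h. h \<in> histories M \<Longrightarrow> stop h \<Longrightarrow> G h \<in> strategies M A"
  obtains F where "F \<in> strategies M A"
    "\<And>\<pi> i. \<pi> \<in> plays M \<Longrightarrow> consistent M A F \<pi> \<Longrightarrow> (\<And>j. j \<le> i \<Longrightarrow> \<not> stop (hist \<pi> j)) \<Longrightarrow>
       \<exists>\<tau>\<in>profiles M (\<pi> i). (\<forall>a\<in>A. \<tau> a = f (hist \<pi> i) a) \<and> \<pi> (Suc i) = out M (\<pi> i) \<tau>"
    "\<And>\<pi> j. \<pi> \<in> plays M \<Longrightarrow> consistent M A F \<pi> \<Longrightarrow> stop (hist \<pi> j) \<Longrightarrow>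
       (\<And>k. k < j \<Longrightarrow> \<not> stop (hist \<pi> k)) \<Longrightarrow>
       consistent M A (G (hist \<pi> j)) (\<lambda>n. \<pi> (n + j))"
proof -
  \<comment> \<open>The state at position \<open>j\<close> is kept on both sides of the cut, by
    \<open>take (Suc j)\<close> and by \<open>drop j\<close>: the attached strategy reads histories
    that start at the state where it takes over.\<close>
  define Q where "Q h j \<longleftrightarrow> j < length h \<and> stop (take (Suc j) h)" for h j
  define F where "F = restrict (\<lambda>h. if \<exists>j. Q h j
      then G (take (Suc (LEAST j. Q h j)) h) (drop (LEAST j. Q h j) h) else f h) (histories M)"
  have take_mem: "take (Suc j) h \<in> histories M" if "h \<in> histories M" "j < length h" for h j
    using that histories_hist by (auto simp: histories_def take_hist)
  have "F \<in> strategies M A"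
    unfolding F_def
  proof (rule strategyI)
    fix h assume h: "h \<in> histories M"
    show "(if \<exists>j. Q h j then G (take (Suc (LEAST j. Q h j)) h) (drop (LEAST j. Q h j) h) else f h)
      \<in> actions M A (last h)"
    proof (cases "\<exists>j. Q h j")
      case True
      then have q: "Q h (LEAST j. Q h j)" by (rule LeastI_ex)
      define j where "j = (LEAST j. Q h j)"
      have "j < length h" "stop (take (Suc j) h)" using q by (auto simp: Q_def j_def)
      then have "G (take (Suc j) h) \<in> strategies M A" using G take_mem[OF h] by blast
      from strategies_mem[OF this drop_history(1)[OF h \<open>j < length h\<close>]]
      show ?thesis using True drop_history(2)[OF h \<open>j < length h\<close>] by (simp add: j_def)
    qed (use f h in simp)
  qed
  moreover have "\<exists>\<tau>\<in>profiles M (\<pi> i). (\<forall>a\<in>A. \<tau> a = f (hist \<pi> i) a) \<and> \<pi> (Suc i) = out M (\<pi> i) \<tau>"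
    if "\<pi> \<in> plays M" "consistent M A F \<pi>" "\<And>j. j \<le> i \<Longrightarrow> \<not> stop (hist \<pi> j)" for \<pi> i
  proof -
    have "\<not> (\<exists>j. Q (hist \<pi> i) j)" using that(3) by (auto simp: Q_def take_hist)
    then have "F (hist \<pi> i) = f (hist \<pi> i)"
      using histories_hist[OF that(1), of i] unfolding F_def by (simp only: restrict_apply if_True if_False)
    then show ?thesis using that(2)[unfolded consistent_def, rule_format, of i] by simp
  qed
  moreover have "consistent M A (G (hist \<pi> j)) (\<lambda>n. \<pi> (n + j))"
    if "\<pi> \<in> plays M" "consistent M A F \<pi>" "stop (hist \<pi> j)" "\<And>k. k < j \<Longrightarrow> \<not> stop (hist \<pi> k)" for \<pi> j
  proof -
    have "F (hist \<pi> (i + j)) = G (hist \<pi> j) (hist (\<lambda>n. \<pi> (n + j)) i)" for i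
    proof -
      have "Q (hist \<pi> (i + j)) j" using that(3) by (simp add: Q_def take_hist)
      \<comment> \<open>\<open>stop\<close> looks at prefixes only, so the switching point does not
        move when the history grows.\<close>
      moreover have "(LEAST k. Q (hist \<pi> (i + j)) k) = j"
      proof (rule Least_equality)
        fix k assume "Q (hist \<pi> (i + j)) k"
        then show "j \<le> k" using that(4)[of k] by (cases "k < j") (auto simp: Q_def take_hist)
      qed fact
      ultimately show ?thesis
        using histories_hist[OF that(1)] by (auto simp: F_def take_hist drop_hist)
    qed
    then show ?thesis
      using that(2)[unfolded consistent_def, rule_format, of "_ + j"] by (simp add: consistent_def)
  qed
  ultimately show thesis using that by blast
qed

lemma strategy_through:
  assumes "s \<in> St M" "\<alpha> \<in> actions M A s"
  shows "\<exists>F\<in>strategies M A. F [s] = \<alpha>"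
proof -
  obtain F where F: "F \<in> strategies M A" using strategies_ex by blast
  have "restrict (F([s] := \<alpha>)) (histories M) \<in> strategies M A"
    using strategies_mem[OF F] assms(2) by (intro strategyI) auto
  then show ?thesis using singleton_history[OF assms(1)] by (intro bexI) simp_all
qed

lemma shift_strategy:
  assumes F: "F \<in> strategies M A"
  shows "\<exists>F'\<in>strategies M A. \<forall>h\<in>histories M. s # h \<in> histories M \<longrightarrow> F' h = F (s # h)"
proof -
  \<comment> \<open>\<open>F0\<close> is the default on histories that cannot follow
    \<open>s\<close>.\<close>
  obtain F0 where F0: "F0 \<in> strategies M A" using strategies_ex by blast
  have "h \<noteq> []" if "h \<in> histories M" for h using that by (auto simp: histories_def hist_def)
  then have "restrict (\<lambda>h. if s # h \<in> histories M then F (s # h) else F0 h) (histories M) \<in> strategies M A"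
    using strategies_mem[OF F] strategies_mem[OF F0] by (intro strategyI) fastforce
  then show ?thesis by (rule bexI[rotated]) simp
qed

lemma consistent_Cons:
  assumes \<tau>: "s \<in> St M" "\<tau> \<in> profiles M s" "\<forall>a\<in>A. \<tau> a = F [s] a"
    and F': "\<forall>h\<in>histories M. s # h \<in> histories M \<longrightarrow> F' h = F (s # h)"
    and \<pi>: "\<pi> \<in> plays M" "\<pi> 0 = out M s \<tau>" "consistent M A F' \<pi>"
  shows "consistent M A F (case_nat s \<pi>)"
  unfolding consistent_def
proof
  fix i
  have pl: "case_nat s \<pi> \<in> plays M" using play_Cons[OF \<pi>(1) \<tau>(1,2) \<pi>(2)] .
  show "\<exists>\<sigma>\<in>profiles M (case_nat s \<pi> i). (\<forall>a\<in>A. \<sigma> a = F (hist (case_nat s \<pi>) i) a) \<and>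
    case_nat s \<pi> (Suc i) = out M (case_nat s \<pi> i) \<sigma>"
  proof (cases i)
    case 0
    then show ?thesis using \<tau> \<pi>(2) by auto
  next
    case (Suc k)
    have "F' (hist \<pi> k) = F (s # hist \<pi> k)"
      using F' histories_hist[OF pl, of "Suc k"] histories_hist[OF \<pi>(1)] by (simp add: hist_case_nat)
    then show ?thesis
      using \<pi>(3)[unfolded consistent_def, rule_format, of k] Suc by (simp add: hist_case_nat)
  qed
qed

section \<open>Satisfaction of strategic formulae\<close>

text \<open>As a co-strategy sees the whole strategy it responds to, \<open>[[A]]\<Phi>\<close> is the dual of
  \<open>\<langle>\<langle>A\<rangle>\<rangle>\<close>: no strategy of \<open>A\<close> avoids \<open>\<Phi>\<close>.\<close>

lemma sat_Unav_iff:
  assumes s: "s \<in> St M"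
  shows "sat M s (Unav A \<Phi>) \<longleftrightarrow>
    (\<forall>F\<in>strategies M A. \<exists>\<pi>\<in>plays M. \<pi> 0 = s \<and> consistent M A F \<pi> \<and> psat M \<pi> \<Phi>)"
proof
  assume "sat M s (Unav A \<Phi>)"
  then obtain Fc where Fc: "Fc \<in> costrategies M A"
    "\<And>\<pi>. \<pi> \<in> plays M \<Longrightarrow> \<pi> 0 = s \<Longrightarrow> co_consistent M A Fc \<pi> \<Longrightarrow> psat M \<pi> \<Phi>" by auto
  show "\<forall>F\<in>strategies M A. \<exists>\<pi>\<in>plays M. \<pi> 0 = s \<and> consistent M A F \<pi> \<and> psat M \<pi> \<Phi>"
  proof
    fix F assume F: "F \<in> strategies M A"
    define P where "P h = (\<lambda>a. if a \<in> A then F h a else Fc h F a)" for h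
    have P: "P h \<in> profiles M (last h)" if "h \<in> histories M" for h
    proof -
      have "Fc h F \<in> actions M (- A) (last h)" using Fc(1) F that unfolding costrategies_def by blast
      then show ?thesis
        using actions_mem[OF strategies_mem[OF F that]] by (auto simp: profiles_iff P_def dest: actions_mem)
    qed
    obtain \<pi> where \<pi>: "\<pi> \<in> plays M" "\<pi> 0 = s" "\<And>i. \<pi> (Suc i) = out M (\<pi> i) (P (hist \<pi> i))"
      using play_following[OF s, of P] P by blast
    have "co_consistent M A Fc \<pi>"
      unfolding co_consistent_def by (rule bexI[OF _ F]) (use \<pi>(3) in \<open>simp add: P_def\<close>)
    moreover have "consistent M A F \<pi>"
      unfolding consistent_def
    proof
      fix i
      show "\<exists>\<sigma>\<in>profiles M (\<pi> i). (\<forall>a\<in>A. \<sigma> a = F (hist \<pi> i) a) \<and> \<pi> (Suc i) = out M (\<pi> i) \<sigma>"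
        using P[OF histories_hist[OF \<pi>(1)], of i] \<pi>(3)[of i]
        by (intro bexI[of _ "P (hist \<pi> i)"]) (simp_all add: P_def)
    qed
    ultimately show "\<exists>\<pi>\<in>plays M. \<pi> 0 = s \<and> consistent M A F \<pi> \<and> psat M \<pi> \<Phi>"
      using \<pi> Fc(2) by blast
  qed
next
  assume "\<forall>F\<in>strategies M A. \<exists>\<pi>\<in>plays M. \<pi> 0 = s \<and> consistent M A F \<pi> \<and> psat M \<pi> \<Phi>"
  then obtain \<rho> where \<rho>: "\<And>F. F \<in> strategies M A \<Longrightarrow>
      \<rho> F \<in> plays M \<and> \<rho> F 0 = s \<and> consistent M A F (\<rho> F) \<and> psat M (\<rho> F) \<Phi>"
    by metis
  then have "\<forall>F\<in>strategies M A. \<forall>i. \<exists>\<sigma>\<in>profiles M (\<rho> F i).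
      (\<forall>a\<in>A. \<sigma> a = F (hist (\<rho> F) i) a) \<and> \<rho> F (Suc i) = out M (\<rho> F i) \<sigma>"
    unfolding consistent_def by blast
  then obtain R where R: "\<And>F i. F \<in> strategies M A \<Longrightarrow> R F i \<in> profiles M (\<rho> F i) \<and>
      (\<forall>a\<in>A. R F i a = F (hist (\<rho> F) i) a) \<and> \<rho> F (Suc i) = out M (\<rho> F i) (R F i)"
    by metis
  obtain D where D: "D \<in> strategies M (- A)" using strategies_ex by blast
  \<comment> \<open>The co-strategy knows \<open>F\<close>, hence also the play
    \<open>\<rho> F\<close> chosen for it, and keeps to that play. The index
    \<open>length h - 1\<close> is the current position, and \<open>D\<close> is the default off the
    play.\<close>
  define Fc where "Fc = restrict (\<lambda>h. restrict (\<lambda>F.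
      if h = hist (\<rho> F) (length h - 1) then restrict (R F (length h - 1)) (- A) else D h)
      (strategies M A)) (histories M)"
  have "Fc \<in> costrategies M A"
    unfolding Fc_def costrategies_def
  proof (intro restrict_PiE_iff[THEN iffD2] ballI)
    fix h F assume h: "h \<in> histories M" and F: "F \<in> strategies M A"
    have "restrict (R F i) (- A) \<in> actions M (- A) (\<rho> F i)" for i
      using R[OF F, of i] by (auto simp: actions_def)
    then show "(if h = hist (\<rho> F) (length h - 1) then restrict (R F (length h - 1)) (- A) else D h)
        \<in> actions M (- A) (last h)"
      using strategies_mem[OF D h] by (metis last_hist)
  qed
  moreover have "psat M \<pi> \<Phi>" if \<pi>: "\<pi> \<in> plays M" "\<pi> 0 = s" "co_consistent M A Fc \<pi>" for \<pi>
  proof -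
    obtain F where F: "F \<in> strategies M A"
      "\<And>i. \<pi> (Suc i) = out M (\<pi> i) (\<lambda>a. if a \<in> A then F (hist \<pi> i) a else Fc (hist \<pi> i) F a)"
      using \<pi>(3) unfolding co_consistent_def by blast
    have "hist \<pi> i = hist (\<rho> F) i" for i
    proof (induction i)
      case 0
      then show ?case using \<rho>[OF F(1)] \<pi>(2) by simp
    next
      case (Suc i)
      have "Fc (hist \<pi> i) F = restrict (R F i) (- A)"
        using histories_hist[OF \<pi>(1), of i] F(1) Suc by (simp add: Fc_def)
      then have "(\<lambda>a. if a \<in> A then F (hist \<pi> i) a else Fc (hist \<pi> i) F a) = R F i"
        using R[OF F(1), of i] Suc by auto
      then have "\<pi> (Suc i) = \<rho> F (Suc i)"
        using F(2)[of i] R[OF F(1), of i] Suc by (metis last_hist)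
      then show ?case using Suc by (simp add: hist_Suc)
    qed
    then have "\<pi> = \<rho> F" by (metis last_hist ext)
    then show ?thesis using \<rho>[OF F(1)] by simp
  qed
  ultimately show "sat M s (Unav A \<Phi>)" by auto
qed

lemma sat_Coop_Next_iff:
  assumes s: "s \<in> St M"
  shows "sat M s (Coop A (Next \<phi>)) \<longleftrightarrow> eff_coop M A s {t. sat M t \<phi>}"
proof
  assume "sat M s (Coop A (Next \<phi>))"
  then obtain F where F: "F \<in> strategies M A"
    "\<And>\<pi>. \<pi> \<in> plays M \<Longrightarrow> \<pi> 0 = s \<Longrightarrow> consistent M A F \<pi> \<Longrightarrow> sat M (\<pi> 1) \<phi>" by auto
  show "eff_coop M A s {t. sat M t \<phi>}"
    unfolding eff_coop_def
  proof (intro bexI[of _ "F [s]"] ballI impI)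
    show "F [s] \<in> actions M A s" using strategies_mem[OF F(1) singleton_history[OF s]] by simp
    fix \<tau> assume "\<tau> \<in> profiles M s" "\<forall>a\<in>A. \<tau> a = F [s] a"
    from consistent_play_ex[OF F(1) s this] show "out M s \<tau> \<in> {t. sat M t \<phi>}"
      using F(2) by force
  qed
next
  assume "eff_coop M A s {t. sat M t \<phi>}"
  then obtain \<alpha> where \<alpha>: "\<alpha> \<in> actions M A s"
    "\<And>\<tau>. \<tau> \<in> profiles M s \<Longrightarrow> (\<forall>a\<in>A. \<tau> a = \<alpha> a) \<Longrightarrow> sat M (out M s \<tau>) \<phi>"
    by (auto simp: eff_coop_def)
  obtain F where F: "F \<in> strategies M A" "F [s] = \<alpha>" using strategy_through[OF s \<alpha>(1)] by blast
  have "sat M (\<pi> 1) \<phi>" if "\<pi> 0 = s" "consistent M A F \<pi>" for \<pi>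
    using that(2)[unfolded consistent_def, rule_format, of 0] that(1) F(2) \<alpha>(2) by auto
  then show "sat M s (Coop A (Next \<phi>))" using F(1) by auto
qed

lemma sat_Unav_Next_iff:
  assumes s: "s \<in> St M"
  shows "sat M s (Unav A (Next \<phi>)) \<longleftrightarrow> eff_unav M A s {t. sat M t \<phi>}"
proof
  assume asm: "sat M s (Unav A (Next \<phi>))"
  show "eff_unav M A s {t. sat M t \<phi>}"
    unfolding eff_unav_def
  proof
    fix \<alpha> assume \<alpha>: "\<alpha> \<in> actions M A s"
    obtain F where F: "F \<in> strategies M A" "F [s] = \<alpha>" using strategy_through[OF s \<alpha>] by blast
    obtain \<pi> where \<pi>: "\<pi> 0 = s" "consistent M A F \<pi>" "sat M (\<pi> 1) \<phi>"
      using asm F(1) unfolding sat_Unav_iff[OF s] by auto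
    then show "\<exists>\<tau>\<in>profiles M s. (\<forall>a\<in>A. \<tau> a = \<alpha> a) \<and> out M s \<tau> \<in> {t. sat M t \<phi>}"
      using \<pi>(2)[unfolded consistent_def, rule_format, of 0] F(2) by auto
  qed
next
  assume asm: "eff_unav M A s {t. sat M t \<phi>}"
  show "sat M s (Unav A (Next \<phi>))"
    unfolding sat_Unav_iff[OF s]
  proof
    fix F assume F: "F \<in> strategies M A"
    have "F [s] \<in> actions M A s" using strategies_mem[OF F singleton_history[OF s]] by simp
    then obtain \<tau> where "\<tau> \<in> profiles M s" "\<forall>a\<in>A. \<tau> a = F [s] a" "sat M (out M s \<tau>) \<phi>"
      using asm by (auto simp: eff_unav_def)
    with consistent_play_ex[OF F s this(1,2)]
    show "\<exists>\<pi>\<in>plays M. \<pi> 0 = s \<and> consistent M A F \<pi> \<and> psat M \<pi> (Next \<phi>)" by auto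
  qed
qed

end

section \<open>Canonical decompositions\<close>

text \<open>\<open>best p v \<Phi>\<close> is the pair \<open>\<langle>\<psi>, \<Psi>\<rangle>\<close> of \<open>dec \<Phi>\<close> with \<open>\<psi>\<close> true under \<open>v\<close> whose residual
  \<open>\<Psi>\<close> is weakest: every play that starts in a state with valuation \<open>v\<close> and satisfies \<open>\<Phi>\<close>
  satisfies \<open>\<Psi>\<close> from the next state on.\<close>

primrec best :: "'p \<Rightarrow> (('ag, 'p) sform \<Rightarrow> bool) \<Rightarrow> ('ag, 'p) pform \<Rightarrow>
    (('ag, 'p) sform \<times> ('ag, 'p) pform) option" where
  "best p v (PState \<phi>) = (if v \<phi> then Some (\<phi>, PState (Top p)) else None)"
| "best p v (Next \<phi>) = Some (Top p, PState \<phi>)"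
| "best p v (Always \<phi>) = (if v \<phi> then Some (\<phi>, Always \<phi>) else None)"
| "best p v (Until \<phi> \<psi>) = (if v \<psi> then Some (\<psi>, PState (Top p))
     else if v \<phi> then Some (\<phi>, Until \<phi> \<psi>) else None)"
| "best p v (PAnd \<Phi>1 \<Phi>2) = (case best p v \<Phi>1 of None \<Rightarrow> None | Some (\<psi>1, \<Psi>1) \<Rightarrow>
     (case best p v \<Phi>2 of None \<Rightarrow> None | Some (\<psi>2, \<Psi>2) \<Rightarrow> Some (And \<psi>1 \<psi>2, PAnd \<Psi>1 \<Psi>2)))"
| "best p v (POr \<Phi>1 \<Phi>2) = (case best p v \<Phi>1 of None \<Rightarrow> best p v \<Phi>2 | Some (\<psi>1, \<Psi>1) \<Rightarrow>
     if \<Psi>1 = PState (Top p) then Some (\<psi>1, \<Psi>1) else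
     (case best p v \<Phi>2 of None \<Rightarrow> Some (\<psi>1, \<Psi>1) | Some (\<psi>2, \<Psi>2) \<Rightarrow>
        if \<Psi>2 = PState (Top p) then Some (\<psi>2, \<Psi>2) else Some (And \<psi>1 \<psi>2, POr \<Psi>1 \<Psi>2)))"

lemma best_dec: "best p v \<Phi> = Some (\<psi>, \<Psi>) \<Longrightarrow> (\<psi>, \<Psi>) \<in> dec p \<Phi>"
  by (induction \<Phi> arbitrary: \<psi> \<Psi> rule: pform_induct) (auto split: if_splits option.splits)

text \<open>This makes \<open>C \<Psi>\<close> a \<gamma>-formula again for every residual \<Psi>,
  so that realization can be continued at the successor.\<close>

lemma dec_not_next: "(\<psi>, \<Psi>) \<in> dec p \<Phi> \<Longrightarrow> \<not> is_next \<Psi>"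
  unfolding is_next_def by (induction \<Phi> arbitrary: \<psi> \<Psi> rule: pform_induct) (auto, blast+)

lemma best_true: "best p (sat M s) \<Phi> = Some (\<psi>, \<Psi>) \<Longrightarrow> sat M s \<psi>"
  by (induction \<Phi> arbitrary: \<psi> \<Psi> rule: pform_induct) (auto split: if_splits option.splits)

text \<open>The disjunctive case explains the shape of \<open>best\<close>: an available pair with
  residual \<top> wins outright, and otherwise two available pairs are merged, so the residual of
  whichever disjunct the play satisfies implies the chosen one.\<close>

lemma psat_best:
  "psat M \<pi> \<Phi> \<Longrightarrow>
    \<exists>\<psi> \<Psi>. best p (sat M (\<pi> 0)) \<Phi> = Some (\<psi>, \<Psi>) \<and> psat M (\<lambda>n. \<pi> (Suc n)) \<Psi>"
proof (induction \<Phi> rule: pform_induct)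
  case (Until \<phi> \<psi>)
  then obtain i where i: "sat M (\<pi> i) \<psi>" "\<And>j. j < i \<Longrightarrow> sat M (\<pi> j) \<phi>" by auto
  show ?case
  proof (cases i)
    case (Suc k)
    then have "psat M (\<lambda>n. \<pi> (Suc n)) (Until \<phi> \<psi>)" "sat M (\<pi> 0) \<phi>" using i by auto
    then show ?thesis by auto
  qed (use i in auto)
next
  case (POr \<Phi>1 \<Phi>2)
  then show ?case by (auto split: option.splits)
next
  case (PAnd \<Phi>1 \<Phi>2)
  then show ?case by fastforce
qed auto

text \<open>The residual depends on the current state only, not on the play. All plays through a
  state share the next obligation, which can therefore be put under a modality at the
  successor.\<close>

definition step :: "('ag, 'p, 's, 'c) cgm \<Rightarrow> 'p \<Rightarrow> 's \<Rightarrow> ('ag, 'p) pform \<Rightarrow> ('ag, 'p) pform" where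
  "step M p s \<Phi> = snd (the (best p (sat M s) \<Phi>))"

text \<open>The obligation on arrival at position \<open>i\<close>: the states before
  \<open>i\<close> are consumed, the one at \<open>i\<close> is not.\<close>

abbreviation residual ::
  "('ag, 'p, 's, 'c) cgm \<Rightarrow> 'p \<Rightarrow> (nat \<Rightarrow> 's) \<Rightarrow> ('ag, 'p) pform \<Rightarrow> nat \<Rightarrow> ('ag, 'p) pform" where
  "residual M p \<pi> \<Phi> i \<equiv> fold (step M p) (map \<pi> [0..<i]) \<Phi>"

text \<open>Conditions of conjunctive and merged pairs are nested conjunctions, while
  \<open>Real\<close> asks for their parts as members of the label.\<close>

definition and_closed :: "('ag, 'p) sform set \<Rightarrow> bool" where
  "and_closed \<Delta> \<longleftrightarrow> (\<forall>\<phi> \<psi>. And \<phi> \<psi> \<in> \<Delta> \<longrightarrow> \<phi> \<in> \<Delta> \<and> \<psi> \<in> \<Delta>)"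

lemma and_closedD: "and_closed \<Delta> \<Longrightarrow> And \<phi> \<psi> \<in> \<Delta> \<Longrightarrow> \<phi> \<in> \<Delta> \<and> \<psi> \<in> \<Delta>"
  unfolding and_closed_def by blast

text \<open>\<open>Real\<close> tests membership, not truth. It is required of every label that
  contains the condition of the canonical pair, so that any expansion built later with that link
  realizes \<Phi> on the spot.\<close>

definition real_now :: "('ag, 'p, 's, 'c) cgm \<Rightarrow> 'p \<Rightarrow> 's \<Rightarrow> ('ag, 'p) pform \<Rightarrow> bool" where
  "real_now M p s \<Phi> \<longleftrightarrow> (\<forall>\<Delta>. and_closed \<Delta> \<longrightarrow>
     fst (the (best p (sat M s) \<Phi>)) \<in> \<Delta> \<longrightarrow> Real \<Phi> \<Delta>)"

lemma psat_step:
  assumes "psat M \<pi> \<Phi>"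
  obtains \<psi> where "best p (sat M (\<pi> 0)) \<Phi> = Some (\<psi>, step M p (\<pi> 0) \<Phi>)"
    "psat M (\<lambda>n. \<pi> (Suc n)) (step M p (\<pi> 0) \<Phi>)"
  using psat_best[OF assms, of p] by (auto simp: step_def)

lemma psat_residual: "psat M \<pi> \<Phi> \<Longrightarrow> psat M (\<lambda>n. \<pi> (n + i)) (residual M p \<pi> \<Phi> i)"
proof (induction i)
  case (Suc i)
  from psat_step[OF Suc.IH[OF Suc.prems], of p] show ?case by simp
qed simp

lemma best_residual:
  assumes "psat M \<pi> \<Phi>"
  obtains \<psi> where "best p (sat M (\<pi> i)) (residual M p \<pi> \<Phi> i) = Some (\<psi>, residual M p \<pi> \<Phi> (Suc i))"
  using psat_step[OF psat_residual[OF assms, of i p], of p] by auto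

lemma residual_Suc_shift:
  "residual M p \<pi> \<Phi> (Suc i) = residual M p (\<lambda>n. \<pi> (Suc n)) (step M p (\<pi> 0) \<Phi>) i"
proof -
  have "map \<pi> [0..<Suc i] = \<pi> 0 # map (\<lambda>n. \<pi> (Suc n)) [0..<i]"
    by (rule nth_equalityI) (auto simp: nth_Cons split: nat.split simp del: upt_Suc)
  then show ?thesis by (simp del: upt_Suc)
qed

lemma step_Top [simp]: "step M p s (PState (Top p)) = PState (Top p)"
  by (simp add: step_def)

lemma residual_Top [simp]: "residual M p \<pi> (PState (Top p)) i = PState (Top p)"
  by (induction i) simp_all

lemma residual_stays_Top:
  assumes "residual M p \<pi> \<Phi> k = PState (Top p)" "k \<le> i"
  shows "residual M p \<pi> \<Phi> i = PState (Top p)"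
  using assms(2) by (induction i rule: dec_induct) (simp_all add: assms(1))

lemma real_now_Top [simp]: "real_now M p s (PState (Top p))"
  by (simp add: real_now_def)

lemma real_now_shift:
  assumes "\<exists>N. \<forall>i\<ge>N. real_now M p (\<pi> (Suc i)) (residual M p (\<lambda>n. \<pi> (Suc n)) (step M p (\<pi> 0) \<Phi>) i)"
  shows "\<exists>N. \<forall>i\<ge>N. real_now M p (\<pi> i) (residual M p \<pi> \<Phi> i)"
proof -
  obtain N where N: "\<And>i. i \<ge> N \<Longrightarrow> real_now M p (\<pi> (Suc i)) (residual M p \<pi> \<Phi> (Suc i))"
    using assms unfolding residual_Suc_shift by blast
  have "real_now M p (\<pi> i) (residual M p \<pi> \<Phi> i)" if "i \<ge> Suc N" for i
    using N[of "i - 1"] that by (cases i) auto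
  then show ?thesis by blast
qed

lemma real_nowD:
  "real_now M p s \<Phi> \<Longrightarrow> and_closed \<Delta> \<Longrightarrow>
    best p (sat M s) \<Phi> = Some (\<psi>, \<Psi>) \<Longrightarrow> \<psi> \<in> \<Delta> \<Longrightarrow> Real \<Phi> \<Delta>"
  unfolding real_now_def by (metis fst_conv option.sel)

text \<open>As long as the residual is not \<top>, a disjunct is lost only if it has no true pair at
  all. A disjunct satisfied by the play always has one, so it is never the one that is lost.\<close>

lemma best_POr_cases:
  assumes "best p v (POr \<Phi>1 \<Phi>2) = Some (\<psi>, \<Psi>)" "\<Psi> \<noteq> PState (Top p)"
  obtains "best p v \<Phi>1 = Some (\<psi>, \<Psi>)" "best p v \<Phi>2 = None"
  | "best p v \<Phi>2 = Some (\<psi>, \<Psi>)" "best p v \<Phi>1 = None"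
  | \<psi>1 \<Psi>1 \<psi>2 \<Psi>2 where "best p v \<Phi>1 = Some (\<psi>1, \<Psi>1)" "best p v \<Phi>2 = Some (\<psi>2, \<Psi>2)"
      "\<psi> = And \<psi>1 \<psi>2" "\<Psi> = POr \<Psi>1 \<Psi>2"
proof (cases "best p v \<Phi>1")
  case None
  then show thesis using assms that(2) by simp
next
  case (Some x)
  obtain \<psi>1 \<Psi>1 where x: "x = (\<psi>1, \<Psi>1)" by fastforce
  show thesis
  proof (cases "best p v \<Phi>2")
    case None
    then show thesis using assms Some x that(1) by (simp split: if_splits)
  next
    case Some2: (Some y)
    obtain \<psi>2 \<Psi>2 where "y = (\<psi>2, \<Psi>2)" by fastforce
    then show thesis using assms Some Some2 x that(3) by (simp split: if_splits)
  qed
qed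

text \<open>The bound holds from some point on, not merely at one moment, so that both parts of a
  conjunction can be realized simultaneously. \<open>Until\<close> comes down to \<top> once its
  goal has held, \<open>Always\<close> is realized all the time, and state formulae and
  \<open>Next\<close> come down to \<top> after one and two steps.\<close>

lemma eventually_real_now:
  "psat M \<pi> \<Phi> \<Longrightarrow> \<exists>N. \<forall>i\<ge>N. real_now M p (\<pi> i) (residual M p \<pi> \<Phi> i)"
proof (induction \<Phi> arbitrary: \<pi> rule: pform_induct)
  case (PState \<phi>)
  then have "step M p (\<pi> 0) (PState \<phi>) = PState (Top p)" by (simp add: step_def)
  then show ?case using real_now_shift[of M p \<pi> "PState \<phi>"] by simp
next
  case (Next \<phi>)
  then have "step M p (\<pi> 1) (PState \<phi>) = PState (Top p)" by (simp add: step_def)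
  then have "\<exists>N. \<forall>i\<ge>N. real_now M p (\<pi> (Suc i)) (residual M p (\<lambda>n. \<pi> (Suc n)) (PState \<phi>) i)"
    using real_now_shift[of M p "\<lambda>n. \<pi> (Suc n)" "PState \<phi>"] by simp
  moreover have "step M p (\<pi> 0) (Next \<phi>) = PState \<phi>" by (simp add: step_def)
  ultimately show ?case using real_now_shift[of M p \<pi> "Next \<phi>"] by simp
next
  case (Always \<phi>)
  then have "residual M p \<pi> (Always \<phi>) i = Always \<phi>" for i
    by (induction i) (simp_all add: step_def)
  then show ?case using Always by (simp add: real_now_def)
next
  case (Until \<phi> \<psi>)
  then obtain i where "sat M (\<pi> i) \<psi>" "\<And>j. j < i \<Longrightarrow> sat M (\<pi> j) \<phi>" by auto
  then show ?case
  proof (induction i arbitrary: \<pi>)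
    case 0
    then have "step M p (\<pi> 0) (Until \<phi> \<psi>) = PState (Top p)" by (simp add: step_def)
    then show ?case using real_now_shift[of M p \<pi> "Until \<phi> \<psi>"] by simp
  next
    case (Suc i)
    have IH: "\<exists>N. \<forall>i\<ge>N. real_now M p (\<pi> (Suc i)) (residual M p (\<lambda>n. \<pi> (Suc n)) (Until \<phi> \<psi>) i)"
      using Suc.IH[of "\<lambda>n. \<pi> (Suc n)"] Suc.prems by simp
    have "step M p (\<pi> 0) (Until \<phi> \<psi>) \<in> {PState (Top p), Until \<phi> \<psi>}"
      using Suc.prems(2)[of 0] by (simp add: step_def)
    then have "\<exists>N. \<forall>i\<ge>N. real_now M p (\<pi> (Suc i))
        (residual M p (\<lambda>n. \<pi> (Suc n)) (step M p (\<pi> 0) (Until \<phi> \<psi>)) i)"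
      using IH by (elim insertE emptyE) simp_all
    then show ?case by (rule real_now_shift)
  qed
next
  case (PAnd \<Phi>1 \<Phi>2)
  let ?R = "residual M p \<pi>"
  have sat: "psat M \<pi> \<Phi>1" "psat M \<pi> \<Phi>2" using PAnd.prems by auto
  obtain N1 N2 where N: "\<And>i. i \<ge> N1 \<Longrightarrow> real_now M p (\<pi> i) (?R \<Phi>1 i)"
    "\<And>i. i \<ge> N2 \<Longrightarrow> real_now M p (\<pi> i) (?R \<Phi>2 i)"
    using PAnd.IH(1)[OF sat(1)] PAnd.IH(2)[OF sat(2)] by blast
  have best: "\<exists>\<psi>1 \<psi>2. best p (sat M (\<pi> i)) (?R \<Phi>1 i) = Some (\<psi>1, ?R \<Phi>1 (Suc i)) \<and>
      best p (sat M (\<pi> i)) (?R \<Phi>2 i) = Some (\<psi>2, ?R \<Phi>2 (Suc i))" for i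
    using best_residual[OF sat(1)] best_residual[OF sat(2)] by metis
  have R: "?R (PAnd \<Phi>1 \<Phi>2) i = PAnd (?R \<Phi>1 i) (?R \<Phi>2 i)" for i
  proof (induction i)
    case (Suc i)
    then show ?case
      using best[of i] by (auto simp: step_def[of M p "\<pi> i" "PAnd (?R \<Phi>1 i) (?R \<Phi>2 i)"])
  qed simp
  have "real_now M p (\<pi> i) (?R (PAnd \<Phi>1 \<Phi>2) i)" if i: "i \<ge> max N1 N2" for i
    unfolding R real_now_def
  proof (intro allI impI)
    fix \<Delta> :: "('a, 'b) sform set"
    assume c: "and_closed \<Delta>"
      and m: "fst (the (best p (sat M (\<pi> i)) (PAnd (?R \<Phi>1 i) (?R \<Phi>2 i)))) \<in> \<Delta>"
    obtain \<psi>1 \<psi>2 where b: "best p (sat M (\<pi> i)) (?R \<Phi>1 i) = Some (\<psi>1, ?R \<Phi>1 (Suc i))"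
      "best p (sat M (\<pi> i)) (?R \<Phi>2 i) = Some (\<psi>2, ?R \<Phi>2 (Suc i))" using best by blast
    have "And \<psi>1 \<psi>2 \<in> \<Delta>" using m b by simp
    then have "\<psi>1 \<in> \<Delta>" "\<psi>2 \<in> \<Delta>" using and_closedD[OF c] by blast+
    then show "Real (PAnd (?R \<Phi>1 i) (?R \<Phi>2 i)) \<Delta>"
      using real_nowD[OF N(1) c b(1)] real_nowD[OF N(2) c b(2)] i by simp
  qed
  then show ?case by blast
next
  case (POr \<Phi>1 \<Phi>2)
  let ?R = "residual M p \<pi>" and ?\<Phi> = "POr \<Phi>1 \<Phi>2"
  show ?case
  proof (cases "\<exists>k. ?R ?\<Phi> k = PState (Top p)")
    case True
    then obtain k where "?R ?\<Phi> k = PState (Top p)" by blast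
    then have "real_now M p (\<pi> i) (?R ?\<Phi> i)" if "i \<ge> k" for i
      using residual_stays_Top[OF _ that, of M p \<pi> ?\<Phi>] by simp
    then show ?thesis by blast
  next
    case False
    obtain \<Phi> where \<Phi>: "\<Phi> = \<Phi>1 \<or> \<Phi> = \<Phi>2" "psat M \<pi> \<Phi>" using POr.prems by auto
    obtain N where N: "\<And>i. i \<ge> N \<Longrightarrow> real_now M p (\<pi> i) (?R \<Phi> i)"
      using POr.IH(1)[of \<pi>] POr.IH(2)[of \<pi>] \<Phi> by blast
    \<comment> \<open>The disjunct \<Phi> satisfied by the play never drops out: either both
      residuals are still merged, or only that of \<Phi> is left.\<close>
    have R: "?R ?\<Phi> i \<in> {POr (?R \<Phi>1 i) (?R \<Phi>2 i), ?R \<Phi> i}" for i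
    proof (induction i)
      case (Suc i)
      show ?case
      proof (cases "?R ?\<Phi> i = ?R \<Phi> i")
        case neq: False
        obtain \<psi> where b: "best p (sat M (\<pi> i)) (POr (?R \<Phi>1 i) (?R \<Phi>2 i)) = Some (\<psi>, ?R ?\<Phi> (Suc i))"
          using best_residual[OF POr.prems, of p i] Suc neq by auto
        obtain \<psi>' where b': "best p (sat M (\<pi> i)) (?R \<Phi> i) = Some (\<psi>', ?R \<Phi> (Suc i))"
          using best_residual[OF \<Phi>(2)] .
        from False have "?R ?\<Phi> (Suc i) \<noteq> PState (Top p)" by blast
        with b show ?thesis
          by (rule best_POr_cases) (use b' \<Phi>(1) in \<open>auto simp: step_def[of M p "\<pi> i" "?R _ i"]\<close>)
      qed simp
    qed simp
    have "real_now M p (\<pi> i) (?R ?\<Phi> i)" if i: "i \<ge> N" for i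
    proof (cases "?R ?\<Phi> i = ?R \<Phi> i")
      case True
      then show ?thesis using N[OF i] by simp
    next
      case neq: False
      then have eq: "?R ?\<Phi> i = POr (?R \<Phi>1 i) (?R \<Phi>2 i)" using R[of i] by auto
      obtain \<psi> where b: "best p (sat M (\<pi> i)) (POr (?R \<Phi>1 i) (?R \<Phi>2 i)) = Some (\<psi>, ?R ?\<Phi> (Suc i))"
        using best_residual[OF POr.prems, of p i] eq by auto
      obtain \<psi>' where b': "best p (sat M (\<pi> i)) (?R \<Phi> i) = Some (\<psi>', ?R \<Phi> (Suc i))"
        using best_residual[OF \<Phi>(2)] .
      have nt: "?R ?\<Phi> (Suc i) \<noteq> PState (Top p)" using False by blast
      show ?thesis
        unfolding eq real_now_def
      proof (intro allI impI)
        fix \<Delta> :: "('a, 'b) sform set"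
        assume c: "and_closed \<Delta>"
          and m: "fst (the (best p (sat M (\<pi> i)) (POr (?R \<Phi>1 i) (?R \<Phi>2 i)))) \<in> \<Delta>"
        have "\<psi> \<in> \<Delta>" using m b by simp
        \<comment> \<open>Merged or not, the condition \<psi> contains that of \<Phi>, as itself or
          as a conjunct.\<close>
        from b nt have "\<psi>' \<in> \<Delta>"
        proof (cases rule: best_POr_cases)
          case (3 \<psi>1 \<Psi>1 \<psi>2 \<Psi>2)
          then have "\<psi>1 \<in> \<Delta>" "\<psi>2 \<in> \<Delta>" using and_closedD[OF c] \<open>\<psi> \<in> \<Delta>\<close> by blast+
          then show ?thesis using 3 b' \<Phi>(1) by auto
        qed (use b' \<Phi>(1) \<open>\<psi> \<in> \<Delta>\<close> in auto)
        from real_nowD[OF N[OF i] c b' this] have "Real (?R \<Phi> i) \<Delta>" .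
        then show "Real (POr (?R \<Phi>1 i) (?R \<Phi>2 i)) \<Delta>" using \<Phi>(1) by auto
      qed
    qed
    then show ?thesis by blast
  qed
qed


section \<open>Finite attainment\<close>

text \<open>The one-step power \<open>E\<close> travels with the modality \<open>C\<close>, so that
  \<open>Coop\<close> and \<open>Unav\<close> share one notion of attainment and one treatment of
  the tableau.\<close>

definition modality :: "('ag, 'p, 's, 'c) cgm \<Rightarrow> (('ag, 'p) pform \<Rightarrow> ('ag, 'p) sform) \<Rightarrow>
    ('s \<Rightarrow> 's set \<Rightarrow> bool) \<Rightarrow> bool" where
  "modality M C E \<longleftrightarrow> (\<exists>A. C = Coop A \<and> E = eff_coop M A \<or> C = Unav A \<and> E = eff_unav M A)"

text \<open>The derivation is the rank that decreases along the tableau while \<open>C \<Phi>\<close> is being realized.\<close>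

inductive attains :: "('ag, 'p, 's, 'c) cgm \<Rightarrow> 'p \<Rightarrow> (('ag, 'p) pform \<Rightarrow> ('ag, 'p) sform) \<Rightarrow>
    ('s \<Rightarrow> 's set \<Rightarrow> bool) \<Rightarrow> 's \<Rightarrow> ('ag, 'p) pform \<Rightarrow> bool"
  for M :: "('ag, 'p, 's, 'c) cgm" and p :: 'p and C :: "('ag, 'p) pform \<Rightarrow> ('ag, 'p) sform"
    and E :: "'s \<Rightarrow> 's set \<Rightarrow> bool" where
  now: "real_now M p s \<Phi> \<Longrightarrow> attains M p C E s \<Phi>"
| later: "E s Y \<Longrightarrow> (\<And>t. t \<in> Y \<Longrightarrow> sat M t (C (step M p s \<Phi>))) \<Longrightarrow>
    (\<And>t. t \<in> Y \<Longrightarrow> attains M p C E t (step M p s \<Phi>)) \<Longrightarrow> attains M p C E s \<Phi>"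

context
  fixes M :: "('ag, 'p, 's, 'c) cgm"
  assumes cgm: "is_cgm M"
begin

lemma sat_Next_iff:
  assumes "modality M C E" "s \<in> St M"
  shows "sat M s (C (Next \<phi>)) \<longleftrightarrow> E s {t. sat M t \<phi>}"
  using assms(1) sat_Coop_Next_iff[OF cgm assms(2)] sat_Unav_Next_iff[OF cgm assms(2)]
  unfolding modality_def by blast

lemma sat_Coop_shift:
  assumes F: "F \<in> strategies M A" "F' \<in> strategies M A"
    "\<forall>h\<in>histories M. s # h \<in> histories M \<longrightarrow> F' h = F (s # h)"
    and s: "s \<in> St M"
    and sat: "\<And>\<pi>. \<pi> \<in> plays M \<Longrightarrow> \<pi> 0 = s \<Longrightarrow> consistent M A F \<pi> \<Longrightarrow> psat M \<pi> \<Phi>"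
    and \<tau>: "\<tau> \<in> profiles M s" "\<forall>a\<in>A. \<tau> a = F [s] a"
    and \<pi>: "\<pi> \<in> plays M" "\<pi> 0 = out M s \<tau>" "consistent M A F' \<pi>"
  shows "psat M \<pi> (step M p s \<Phi>)"
proof -
  have "psat M (case_nat s \<pi>) \<Phi>"
    using sat[OF play_Cons[OF cgm \<pi>(1) s \<tau>(1) \<pi>(2)]] consistent_Cons[OF cgm s \<tau> F(3) \<pi>] by simp
  from psat_step[OF this, of p] show ?thesis by simp
qed

text \<open>A fixpoint unfolding of \<open>C \<Phi>\<close>. For \<open>Coop\<close> the strategy is
  shifted past its first move. For \<open>Unav\<close>, if \<open>A\<close> had an action all of
  whose outcomes refute the residual formula, it could play that action and then a spoiling strategy
  for the state reached, and so avoid \<Phi> altogether.\<close>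

lemma sat_modality_step:
  assumes C: "modality M C E" and s: "s \<in> St M" and sat: "sat M s (C \<Phi>)"
  obtains \<psi> where "best p (sat M s) \<Phi> = Some (\<psi>, step M p s \<Phi>)"
    "E s {t. sat M t (C (step M p s \<Phi>))}"
proof -
  let ?\<Psi> = "step M p s \<Phi>"
  from C consider A where "C = Coop A" "E = eff_coop M A" | A where "C = Unav A" "E = eff_unav M A"
    by (auto simp: modality_def)
  then show thesis
  proof cases
    case (1 A)
    obtain F where F: "F \<in> strategies M A"
      "\<And>\<pi>. \<pi> \<in> plays M \<Longrightarrow> \<pi> 0 = s \<Longrightarrow> consistent M A F \<pi> \<Longrightarrow> psat M \<pi> \<Phi>" using sat 1 by auto
    obtain \<pi> where \<pi>: "\<pi> \<in> plays M" "\<pi> 0 = s" "consistent M A F \<pi>"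
      using consistent_play_ex0[OF cgm F(1) s] by blast
    obtain \<psi> where \<psi>: "best p (sat M s) \<Phi> = Some (\<psi>, ?\<Psi>)"
      using psat_step[OF F(2)[OF \<pi>], of p] \<pi>(2) by auto
    obtain F' where F': "F' \<in> strategies M A" "\<forall>h\<in>histories M. s # h \<in> histories M \<longrightarrow> F' h = F (s # h)"
      using shift_strategy[OF cgm F(1)] by blast
    have "sat M (out M s \<tau>) (Coop A ?\<Psi>)" if "\<tau> \<in> profiles M s" "\<forall>a\<in>A. \<tau> a = F [s] a" for \<tau>
      unfolding sat.simps using sat_Coop_shift[OF F(1) F' s F(2) that] F'(1) by blast
    moreover have "F [s] \<in> actions M A s"
      using strategies_mem[OF F(1) singleton_history[OF cgm s]] by simp
    ultimately have "E s {t. sat M t (C ?\<Psi>)}" unfolding 1 eff_coop_def by blast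
    then show thesis using that \<psi> by blast
  next
    case (2 A)
    have un: "\<And>F. F \<in> strategies M A \<Longrightarrow>
        \<exists>\<pi>\<in>plays M. \<pi> 0 = s \<and> consistent M A F \<pi> \<and> psat M \<pi> \<Phi>"
      using sat sat_Unav_iff[OF cgm s] 2 by blast
    obtain F0 where F0: "F0 \<in> strategies M A" using strategies_ex[OF cgm] by blast
    obtain \<pi>0 where "\<pi>0 0 = s" "psat M \<pi>0 \<Phi>" using un[OF F0] by blast
    then obtain \<psi> where \<psi>: "best p (sat M s) \<Phi> = Some (\<psi>, ?\<Psi>)"
      using psat_step[of M \<pi>0 \<Phi> p] by auto
    have "E s {t. sat M t (C ?\<Psi>)}"
      unfolding 2 eff_unav_def
    proof (rule ballI, rule ccontr)
      fix \<alpha> assume \<alpha>: "\<alpha> \<in> actions M A s"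
        and no: "\<not> (\<exists>\<tau>\<in>profiles M s. (\<forall>a\<in>A. \<tau> a = \<alpha> a) \<and> out M s \<tau> \<in> {t. sat M t (Unav A ?\<Psi>)})"
      have "\<forall>t. \<exists>G. t \<in> St M \<longrightarrow> \<not> sat M t (Unav A ?\<Psi>) \<longrightarrow> G \<in> strategies M A \<and>
          (\<forall>\<pi>\<in>plays M. \<pi> 0 = t \<longrightarrow> consistent M A G \<pi> \<longrightarrow> \<not> psat M \<pi> ?\<Psi>)"
        using sat_Unav_iff[OF cgm] by blast
      then obtain G where G: "\<And>t. t \<in> St M \<Longrightarrow> \<not> sat M t (Unav A ?\<Psi>) \<Longrightarrow> G t \<in> strategies M A \<and>
          (\<forall>\<pi>\<in>plays M. \<pi> 0 = t \<longrightarrow> consistent M A (G t) \<pi> \<longrightarrow> \<not> psat M \<pi> ?\<Psi>)"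
        by metis
      obtain f where f: "f \<in> strategies M A" "f [s] = \<alpha>" using strategy_through[OF cgm s \<alpha>] by blast
      \<comment> \<open>Histories of length 2 are those seen right after the first move.\<close>
      define stop where "stop h \<longleftrightarrow> length h = 2 \<and> \<not> sat M (last h) (Unav A ?\<Psi>)" for h
      have G': "G (last h) \<in> strategies M A" if "h \<in> histories M" "stop h" for h
        using G[OF last_history_St[OF cgm that(1)]] that(2) by (simp add: stop_def)
      obtain F where F: "F \<in> strategies M A"
        "\<And>\<pi> i. \<pi> \<in> plays M \<Longrightarrow> consistent M A F \<pi> \<Longrightarrow> (\<And>j. j \<le> i \<Longrightarrow> \<not> stop (hist \<pi> j)) \<Longrightarrow>
          \<exists>\<tau>\<in>profiles M (\<pi> i). (\<forall>a\<in>A. \<tau> a = f (hist \<pi> i) a) \<and> \<pi> (Suc i) = out M (\<pi> i) \<tau>"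
        "\<And>\<pi> j. \<pi> \<in> plays M \<Longrightarrow> consistent M A F \<pi> \<Longrightarrow> stop (hist \<pi> j) \<Longrightarrow>
          (\<And>k. k < j \<Longrightarrow> \<not> stop (hist \<pi> k)) \<Longrightarrow>
          consistent M A (G (last (hist \<pi> j))) (\<lambda>n. \<pi> (n + j))"
        using glue_strategies[OF cgm strategies_mem[OF f(1)], of stop "\<lambda>h. G (last h)"] G' by blast
      obtain \<pi> where \<pi>: "\<pi> \<in> plays M" "\<pi> 0 = s" "consistent M A F \<pi>" "psat M \<pi> \<Phi>"
        using un[OF F(1)] by blast
      have "\<not> sat M (\<pi> 1) (Unav A ?\<Psi>)"
        using F(2)[OF \<pi>(1,3), of 0] no f(2) \<pi>(2) by (auto simp: stop_def)
      then have "consistent M A (G (\<pi> 1)) (\<lambda>n. \<pi> (Suc n))"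
        using F(3)[OF \<pi>(1,3), of 1] by (simp add: stop_def)
      moreover have "psat M (\<lambda>n. \<pi> (Suc n)) ?\<Psi>" using psat_step[OF \<pi>(4), of p] \<pi>(2) by auto
      moreover have "(\<lambda>n. \<pi> (Suc n)) \<in> plays M" using play_shift[OF cgm \<pi>(1), of 1] by simp
      ultimately show False
        using G[OF play_St[OF cgm \<pi>(1), of 1]] \<open>\<not> sat M (\<pi> 1) (Unav A ?\<Psi>)\<close> by fastforce
    qed
    then show thesis using that \<psi> by blast
  qed
qed

text \<open>Failure of attainment is inherited by some successor allowed by the strategy, since the
  residual formula holds there by shifting. Dependent choice turns this into a play consistent with
  \<open>F\<close> along which \<open>real_now\<close> never holds, against
  \<open>eventually_real_now\<close>.\<close>

lemma attains_Coop:
  assumes s: "s \<in> St M" and sat: "sat M s (Coop A \<Phi>)"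
  shows "attains M p (Coop A) (eff_coop M A) s \<Phi>"
proof (rule ccontr)
  let ?att = "attains M p (Coop A) (eff_coop M A)"
  assume not: "\<not> ?att s \<Phi>"
  obtain F where F: "F \<in> strategies M A"
    "\<And>\<pi>. \<pi> \<in> plays M \<Longrightarrow> \<pi> 0 = s \<Longrightarrow> consistent M A F \<pi> \<Longrightarrow> psat M \<pi> \<Phi>" using sat by auto
  \<comment> \<open>The strategy is part of the tuple because it is shifted at every step; the last
    component is the current residual.\<close>
  define good where "good = (\<lambda>(G, t, \<Psi>). G \<in> strategies M A \<and> t \<in> St M \<and> \<not> ?att t \<Psi> \<and>
    (\<forall>\<pi>\<in>plays M. \<pi> 0 = t \<and> consistent M A G \<pi> \<longrightarrow> psat M \<pi> \<Psi>))"
  define nxt where "nxt = (\<lambda>(G, t, \<Psi>) (G', t', \<Psi>').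
    (\<forall>h\<in>histories M. t # h \<in> histories M \<longrightarrow> G' h = G (t # h)) \<and>
    (\<exists>\<tau>\<in>profiles M t. (\<forall>a\<in>A. \<tau> a = G [t] a) \<and> t' = out M t \<tau>) \<and> \<Psi>' = step M p t \<Psi>)"
  have ex: "\<exists>y. good y \<and> nxt x y" if "good x" for x
  proof -
    obtain G t \<Psi> where x: "x = (G, t, \<Psi>)" using prod_cases3 by blast
    have g: "G \<in> strategies M A" "t \<in> St M" "\<not> ?att t \<Psi>"
      "\<And>\<pi>. \<pi> \<in> plays M \<Longrightarrow> \<pi> 0 = t \<Longrightarrow> consistent M A G \<pi> \<Longrightarrow> psat M \<pi> \<Psi>"
      using that by (auto simp: good_def x)
    obtain G' where G': "G' \<in> strategies M A" "\<forall>h\<in>histories M. t # h \<in> histories M \<longrightarrow> G' h = G (t # h)"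
      using shift_strategy[OF cgm g(1)] by blast
    have "\<not> eff_coop M A t {t'. sat M t' (Coop A (step M p t \<Psi>)) \<and> ?att t' (step M p t \<Psi>)}"
      using g(3) attains.later[of "eff_coop M A" t _ M "Coop A" p \<Psi>] by blast
    moreover have "G [t] \<in> actions M A t"
      using strategies_mem[OF g(1) singleton_history[OF cgm g(2)]] by simp
    ultimately obtain \<tau> where \<tau>: "\<tau> \<in> profiles M t" "\<forall>a\<in>A. \<tau> a = G [t] a"
      "\<not> (sat M (out M t \<tau>) (Coop A (step M p t \<Psi>)) \<and> ?att (out M t \<tau>) (step M p t \<Psi>))"
      unfolding eff_coop_def by blast
    have sh: "psat M \<pi> (step M p t \<Psi>)"
      if "\<pi> \<in> plays M" "\<pi> 0 = out M t \<tau>" "consistent M A G' \<pi>" for \<pi>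
      using sat_Coop_shift[OF g(1) G' g(2,4) \<tau>(1,2) that] .
    then have "sat M (out M t \<tau>) (Coop A (step M p t \<Psi>))"
      unfolding sat.simps using G'(1) by blast
    then have "good (G', out M t \<tau>, step M p t \<Psi>)"
      using G'(1) out_St[OF cgm g(2) \<tau>(1)] \<tau>(3) sh by (auto simp: good_def)
    moreover have "nxt x (G', out M t \<tau>, step M p t \<Psi>)" using G'(2) \<tau>(1,2) by (auto simp: nxt_def x)
    ultimately show ?thesis by blast
  qed
  have "good (F, s, \<Phi>)" using F s not by (auto simp: good_def)
  then obtain f where f: "f 0 = (F, s, \<Phi>)" "\<And>i. good (f i)" "\<And>i. nxt (f i) (f (Suc i))"
    using dependent_nat_choice[of "\<lambda>i x. good x \<and> (i = 0 \<longrightarrow> x = (F, s, \<Phi>))" "\<lambda>_. nxt"] ex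
    by (metis nat.distinct(1))
  define G \<pi> R where "G i = fst (f i)" and "\<pi> i = fst (snd (f i))" and "R i = snd (snd (f i))" for i
  have fi: "f i = (G i, \<pi> i, R i)" for i by (simp add: G_def \<pi>_def R_def)
  have init: "G 0 = F" "\<pi> 0 = s" "R 0 = \<Phi>" using f(1) fi[of 0] by auto
  have gd: "\<pi> i \<in> St M" "\<not> ?att (\<pi> i) (R i)" for i
    using f(2)[of i] by (simp_all add: good_def fi)
  have nx: "\<forall>h\<in>histories M. \<pi> i # h \<in> histories M \<longrightarrow> G (Suc i) h = G i (\<pi> i # h)"
    "\<exists>\<tau>\<in>profiles M (\<pi> i). (\<forall>a\<in>A. \<tau> a = G i [\<pi> i] a) \<and> \<pi> (Suc i) = out M (\<pi> i) \<tau>"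
    "R (Suc i) = step M p (\<pi> i) (R i)" for i
    using f(3)[of i] by (simp_all add: nxt_def fi)
  have pl: "\<pi> \<in> plays M" unfolding plays_def using gd(1)[of 0] nx(2) by blast
  \<comment> \<open>Undoing \<open>i\<close> shifts gives back \<open>F\<close> on the full history.
    The instance \<open>j = 0\<close> then yields consistency with \<open>F\<close>.\<close>
  have "G i (hist (\<lambda>n. \<pi> (n + i)) j) = F (hist \<pi> (i + j))" for i j
  proof (induction i arbitrary: j)
    case 0
    then show ?case by (simp add: init)
  next
    case (Suc i)
    have h: "hist (\<lambda>n. \<pi> (n + i)) (Suc j) = \<pi> i # hist (\<lambda>n. \<pi> (n + Suc i)) j"
      by (simp add: hist_shift_Suc)
    have "hist (\<lambda>n. \<pi> (n + Suc i)) j \<in> histories M" "hist (\<lambda>n. \<pi> (n + i)) (Suc j) \<in> histories M"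
      using histories_hist[OF play_shift[OF cgm pl]] by blast+
    then show ?case using nx(1)[of i] Suc[of "Suc j"] h by simp
  qed
  from this[of _ 0] have "consistent M A F \<pi>"
    unfolding consistent_def using nx(2) by simp
  then have "psat M \<pi> \<Phi>" using F(2)[OF pl init(2)] by blast
  moreover have "R i = residual M p \<pi> \<Phi> i" for i
    by (induction i) (simp_all add: init nx(3))
  ultimately obtain i where "real_now M p (\<pi> i) (R i)"
    using eventually_real_now[of M \<pi> \<Phi> p] by auto
  then show False using gd(2)[of i] by (simp add: attains.now)
qed

text \<open>\<open>A\<close> plays actions that block attainment and, once the residual formula
  fails, switches for good to a strategy that avoids the residual. Unavoidability supplies a
  consistent play that satisfies \<Phi>. The switch never happens on it, since its remainder
  satisfies the residual; and without a switch it never attains, against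
  \<open>eventually_real_now\<close>.\<close>

lemma attains_Unav:
  assumes s: "s \<in> St M" and sat: "sat M s (Unav A \<Phi>)"
  shows "attains M p (Unav A) (eff_unav M A) s \<Phi>"
proof (rule ccontr)
  let ?att = "attains M p (Unav A) (eff_unav M A)"
  assume not: "\<not> ?att s \<Phi>"
  define R where "R h = fold (step M p) (butlast h) \<Phi>" for h
  define stop where "stop h \<longleftrightarrow> \<not> sat M (last h) (Unav A (R h))" for h
  \<comment> \<open>By rule \<open>later\<close>, failure of attainment means that the set of
    successors where the residual formula is true and attained can be avoided; some action of
    \<open>A\<close> does so.\<close>
  have "\<exists>\<alpha>\<in>actions M A (last h). \<not> ?att (last h) (R h) \<longrightarrow>
      (\<forall>\<tau>\<in>profiles M (last h). (\<forall>a\<in>A. \<tau> a = \<alpha> a) \<longrightarrow>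
        \<not> (sat M (out M (last h) \<tau>) (Unav A (step M p (last h) (R h))) \<and>
          ?att (out M (last h) \<tau>) (step M p (last h) (R h))))" if h: "h \<in> histories M" for h
  proof (cases "?att (last h) (R h)")
    case True
    then show ?thesis using actions_ex[OF cgm last_history_St[OF cgm h]] by blast
  next
    case False
    then have "\<not> eff_unav M A (last h)
        {t. sat M t (Unav A (step M p (last h) (R h))) \<and> ?att t (step M p (last h) (R h))}"
      using attains.later[of "eff_unav M A" "last h" _ M "Unav A" p "R h"] by blast
    then show ?thesis unfolding eff_unav_def by blast
  qed
  then obtain f where f: "\<And>h. h \<in> histories M \<Longrightarrow> f h \<in> actions M A (last h)"
    "\<And>h \<tau>. h \<in> histories M \<Longrightarrow> \<not> ?att (last h) (R h) \<Longrightarrow> \<tau> \<in> profiles M (last h) \<Longrightarrow>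
      (\<forall>a\<in>A. \<tau> a = f h a) \<Longrightarrow> sat M (out M (last h) \<tau>) (Unav A (step M p (last h) (R h))) \<Longrightarrow>
      \<not> ?att (out M (last h) \<tau>) (step M p (last h) (R h))"
    by metis
  have "\<forall>h. \<exists>G. h \<in> histories M \<longrightarrow> stop h \<longrightarrow> G \<in> strategies M A \<and>
      (\<forall>\<pi>\<in>plays M. \<pi> 0 = last h \<longrightarrow> consistent M A G \<pi> \<longrightarrow> \<not> psat M \<pi> (R h))"
    using sat_Unav_iff[OF cgm last_history_St[OF cgm]] unfolding stop_def by blast
  then obtain G where G: "\<And>h. h \<in> histories M \<Longrightarrow> stop h \<Longrightarrow> G h \<in> strategies M A"
    "\<And>h \<pi>. h \<in> histories M \<Longrightarrow> stop h \<Longrightarrow> \<pi> \<in> plays M \<Longrightarrow> \<pi> 0 = last h \<Longrightarrow>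
      consistent M A (G h) \<pi> \<Longrightarrow> \<not> psat M \<pi> (R h)"
    by metis
  obtain F where F: "F \<in> strategies M A"
    "\<And>\<pi> i. \<pi> \<in> plays M \<Longrightarrow> consistent M A F \<pi> \<Longrightarrow> (\<And>j. j \<le> i \<Longrightarrow> \<not> stop (hist \<pi> j)) \<Longrightarrow>
      \<exists>\<tau>\<in>profiles M (\<pi> i). (\<forall>a\<in>A. \<tau> a = f (hist \<pi> i) a) \<and> \<pi> (Suc i) = out M (\<pi> i) \<tau>"
    "\<And>\<pi> j. \<pi> \<in> plays M \<Longrightarrow> consistent M A F \<pi> \<Longrightarrow> stop (hist \<pi> j) \<Longrightarrow>
      (\<And>k. k < j \<Longrightarrow> \<not> stop (hist \<pi> k)) \<Longrightarrow>
      consistent M A (G (hist \<pi> j)) (\<lambda>n. \<pi> (n + j))"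
    using glue_strategies[OF cgm f(1), of stop G] G(1) by blast
  obtain \<pi> where \<pi>: "\<pi> \<in> plays M" "\<pi> 0 = s" "consistent M A F \<pi>" "psat M \<pi> \<Phi>"
    using sat F(1) sat_Unav_iff[OF cgm s] by blast
  have R: "R (hist \<pi> i) = residual M p \<pi> \<Phi> i" for i by (simp add: R_def)
  have no_stop: "\<not> stop (hist \<pi> j)" for j
  proof
    assume "stop (hist \<pi> j)"
    then obtain j where j: "stop (hist \<pi> j)" "\<And>k. k < j \<Longrightarrow> \<not> stop (hist \<pi> k)"
      using exists_least_iff[of "\<lambda>j. stop (hist \<pi> j)"] by blast
    have "\<not> psat M (\<lambda>n. \<pi> (n + j)) (R (hist \<pi> j))"
      using G(2)[OF histories_hist[OF \<pi>(1)] j(1) play_shift[OF cgm \<pi>(1)] _ F(3)[OF \<pi>(1,3) j]] by simp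
    then show False using psat_residual[OF \<pi>(4)] R by metis
  qed
  have na: "\<not> ?att (\<pi> i) (residual M p \<pi> \<Phi> i)" for i
  proof (induction i)
    case 0
    then show ?case using not \<pi>(2) by simp
  next
    case (Suc i)
    obtain \<tau> where \<tau>: "\<tau> \<in> profiles M (\<pi> i)" "\<forall>a\<in>A. \<tau> a = f (hist \<pi> i) a" "\<pi> (Suc i) = out M (\<pi> i) \<tau>"
      using F(2)[OF \<pi>(1,3) no_stop] by blast
    have "sat M (\<pi> (Suc i)) (Unav A (residual M p \<pi> \<Phi> (Suc i)))"
      using no_stop[of "Suc i"] unfolding stop_def R last_hist by blast
    then show ?case
      using f(2)[OF histories_hist[OF \<pi>(1)], of i \<tau>] \<tau> Suc R[of i] by (simp del: sat.simps)
  qed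
  obtain i where "real_now M p (\<pi> i) (residual M p \<pi> \<Phi> i)"
    using eventually_real_now[OF \<pi>(4), of p] by blast
  then show False using na[of i] by (simp add: attains.now)
qed

lemma sat_attains:
  assumes "modality M C E" "s \<in> St M" "sat M s (C \<Phi>)"
  shows "attains M p C E s \<Phi>"
proof -
  from assms(1) consider A where "C = Coop A" "E = eff_coop M A" | A where "C = Unav A" "E = eff_unav M A"
    by (auto simp: modality_def)
  then show ?thesis using assms(2,3) attains_Coop attains_Unav by cases blast+
qed

end

section \<open>Satisfiable tableau states\<close>

abbreviation true_at :: "('ag, 'p, 's, 'c) cgm \<Rightarrow> 's \<Rightarrow> ('ag, 'p) sform set \<Rightarrow> bool" where
  "true_at M t \<Gamma> \<equiv> \<forall>\<phi>\<in>\<Gamma>. sat M t \<phi>"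

definition link :: "'p \<Rightarrow> (('ag, 'p) pform \<Rightarrow> ('ag, 'p) sform) \<Rightarrow> ('ag, 'p) sform \<Rightarrow>
    ('ag, 'p) pform \<Rightarrow> ('ag, 'p) sform" where
  "link p C \<psi> \<Psi> = (if \<Psi> = PState (Top p) then \<psi> else And \<psi> (C (Next (C \<Psi>))))"

lemma gamma_comps_modality:
  assumes "modality M C E" "\<not> is_next \<Phi>"
  shows "gamma_comps p (C \<Phi>) = {link p C \<psi> \<Psi> | \<psi> \<Psi>. (\<psi>, \<Psi>) \<in> dec p \<Phi>}"
proof -
  obtain A where "C = Coop A \<or> C = Unav A" using assms(1) by (auto simp: modality_def)
  then have "gamma_comps p (C \<Phi>) = (\<lambda>(\<psi>, \<Psi>). link p C \<psi> \<Psi>) ` dec p \<Phi>"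
    using assms(2) by (elim disjE) (simp_all add: gamma_comps_def link_def)
  then show ?thesis by auto
qed

lemma gamma_formula_modality:
  "modality M C E \<Longrightarrow> \<not> is_next \<Phi> \<Longrightarrow> gamma_formula (C \<Phi>)"
  by (auto simp: modality_def gamma_formula_def)

lemma gamma_formulaE:
  assumes "gamma_formula \<xi>"
  obtains C E \<Phi> where "modality M C E" "\<xi> = C \<Phi>" "\<not> is_next \<Phi>"
proof -
  obtain A \<Phi> where "\<xi> = Coop A \<Phi> \<or> \<xi> = Unav A \<Phi>" "\<not> is_next \<Phi>"
    using assms by (auto simp: gamma_formula_def)
  then show thesis
    using that[of "Coop A" "eff_coop M A" \<Phi>] that[of "Unav A" "eff_unav M A" \<Phi>]
    by (auto simp: modality_def)
qed

text \<open>\<open>sr_complete\<close> adds at most \<open>Coop UNIV (Next (Top p))\<close>, which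
  is not a \<gamma>-formula and has no \<alpha>-components, so these closure properties of full
  expansions persist.\<close>

lemma sr_edge_facts:
  fixes \<Delta> :: "('ag, 'p) sform set"
  assumes "sr_edge p \<Gamma> (\<Delta>, \<gamma>)"
  shows "and_closed \<Delta>"
    and "Unav UNIV (Next \<psi>) \<in> \<Delta> \<Longrightarrow> Coop {} (Next \<psi>) \<in> \<Delta>"
    and "\<xi> \<in> \<Delta> \<Longrightarrow> gamma_formula \<xi> \<Longrightarrow> \<exists>\<chi>. \<gamma> \<xi> = Some \<chi> \<and> \<chi> \<in> gamma_comps p \<xi> \<and> \<chi> \<in> \<Delta>"
proof -
  obtain \<Delta>0 where f: "full_expansion p \<Gamma> (\<Delta>0, \<gamma>)"
    and \<Delta>: "\<Delta> = \<Delta>0 \<or> \<Delta> = insert (Coop UNIV (Next (Top p))) \<Delta>0"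
    using assms by (auto simp: sr_edge_def sr_complete_def split: if_splits)
  have alpha: "alpha_comps \<xi> \<subseteq> \<Delta>" if "\<xi> \<in> \<Delta>" for \<xi>
  proof -
    have "\<xi> \<in> \<Delta>0 \<Longrightarrow> alpha_comps \<xi> \<subseteq> \<Delta>0" using f by (simp add: full_expansion_def)
    moreover have "alpha_comps (Coop UNIV (Next (Top p)) :: ('ag, 'p) sform) = {}"
      by (simp add: alpha_comps_def)
    ultimately show ?thesis using that \<Delta> by auto
  qed
  show "and_closed \<Delta>"
    unfolding and_closed_def
  proof (intro allI impI)
    fix \<phi> \<psi> :: "('ag, 'p) sform" assume "And \<phi> \<psi> \<in> \<Delta>"
    from alpha[OF this] show "\<phi> \<in> \<Delta> \<and> \<psi> \<in> \<Delta>" by (simp add: alpha_comps_def)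
  qed
  show "Coop {} (Next \<psi>) \<in> \<Delta>" if "Unav UNIV (Next \<psi>) \<in> \<Delta>"
    using alpha[OF that] by (simp add: alpha_comps_def)
  show "\<exists>\<chi>. \<gamma> \<xi> = Some \<chi> \<and> \<chi> \<in> gamma_comps p \<xi> \<and> \<chi> \<in> \<Delta>" if "\<xi> \<in> \<Delta>" "gamma_formula \<xi>"
  proof -
    have "\<xi> \<noteq> Coop UNIV (Next (Top p))" using that(2) by (auto simp: gamma_formula_def is_next_def)
    then have "\<xi> \<in> \<Delta>0" using that(1) \<Delta> by blast
    have "dom \<gamma> = {\<xi> \<in> \<Delta>0. gamma_formula \<xi>}" "\<And>\<chi>. \<gamma> \<xi> = Some \<chi> \<Longrightarrow> \<chi> \<in> gamma_comps p \<xi> \<and> \<chi> \<in> \<Delta>0"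
      using f by (simp_all add: full_expansion_def)
    moreover from this \<open>\<xi> \<in> \<Delta>0\<close> that(2) obtain \<chi> where "\<gamma> \<xi> = Some \<chi>" by blast
    ultimately show ?thesis using \<Delta> by blast
  qed
qed

lemma listing_sets:
  assumes "listing L" "finite \<Delta>"
  shows "set (coops L (\<Delta>, \<gamma>)) = {(A, \<phi>). Coop A (Next \<phi>) \<in> \<Delta>}"
    "set (unavs L (\<Delta>, \<gamma>)) = {(A, \<psi>). Unav A (Next \<psi>) \<in> \<Delta> \<and> A \<noteq> UNIV}"
proof -
  have "case L (\<Delta>, \<gamma>) of (cs, us) \<Rightarrow>
      distinct cs \<and> set cs = {(A, \<phi>). Coop A (Next \<phi>) \<in> \<Delta>} \<and>
      distinct us \<and> set us = {(A, \<psi>). Unav A (Next \<psi>) \<in> \<Delta> \<and> A \<noteq> UNIV}"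
    using assms(1)[unfolded listing_def, THEN spec, THEN spec, THEN mp, OF assms(2)] .
  then show "set (coops L (\<Delta>, \<gamma>)) = {(A, \<phi>). Coop A (Next \<phi>) \<in> \<Delta>}"
    "set (unavs L (\<Delta>, \<gamma>)) = {(A, \<psi>). Unav A (Next \<psi>) \<in> \<Delta> \<and> A \<noteq> UNIV}"
    by (simp_all add: case_prod_beta)
qed

context
  fixes M :: "('ag, 'p, 's, 'c) cgm" and p :: 'p
  assumes cgm: "is_cgm M"
begin

lemma sat_Unav_UNIV_Next:
  assumes "s \<in> St M" "sat M s (Unav UNIV (Next \<psi>))"
  shows "sat M s (Coop {} (Next \<psi>))"
proof -
  have "eff_unav M UNIV s {t. sat M t \<psi>}" using assms sat_Unav_Next_iff[OF cgm] by blast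
  then have "out M s \<tau> \<in> {t. sat M t \<psi>}" if "\<tau> \<in> profiles M s" for \<tau>
    using that unfolding eff_unav_def by (metis UNIV_I ext)
  moreover obtain \<alpha> where "\<alpha> \<in> actions M {} s" using actions_ex[OF cgm assms(1)] by blast
  ultimately have "eff_coop M {} s {t. sat M t \<psi>}" unfolding eff_coop_def by blast
  then show ?thesis using assms(1) sat_Coop_Next_iff[OF cgm] by blast
qed

lemma sat_alpha_comps:
  assumes "t \<in> St M" "sat M t \<xi>" "\<phi> \<in> alpha_comps \<xi>"
  shows "sat M t \<phi>"
proof -
  from assms(3) consider \<psi> \<chi> where "\<xi> = And \<psi> \<chi>" "\<phi> = \<psi> \<or> \<phi> = \<chi>"
    | \<psi> where "\<xi> = Unav UNIV (Next \<psi>)" "\<phi> = Coop {} (Next \<psi>)"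
    by (auto simp: alpha_comps_def split: sform.splits pform.splits if_splits)
  then show ?thesis
  proof cases
    case 1
    then show ?thesis using assms(2) by auto
  next
    case 2
    then show ?thesis using assms(1,2) sat_Unav_UNIV_Next by blast
  qed
qed

lemma sat_link:
  assumes C: "modality M C E" and t: "t \<in> St M" and sat: "sat M t (C \<Phi>)"
  obtains \<psi> where "best p (sat M t) \<Phi> = Some (\<psi>, step M p t \<Phi>)"
    "sat M t (link p C \<psi> (step M p t \<Phi>))"
proof -
  obtain \<psi> where \<psi>: "best p (sat M t) \<Phi> = Some (\<psi>, step M p t \<Phi>)" "E t {u. sat M u (C (step M p t \<Phi>))}"
    using sat_modality_step[OF cgm C t sat] by blast
  have "sat M t \<psi>" using best_true[OF \<psi>(1)] .
  moreover have "sat M t (C (Next (C (step M p t \<Phi>))))" using sat_Next_iff[OF cgm C t] \<psi>(2) by blast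
  ultimately show thesis using that[OF \<psi>(1)] by (simp add: link_def)
qed

text \<open>The link to the canonical pair of a true \<gamma>-formula is itself true. A choice
  function for all formulae at once allows a single link to be overridden later.\<close>

lemma true_links_ex:
  assumes "t \<in> St M"
  shows "\<exists>g. \<forall>\<xi>. gamma_formula \<xi> \<longrightarrow> sat M t \<xi> \<longrightarrow> g \<xi> \<in> gamma_comps p \<xi> \<and> sat M t (g \<xi>)"
proof -
  have "\<exists>\<chi>. \<chi> \<in> gamma_comps p \<xi> \<and> sat M t \<chi>" if g: "gamma_formula \<xi>" and s: "sat M t \<xi>" for \<xi>
  proof -
    obtain C E \<Phi> where C: "modality M C E" "\<xi> = C \<Phi>" "\<not> is_next \<Phi>" using gamma_formulaE[OF g] .
    obtain \<psi> where \<psi>: "best p (sat M t) \<Phi> = Some (\<psi>, step M p t \<Phi>)"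
      "sat M t (link p C \<psi> (step M p t \<Phi>))"
      using sat_link[OF C(1) assms] s C(2) by blast
    have "link p C \<psi> (step M p t \<Phi>) \<in> gamma_comps p \<xi>"
      unfolding C(2) gamma_comps_modality[OF C(1,3)] using best_dec[OF \<psi>(1)] by blast
    then show ?thesis using \<psi>(2) by blast
  qed
  then show ?thesis by metis
qed

text \<open>All formulae of the closure that hold at \<open>t\<close> form a full expansion, with any true links.\<close>

lemma true_expansion:
  assumes t: "t \<in> St M" and \<Gamma>: "true_at M t \<Gamma>"
    and g: "\<And>\<xi>. gamma_formula \<xi> \<Longrightarrow> sat M t \<xi> \<Longrightarrow> g \<xi> \<in> gamma_comps p \<xi> \<and> sat M t (g \<xi>)"
  shows "\<exists>\<Delta> \<gamma>. sr_edge p \<Gamma> (\<Delta>, \<gamma>) \<and> \<Gamma> \<subseteq> \<Delta> \<and> true_at M t \<Delta> \<and>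
    (\<forall>\<xi>\<in>\<Gamma>. gamma_formula \<xi> \<longrightarrow> \<gamma> \<xi> = Some (g \<xi>))"
proof -
  define \<Delta> where "\<Delta> = {\<phi> \<in> cl p \<Gamma>. sat M t \<phi>}"
  define \<gamma> where "\<gamma> \<xi> = (if \<xi> \<in> \<Delta> \<and> gamma_formula \<xi> then Some (g \<xi>) else None)" for \<xi>
  have sub: "\<Gamma> \<subseteq> \<Delta>" "\<Delta> \<subseteq> cl p \<Gamma>" using \<Gamma> cl.base by (auto simp: \<Delta>_def)
  have "Bot p \<notin> \<Delta>" "\<not> (Lit q \<in> \<Delta> \<and> NLit q \<in> \<Delta>)" for q by (auto simp: \<Delta>_def)
  moreover have "alpha_comps \<xi> \<subseteq> \<Delta>" if "\<xi> \<in> \<Delta>" for \<xi>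
  proof
    fix \<phi> assume "\<phi> \<in> alpha_comps \<xi>"
    then show "\<phi> \<in> \<Delta>" using that sat_alpha_comps[OF t, of \<xi> \<phi>] cl.comp[of \<xi> p \<Gamma> \<phi>] by (simp add: \<Delta>_def)
  qed
  moreover have "\<phi> \<in> \<Delta> \<or> \<psi> \<in> \<Delta>" if "Or \<phi> \<psi> \<in> \<Delta>" for \<phi> \<psi>
    using that cl.comp[of "Or \<phi> \<psi>" p \<Gamma> \<phi>] cl.comp[of "Or \<phi> \<psi>" p \<Gamma> \<psi>]
    by (auto simp: \<Delta>_def beta_comps_def)
  moreover have "dom \<gamma> = {\<xi> \<in> \<Delta>. gamma_formula \<xi>}"
    by (auto simp: \<gamma>_def split: if_splits)
  moreover have "\<chi> \<in> gamma_comps p \<xi> \<and> \<chi> \<in> \<Delta>" if "\<gamma> \<xi> = Some \<chi>" for \<xi> \<chi>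
  proof -
    have x: "\<xi> \<in> cl p \<Gamma>" "sat M t \<xi>" "gamma_formula \<xi>" "\<chi> = g \<xi>"
      using that unfolding \<gamma>_def \<Delta>_def by (simp_all split: if_splits)
    then have "\<chi> \<in> gamma_comps p \<xi>" "sat M t \<chi>" using g by blast+
    then show ?thesis using cl.comp[OF x(1)] unfolding \<Delta>_def by blast
  qed
  ultimately have f: "full_expansion p \<Gamma> (\<Delta>, \<gamma>)" using sub by (simp add: full_expansion_def)
  define \<Delta>' where "\<Delta>' = (if has_next \<Delta> then \<Delta> else insert (Coop UNIV (Next (Top p))) \<Delta>)"
  have "sr_edge p \<Gamma> (\<Delta>', \<gamma>)"
    unfolding sr_edge_def by (rule exI[of _ "(\<Delta>, \<gamma>)"]) (simp add: f sr_complete_def \<Delta>'_def)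
  moreover have "sat M t (Coop UNIV (Next (Top p)))"
  proof -
    have "eff_coop M UNIV t {u. sat M u (Top p)}"
      using actions_ex[OF cgm t, of UNIV] by (auto simp: eff_coop_def)
    then show ?thesis using sat_Coop_Next_iff[OF cgm t] by blast
  qed
  then have "true_at M t \<Delta>'" unfolding \<Delta>'_def \<Delta>_def by (simp del: sat.simps)
  moreover have "\<Gamma> \<subseteq> \<Delta>'" using sub by (auto simp: \<Delta>'_def)
  moreover have "\<gamma> \<xi> = Some (g \<xi>)" if "\<xi> \<in> \<Gamma>" "gamma_formula \<xi>" for \<xi>
    using that sub by (auto simp: \<gamma>_def)
  ultimately show ?thesis by blast
qed

text \<open>Agents voting for a cooperation formula play their action for it. The remaining agents, who
  include all of \<open>- A\<close> when \<open>[[A]]\<circle>\<psi>\<close> is activated, can respond to what \<open>A\<close> has chosen.\<close>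

lemma profile_for_move:
  assumes t: "t \<in> St M" and \<sigma>: "\<sigma> \<in> moves L S"
    and Yc: "\<And>n. n < length (coops L S) \<Longrightarrow> eff_coop M (fst (coops L S ! n)) t (Yc n)"
    and Yu: "\<And>q. q < length (unavs L S) \<Longrightarrow> eff_unav M (fst (unavs L S ! q)) t (Yu q)"
  obtains \<tau> where "\<tau> \<in> profiles M t"
    "\<And>n. n < length (coops L S) \<Longrightarrow> \<sigma> \<in> coop_moves L S (fst (coops L S ! n)) n \<Longrightarrow> out M t \<tau> \<in> Yc n"
    "\<And>q. q < length (unavs L S) \<Longrightarrow> \<sigma> \<in> unav_moves L S (fst (unavs L S ! q)) q \<Longrightarrow> out M t \<tau> \<in> Yu q"
proof -
  let ?m = "length (coops L S)" and ?l = "length (unavs L S)"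
  let ?A = "\<lambda>n. fst (coops L S ! n)" and ?B = "\<lambda>q. fst (unavs L S ! q)"
  obtain \<alpha> where \<alpha>: "\<And>n. n < ?m \<Longrightarrow> \<alpha> n \<in> actions M (?A n) t"
    "\<And>n \<tau>. n < ?m \<Longrightarrow> \<tau> \<in> profiles M t \<Longrightarrow> (\<forall>a\<in>?A n. \<tau> a = \<alpha> n a) \<Longrightarrow> out M t \<tau> \<in> Yc n"
    using Yc unfolding eff_coop_def by metis
  obtain \<rho> where \<rho>: "\<rho> \<in> profiles M t" using actions_ex[OF cgm t] by blast
  \<comment> \<open>An agent votes for a single number, so the activated cooperation formulae never
    demand two different actions of it.\<close>
  define \<tau>0 where "\<tau>0 a = (if \<sigma> a < ?m \<and> a \<in> ?A (\<sigma> a) then \<alpha> (\<sigma> a) a else \<rho> a)" for a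
  have \<tau>0: "\<tau>0 \<in> profiles M t"
    using \<rho> actions_mem[OF \<alpha>(1)] by (auto simp: profiles_iff \<tau>0_def)
  have agree: "\<tau>0 a = \<alpha> n a" "a \<notin> neg_agents L S \<sigma>"
    if "n < ?m" "\<sigma> \<in> coop_moves L S (?A n) n" "a \<in> ?A n" for n a
    using that by (auto simp: \<tau>0_def coop_moves_def neg_agents_def)
  show thesis
  proof (cases "\<exists>q<?l. \<sigma> \<in> unav_moves L S (?B q) q")
    case True
    then obtain q where q: "q < ?l" "\<sigma> \<in> unav_moves L S (?B q) q" by blast
    have "restrict \<tau>0 (?B q) \<in> actions M (?B q) t"
      using \<tau>0 by (auto simp: actions_def)
    then obtain \<tau> where \<tau>: "\<tau> \<in> profiles M t" "\<forall>a\<in>?B q. \<tau> a = restrict \<tau>0 (?B q) a" "out M t \<tau> \<in> Yu q"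
      using Yu[OF q(1)] unfolding eff_unav_def by blast
    have "\<tau> a = \<alpha> n a" if n: "n < ?m" "\<sigma> \<in> coop_moves L S (?A n) n" "a \<in> ?A n" for n a
    proof -
      \<comment> \<open>Voters for a cooperation formula lie outside
        \<open>neg_agents L S \<sigma>\<close>, whereas all agents outside \<open>?B q\<close> lie
        inside it. The response of the latter thus changes no action fixed by a cooperation
        formula.\<close>
      have "a \<in> ?B q" using agree(2)[OF n] q(2) unfolding unav_moves_def by blast
      then show ?thesis using agree(1)[OF n] \<tau>(2) by simp
    qed
    \<comment> \<open>\<open>co\<close> has a single value, so at most one unavoidable formula is
      activated and one response serves.\<close>
    moreover have "q' = q" if "\<sigma> \<in> unav_moves L S (?B q') q'" for q'
      using that q(2) by (simp add: unav_moves_def)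
    ultimately show thesis using that[OF \<tau>(1)] \<alpha>(2)[OF _ \<tau>(1)] \<tau>(3) by blast
  next
    case False
    then show thesis using that[OF \<tau>0] \<alpha>(2)[OF _ \<tau>0] agree(1) by blast
  qed
qed

lemma listing_eff:
  assumes L: "listing L" "finite \<Delta>" and t: "t \<in> St M" "true_at M t \<Delta>"
  shows "n < length (coops L (\<Delta>, \<gamma>)) \<Longrightarrow>
      eff_coop M (fst (coops L (\<Delta>, \<gamma>) ! n)) t {u. sat M u (snd (coops L (\<Delta>, \<gamma>) ! n))}"
    and "q < length (unavs L (\<Delta>, \<gamma>)) \<Longrightarrow>
      eff_unav M (fst (unavs L (\<Delta>, \<gamma>) ! q)) t {u. sat M u (snd (unavs L (\<Delta>, \<gamma>) ! q))}"
proof -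
  assume n: "n < length (coops L (\<Delta>, \<gamma>))"
  have "coops L (\<Delta>, \<gamma>) ! n \<in> {(A, \<phi>). Coop A (Next \<phi>) \<in> \<Delta>}"
    using nth_mem[OF n] unfolding listing_sets(1)[OF L] .
  then have "sat M t (Coop (fst (coops L (\<Delta>, \<gamma>) ! n)) (Next (snd (coops L (\<Delta>, \<gamma>) ! n))))"
    using t(2) by (simp add: case_prod_beta del: sat.simps)
  then show "eff_coop M (fst (coops L (\<Delta>, \<gamma>) ! n)) t {u. sat M u (snd (coops L (\<Delta>, \<gamma>) ! n))}"
    using sat_Coop_Next_iff[OF cgm t(1)] by blast
next
  assume q: "q < length (unavs L (\<Delta>, \<gamma>))"
  have "unavs L (\<Delta>, \<gamma>) ! q \<in> {(A, \<psi>). Unav A (Next \<psi>) \<in> \<Delta> \<and> A \<noteq> UNIV}"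
    using nth_mem[OF q] unfolding listing_sets(2)[OF L] .
  then have "sat M t (Unav (fst (unavs L (\<Delta>, \<gamma>) ! q)) (Next (snd (unavs L (\<Delta>, \<gamma>) ! q))))"
    using t(2) by (simp add: case_prod_beta del: sat.simps)
  then show "eff_unav M (fst (unavs L (\<Delta>, \<gamma>) ! q)) t {u. sat M u (snd (unavs L (\<Delta>, \<gamma>) ! q))}"
    using sat_Unav_Next_iff[OF cgm t(1)] by blast
qed

text \<open>\<open>Yc\<close> and \<open>Yu\<close> may be smaller than the truth sets of the listed
  formulae. A successor can thus satisfy the whole next prestate and still be steered into a set
  that marks progress.\<close>

lemma move_successor:
  assumes t: "t \<in> St M" and \<sigma>: "\<sigma> \<in> moves L S"
    and Yc: "\<And>n. n < length (coops L S) \<Longrightarrow> eff_coop M (fst (coops L S ! n)) t (Yc n)"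
      "\<And>n u. n < length (coops L S) \<Longrightarrow> u \<in> Yc n \<Longrightarrow> sat M u (snd (coops L S ! n))"
    and Yu: "\<And>q. q < length (unavs L S) \<Longrightarrow> eff_unav M (fst (unavs L S ! q)) t (Yu q)"
      "\<And>q u. q < length (unavs L S) \<Longrightarrow> u \<in> Yu q \<Longrightarrow> sat M u (snd (unavs L S ! q))"
  obtains u where "u \<in> St M" "true_at M u (next_prestate L p S \<sigma>)"
    "\<And>n. n < length (coops L S) \<Longrightarrow> \<sigma> \<in> coop_moves L S (fst (coops L S ! n)) n \<Longrightarrow> u \<in> Yc n"
    "\<And>q. q < length (unavs L S) \<Longrightarrow> \<sigma> \<in> unav_moves L S (fst (unavs L S ! q)) q \<Longrightarrow> u \<in> Yu q"
proof -
  obtain \<tau> where \<tau>: "\<tau> \<in> profiles M t"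
    "\<And>n. n < length (coops L S) \<Longrightarrow> \<sigma> \<in> coop_moves L S (fst (coops L S ! n)) n \<Longrightarrow> out M t \<tau> \<in> Yc n"
    "\<And>q. q < length (unavs L S) \<Longrightarrow> \<sigma> \<in> unav_moves L S (fst (unavs L S ! q)) q \<Longrightarrow> out M t \<tau> \<in> Yu q"
    using profile_for_move[OF t \<sigma> Yc(1) Yu(1)] by blast
  have "sat M (out M t \<tau>) \<phi>" if \<phi>: "\<phi> \<in> next_prestate L p S \<sigma>" for \<phi>
  proof -
    from \<phi> consider "\<phi> = Top p"
      | n A where "n < length (coops L S)" "coops L S ! n = (A, \<phi>)" "\<sigma> \<in> coop_moves L S A n"
      | q A where "q < length (unavs L S)" "unavs L S ! q = (A, \<phi>)" "\<sigma> \<in> unav_moves L S A q"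
      unfolding next_prestate_def Let_def by (auto split: if_splits)
    then show ?thesis
    proof cases
      case 2
      then show ?thesis using Yc(2)[OF 2(1) \<tau>(2)] by simp
    next
      case 3
      then show ?thesis using Yu(2)[OF 3(1) \<tau>(3)] by simp
    qed simp
  qed
  then show thesis using that[OF out_St[OF cgm t \<tau>(1)]] \<tau>(2,3) by blast
qed

text \<open>One step of realization, for the three inductive rules together. The target
  \<open>Y\<close> is imposed on the linked formula alone; the other listed formulae keep their
  truth sets as targets.\<close>

lemma realized_link:
  assumes L: "listing L" "finite \<Delta>" and t: "t \<in> St M" "true_at M t \<Delta>"
    and T: "(\<Delta>, \<gamma>) \<in> T" and sr: "sr_edge p \<Gamma> (\<Delta>, \<gamma>)"
    and C: "modality M C E" and \<Phi>: "C \<Phi> \<in> \<Delta>" "\<not> is_next \<Phi>"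
    and \<gamma>: "\<gamma> (C \<Phi>) = Some (And \<psi> (C (Next \<xi>)))"
    and Y: "E t Y" "\<And>u. u \<in> Y \<Longrightarrow> sat M u \<xi>"
    and succ: "\<And>\<sigma> u. \<sigma> \<in> moves L (\<Delta>, \<gamma>) \<Longrightarrow> u \<in> St M \<Longrightarrow> u \<in> Y \<Longrightarrow>
      true_at M u (next_prestate L p (\<Delta>, \<gamma>) \<sigma>) \<Longrightarrow> \<xi> \<in> next_prestate L p (\<Delta>, \<gamma>) \<sigma> \<Longrightarrow>
      \<exists>S'\<in>T. edge L p (\<Delta>, \<gamma>) \<sigma> S' \<and> realized L p T \<xi> S'"
  shows "realized L p T (C \<Phi>) (\<Delta>, \<gamma>)"
proof -
  let ?S = "(\<Delta>, \<gamma>)"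
  have gf: "gamma_formula (C \<Phi>)" using gamma_formula_modality[OF C \<Phi>(2)] .
  have "And \<psi> (C (Next \<xi>)) \<in> \<Delta>" using sr_edge_facts(3)[OF sr \<Phi>(1) gf] \<gamma> by auto
  then have nx: "C (Next \<xi>) \<in> \<Delta>" using and_closedD[OF sr_edge_facts(1)[OF sr]] by blast
  let ?Yc = "\<lambda>n. {u. sat M u (snd (coops L ?S ! n))}" and ?Yu = "\<lambda>q. {u. sat M u (snd (unavs L ?S ! q))}"
  have coop: "\<forall>\<sigma>\<in>coop_moves L ?S A n. \<exists>S'\<in>T. edge L p ?S \<sigma> S' \<and> realized L p T \<xi> S'"
    if n: "n < length (coops L ?S)" "coops L ?S ! n = (A, \<xi>)" and eff: "eff_coop M A t Y" for A n
  proof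
    fix \<sigma> assume \<sigma>: "\<sigma> \<in> coop_moves L ?S A n"
    then have mv: "\<sigma> \<in> moves L ?S" by (simp add: coop_moves_def)
    obtain u where u: "u \<in> St M" "true_at M u (next_prestate L p ?S \<sigma>)"
      "\<And>k. k < length (coops L ?S) \<Longrightarrow> \<sigma> \<in> coop_moves L ?S (fst (coops L ?S ! k)) k \<Longrightarrow> u \<in> (?Yc(n := Y)) k"
    proof (rule move_successor[OF t(1) mv, of "?Yc(n := Y)" ?Yu])
      show "eff_coop M (fst (coops L ?S ! k)) t ((?Yc(n := Y)) k)" if "k < length (coops L ?S)" for k
        using listing_eff(1)[OF L t that] eff n(2) by simp
      show "sat M w (snd (coops L ?S ! k))" if "w \<in> (?Yc(n := Y)) k" for k w
        using that Y(2) n(2) by (cases "k = n") auto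
    qed (use listing_eff(2)[OF L t] in blast)+
    have "u \<in> Y" using u(3)[OF n(1)] n(2) \<sigma> by simp
    moreover have "\<xi> \<in> next_prestate L p ?S \<sigma>"
      using n \<sigma> unfolding next_prestate_def Let_def by auto
    ultimately show "\<exists>S'\<in>T. edge L p ?S \<sigma> S' \<and> realized L p T \<xi> S'" using succ[OF mv u(1) _ u(2)] by blast
  qed
  have unav: "\<forall>\<sigma>\<in>unav_moves L ?S A q. \<exists>S'\<in>T. edge L p ?S \<sigma> S' \<and> realized L p T \<xi> S'"
    if q: "q < length (unavs L ?S)" "unavs L ?S ! q = (A, \<xi>)" and eff: "eff_unav M A t Y" for A q
  proof
    fix \<sigma> assume \<sigma>: "\<sigma> \<in> unav_moves L ?S A q"
    then have mv: "\<sigma> \<in> moves L ?S" by (simp add: unav_moves_def)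
    obtain u where u: "u \<in> St M" "true_at M u (next_prestate L p ?S \<sigma>)"
      "\<And>k. k < length (unavs L ?S) \<Longrightarrow> \<sigma> \<in> unav_moves L ?S (fst (unavs L ?S ! k)) k \<Longrightarrow> u \<in> (?Yu(q := Y)) k"
    proof (rule move_successor[OF t(1) mv, of ?Yc "?Yu(q := Y)"])
      show "eff_unav M (fst (unavs L ?S ! k)) t ((?Yu(q := Y)) k)" if "k < length (unavs L ?S)" for k
        using listing_eff(2)[OF L t that] eff q(2) by simp
      show "sat M w (snd (unavs L ?S ! k))" if "w \<in> (?Yu(q := Y)) k" for k w
        using that Y(2) q(2) by (cases "k = q") auto
    qed (use listing_eff(1)[OF L t] in blast)+
    have "u \<in> Y" using u(3)[OF q(1)] q(2) \<sigma> by simp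
    moreover have "\<xi> \<in> next_prestate L p ?S \<sigma>"
      using q \<sigma> unfolding next_prestate_def Let_def by auto
    ultimately show "\<exists>S'\<in>T. edge L p ?S \<sigma> S' \<and> realized L p T \<xi> S'" using succ[OF mv u(1) _ u(2)] by blast
  qed
  from C consider A where "C = Coop A" "E = eff_coop M A"
    | A where "C = Unav A" "E = eff_unav M A" "A \<noteq> UNIV" | "C = Unav UNIV" "E = eff_unav M UNIV"
    by (auto simp: modality_def)
  then show ?thesis
  proof cases
    case (1 A)
    then have "(A, \<xi>) \<in> set (coops L ?S)" using nx listing_sets(1)[OF L] by blast
    then obtain n where n: "n < length (coops L ?S)" "coops L ?S ! n = (A, \<xi>)" by (auto simp: in_set_conv_nth)
    show ?thesis
      unfolding 1
      by (rule realized.coop[OF T \<Phi>(1)[unfolded 1] gf[unfolded 1] \<gamma>[unfolded 1] n coop[OF n]])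
        (use Y(1) 1 in simp)
  next
    case (2 A)
    then have "(A, \<xi>) \<in> set (unavs L ?S)" using nx listing_sets(2)[OF L] by blast
    then obtain q where q: "q < length (unavs L ?S)" "unavs L ?S ! q = (A, \<xi>)" by (auto simp: in_set_conv_nth)
    show ?thesis
      unfolding 2
      by (rule realized.unav[OF T \<Phi>(1)[unfolded 2] gf[unfolded 2] \<gamma>[unfolded 2] q unav[OF q]])
        (use Y(1) 2 in simp)
  next
    case 3
    \<comment> \<open>The empty coalition of the \<alpha>-component has the same one-step power as
      \<open>Unav UNIV\<close>: all successors lie in \<open>Y\<close>.\<close>
    then have "Coop {} (Next \<xi>) \<in> \<Delta>" using nx sr_edge_facts(2)[OF sr] by blast
    then have "({}, \<xi>) \<in> set (coops L ?S)" using listing_sets(1)[OF L] by blast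
    then obtain n where n: "n < length (coops L ?S)" "coops L ?S ! n = ({}, \<xi>)" by (auto simp: in_set_conv_nth)
    have "eff_unav M UNIV t Y" using Y(1) 3 by simp
    then have "out M t \<tau> \<in> Y" if "\<tau> \<in> profiles M t" for \<tau>
      using that unfolding eff_unav_def by (metis UNIV_I ext)
    then have "eff_coop M {} t Y" using actions_ex[OF cgm t(1)] unfolding eff_coop_def by blast
    then show ?thesis
      unfolding 3
      by (intro realized.unav_all[OF T \<Phi>(1)[unfolded 3] gf[unfolded 3] \<gamma>[unfolded 3] n coop[OF n]])
  qed
qed

section \<open>Survival of the satisfiable states\<close>

context
  fixes L :: "('ag, 'p) lister" and \<eta> :: "('ag, 'p) sform"
  assumes L: "listing L"
begin

text \<open>Membership in the pretableau makes the labels finite, as \<open>listing\<close> demands,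
  and places the set inside the initial tableau.\<close>

definition sat_states :: "('ag, 'p) tstate set" where
  "sat_states = {S. tableau_state L p \<eta> S \<and> (\<exists>t\<in>St M. true_at M t (fst S))}"

lemma realized_nothing_left:
  assumes "(\<Delta>, \<gamma>) \<in> T" "modality M C E" "C \<Phi> \<in> \<Delta>" "\<not> is_next \<Phi>"
    "\<gamma> (C \<Phi>) = Some \<psi>" "(\<psi>, PState (Top p)) \<in> dec p \<Phi>"
  shows "realized L p T (C \<Phi>) (\<Delta>, \<gamma>)"
proof -
  obtain A where "C \<Phi> = Coop A \<Phi> \<or> C \<Phi> = Unav A \<Phi>" using assms(2) by (auto simp: modality_def)
  from realized.nothing_left[OF assms(1,3) gamma_formula_modality[OF assms(2,4)] this assms(5,6)]
  show ?thesis .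
qed

text \<open>Only the link of \<open>C \<Phi>\<close> is forced to be canonical; the other
  \<gamma>-formulae keep arbitrary true links.\<close>

lemma linked_expansion:
  assumes C: "modality M C E" and t: "t \<in> St M" and sat: "sat M t (C \<Phi>)" and \<Phi>: "\<not> is_next \<Phi>"
    and \<Gamma>: "prestate L p \<eta> \<Gamma>" "true_at M t \<Gamma>" "C \<Phi> \<in> \<Gamma>"
  obtains \<Delta> \<gamma> \<psi> where "best p (sat M t) \<Phi> = Some (\<psi>, step M p t \<Phi>)" "sr_edge p \<Gamma> (\<Delta>, \<gamma>)"
    "tableau_state L p \<eta> (\<Delta>, \<gamma>)" "true_at M t \<Delta>" "C \<Phi> \<in> \<Delta>" "\<psi> \<in> \<Delta>"
    "\<gamma> (C \<Phi>) = Some (link p C \<psi> (step M p t \<Phi>))"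
proof -
  let ?\<Psi> = "step M p t \<Phi>"
  have gf: "gamma_formula (C \<Phi>)" using gamma_formula_modality[OF C \<Phi>] .
  obtain \<psi> where \<psi>: "best p (sat M t) \<Phi> = Some (\<psi>, ?\<Psi>)" "sat M t (link p C \<psi> ?\<Psi>)"
    using sat_link[OF C t sat] .
  obtain g where g: "\<And>\<xi>. gamma_formula \<xi> \<Longrightarrow> sat M t \<xi> \<Longrightarrow> g \<xi> \<in> gamma_comps p \<xi> \<and> sat M t (g \<xi>)"
    using true_links_ex[OF t] by blast
  have "link p C \<psi> ?\<Psi> \<in> gamma_comps p (C \<Phi>)"
    unfolding gamma_comps_modality[OF C \<Phi>] using best_dec[OF \<psi>(1)] by blast
  then have g': "(g(C \<Phi> := link p C \<psi> ?\<Psi>)) \<xi> \<in> gamma_comps p \<xi> \<and> sat M t ((g(C \<Phi> := link p C \<psi> ?\<Psi>)) \<xi>)"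
    if "gamma_formula \<xi>" "sat M t \<xi>" for \<xi>
    using g[OF that] \<psi>(2) by (simp del: sat.simps)
  obtain \<Delta> \<gamma> where S: "sr_edge p \<Gamma> (\<Delta>, \<gamma>)" "\<Gamma> \<subseteq> \<Delta>" "true_at M t \<Delta>"
    "\<And>\<xi>. \<xi> \<in> \<Gamma> \<Longrightarrow> gamma_formula \<xi> \<Longrightarrow> \<gamma> \<xi> = Some ((g(C \<Phi> := link p C \<psi> ?\<Psi>)) \<xi>)"
    using true_expansion[OF t \<Gamma>(2) g'] by blast
  have \<gamma>: "\<gamma> (C \<Phi>) = Some (link p C \<psi> ?\<Psi>)" using S(4)[OF \<Gamma>(3) gf] by simp
  have ts: "tableau_state L p \<eta> (\<Delta>, \<gamma>)" using prestate_tableau_state.sr[OF \<Gamma>(1) S(1)] .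
  have in\<Delta>: "C \<Phi> \<in> \<Delta>" using S(2) \<Gamma>(3) by blast
  have "link p C \<psi> ?\<Psi> \<in> \<Delta>" using sr_edge_facts(3)[OF S(1) in\<Delta> gf] \<gamma> by auto
  then have "\<psi> \<in> \<Delta>"
    using and_closedD[OF sr_edge_facts(1)[OF S(1)], of \<psi>] by (simp add: link_def split: if_splits)
  then show thesis using that[OF \<psi>(1) S(1) ts S(3) in\<Delta> _ \<gamma>] by blast
qed

text \<open>Induction on the derivation of \<open>attains\<close>. The prestate \<Gamma> is
  arbitrary because it varies with the votes, and the expansion is existential: with the canonical
  link for \<open>C \<Phi>\<close>, the residual in the tableau agrees with the one in the
  model.\<close>

lemma attains_realized:
  assumes "attains M p C E t \<Phi>" and C: "modality M C E" and "t \<in> St M" "sat M t (C \<Phi>)" "\<not> is_next \<Phi>"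
    "prestate L p \<eta> \<Gamma>" "true_at M t \<Gamma>" "C \<Phi> \<in> \<Gamma>"
  shows "\<exists>S\<in>sat_states. sr_edge p \<Gamma> S \<and> realized L p sat_states (C \<Phi>) S"
  using assms(1,3-)
proof (induction arbitrary: \<Gamma>)
  case (now t \<Phi>)
  obtain \<Delta> \<gamma> \<psi> where S: "best p (sat M t) \<Phi> = Some (\<psi>, step M p t \<Phi>)" "sr_edge p \<Gamma> (\<Delta>, \<gamma>)"
    "tableau_state L p \<eta> (\<Delta>, \<gamma>)" "true_at M t \<Delta>" "C \<Phi> \<in> \<Delta>" "\<psi> \<in> \<Delta>"
    "\<gamma> (C \<Phi>) = Some (link p C \<psi> (step M p t \<Phi>))"
    using linked_expansion[OF C now.prems] .
  have mem: "(\<Delta>, \<gamma>) \<in> sat_states" using S(3,4) now.prems(1) by (auto simp: sat_states_def)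
  have "Real \<Phi> \<Delta>" using real_nowD[OF now.hyps sr_edge_facts(1)[OF S(2)] S(1,6)] .
  moreover obtain A where "C \<Phi> = Coop A \<Phi> \<or> C \<Phi> = Unav A \<Phi>" using C by (auto simp: modality_def)
  ultimately have "realized L p sat_states (C \<Phi>) (\<Delta>, \<gamma>)"
    using realized.now[OF mem S(5) gamma_formula_modality[OF C now.prems(3)]] by blast
  then show ?case using mem S(2) by blast
next
  case (later t Y \<Phi>)
  let ?\<Psi> = "step M p t \<Phi>"
  obtain \<Delta> \<gamma> \<psi> where S: "best p (sat M t) \<Phi> = Some (\<psi>, ?\<Psi>)" "sr_edge p \<Gamma> (\<Delta>, \<gamma>)"
    "tableau_state L p \<eta> (\<Delta>, \<gamma>)" "true_at M t \<Delta>" "C \<Phi> \<in> \<Delta>" "\<psi> \<in> \<Delta>"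
    "\<gamma> (C \<Phi>) = Some (link p C \<psi> ?\<Psi>)"
    using linked_expansion[OF C later.prems] .
  have mem: "(\<Delta>, \<gamma>) \<in> sat_states" using S(3,4) later.prems(1) by (auto simp: sat_states_def)
  have dec: "(\<psi>, ?\<Psi>) \<in> dec p \<Phi>" using best_dec[OF S(1)] .
  have "realized L p sat_states (C \<Phi>) (\<Delta>, \<gamma>)"
  \<comment> \<open>With residual \<top> the link is the bare condition, with no successor
    obligation to follow; \<open>nothing_left\<close> closes this case.\<close>
  proof (cases "?\<Psi> = PState (Top p)")
    case True
    then show ?thesis
      using realized_nothing_left[OF mem C S(5) later.prems(3)] S(7) dec by (simp add: link_def)
  next
    case False
    have fin: "finite \<Delta>" using pretableau_label_finite[OF L S(3)] by simp
    have link: "\<gamma> (C \<Phi>) = Some (And \<psi> (C (Next (C ?\<Psi>))))" using S(7) False by (simp add: link_def)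
    show ?thesis
    proof (rule realized_link[OF L fin later.prems(1) S(4) mem S(2) C S(5) later.prems(3) link
          later.hyps(1) later.hyps(2)])
      fix \<sigma> u
      assume \<sigma>: "\<sigma> \<in> moves L (\<Delta>, \<gamma>)" and u: "u \<in> St M" "u \<in> Y"
        "true_at M u (next_prestate L p (\<Delta>, \<gamma>) \<sigma>)" "C ?\<Psi> \<in> next_prestate L p (\<Delta>, \<gamma>) \<sigma>"
      have "prestate L p \<eta> (next_prestate L p (\<Delta>, \<gamma>) \<sigma>)"
        using prestate_tableau_state.nxt[OF S(3) \<sigma>] .
      from later.IH[OF u(2,1) later.hyps(2)[OF u(2)] dec_not_next[OF dec] this u(3,4)]
      show "\<exists>S'\<in>sat_states. edge L p (\<Delta>, \<gamma>) \<sigma> S' \<and> realized L p sat_states (C ?\<Psi>) S'"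
        using \<sigma> unfolding edge_def by blast
    qed
  qed
  then show ?case using mem S(2) by blast
qed

text \<open>ER2 is the delicate half: the given link need not be canonical, so the first step only
  keeps the residual formula true. Progress starts at the successor, where the expansion can be
  chosen and \<open>attains_realized\<close> applies.\<close>

lemma sat_states_not_eliminated:
  assumes S: "S \<in> sat_states"
  shows "\<not> er1 L p sat_states S" "\<not> er2 L p sat_states S"
proof -
  obtain \<Delta> \<gamma> where \<Delta>: "S = (\<Delta>, \<gamma>)" by fastforce
  have ts: "tableau_state L p \<eta> (\<Delta>, \<gamma>)" using S by (simp add: sat_states_def \<Delta>)
  obtain t where t: "t \<in> St M" "true_at M t \<Delta>" using S by (auto simp: sat_states_def \<Delta>)
  have fin: "finite \<Delta>" using pretableau_label_finite[OF L ts] by simp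
  obtain \<Gamma> where \<Gamma>: "sr_edge p \<Gamma> (\<Delta>, \<gamma>)" using ts by (auto elim: tableau_state.cases)
  show "\<not> er1 L p sat_states S"
    unfolding er1_def \<Delta>
  proof clarify
    fix \<sigma> assume \<sigma>: "\<sigma> \<in> moves L (\<Delta>, \<gamma>)" and no: "\<not> (\<exists>S'\<in>sat_states. edge L p (\<Delta>, \<gamma>) \<sigma> S')"
    obtain u where u: "u \<in> St M" "true_at M u (next_prestate L p (\<Delta>, \<gamma>) \<sigma>)"
      by (rule move_successor[OF t(1) \<sigma> listing_eff(1)[OF L fin t] _ listing_eff(2)[OF L fin t]]) blast+
    obtain g where g: "\<And>\<xi>. gamma_formula \<xi> \<Longrightarrow> sat M u \<xi> \<Longrightarrow> g \<xi> \<in> gamma_comps p \<xi> \<and> sat M u (g \<xi>)"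
      using true_links_ex[OF u(1)] by blast
    obtain \<Delta>' \<gamma>' where S': "sr_edge p (next_prestate L p (\<Delta>, \<gamma>) \<sigma>) (\<Delta>', \<gamma>')" "true_at M u \<Delta>'"
      using true_expansion[OF u g] by blast
    have "tableau_state L p \<eta> (\<Delta>', \<gamma>')"
      using prestate_tableau_state.sr[OF prestate_tableau_state.nxt[OF ts \<sigma>] S'(1)] .
    then have "(\<Delta>', \<gamma>') \<in> sat_states" using S'(2) u(1) by (auto simp: sat_states_def)
    then show False using no S'(1) \<sigma> unfolding edge_def by blast
  qed
  show "\<not> er2 L p sat_states S"
    unfolding er2_def \<Delta> fst_conv
  proof (clarify, erule notE)
    fix \<xi> assume \<xi>: "\<xi> \<in> \<Delta>" "gamma_formula \<xi>"
    obtain C E \<Phi> where C: "modality M C E" and \<xi>': "\<xi> = C \<Phi>" and \<Phi>: "\<not> is_next \<Phi>"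
      using gamma_formulaE[OF \<xi>(2)] .
    obtain \<chi> where \<chi>: "\<gamma> \<xi> = Some \<chi>" "\<chi> \<in> gamma_comps p \<xi>" "\<chi> \<in> \<Delta>"
      using sr_edge_facts(3)[OF \<Gamma> \<xi>] by blast
    then obtain \<psi> \<Psi> where \<Psi>: "\<chi> = link p C \<psi> \<Psi>" "(\<psi>, \<Psi>) \<in> dec p \<Phi>"
      using gamma_comps_modality[OF C \<Phi>] \<xi>' by blast
    note mem = S[unfolded \<Delta>]
    show "realized L p sat_states \<xi> (\<Delta>, \<gamma>)"
    proof (cases "\<Psi> = PState (Top p)")
      case True
      then show ?thesis
        using realized_nothing_left[OF mem C _ \<Phi>] \<chi>(1) \<xi>(1) \<Psi> unfolding \<xi>' by (simp add: link_def)
    next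
      case False
      have \<chi>': "\<chi> = And \<psi> (C (Next (C \<Psi>)))" using \<Psi>(1) False by (simp add: link_def)
      then have "sat M t (C (Next (C \<Psi>)))" using \<chi>(3) t(2) by fastforce
      then have Y: "E t {u. sat M u (C \<Psi>)}" using sat_Next_iff[OF cgm C t(1)] by blast
      show ?thesis
        unfolding \<xi>'
      proof (rule realized_link[OF L fin t mem \<Gamma> C \<xi>(1)[unfolded \<xi>'] \<Phi> \<chi>(1)[unfolded \<xi>' \<chi>'] Y])
        fix \<sigma> u
        assume \<sigma>: "\<sigma> \<in> moves L (\<Delta>, \<gamma>)" and u: "u \<in> St M" "u \<in> {u. sat M u (C \<Psi>)}"
          "true_at M u (next_prestate L p (\<Delta>, \<gamma>) \<sigma>)" "C \<Psi> \<in> next_prestate L p (\<Delta>, \<gamma>) \<sigma>"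
        have sat: "sat M u (C \<Psi>)" using u(2) by simp
        have "prestate L p \<eta> (next_prestate L p (\<Delta>, \<gamma>) \<sigma>)" using prestate_tableau_state.nxt[OF ts \<sigma>] .
        from attains_realized[OF sat_attains[OF cgm C u(1) sat] C u(1) sat dec_not_next[OF \<Psi>(2)] this u(3,4)]
        show "\<exists>S'\<in>sat_states. edge L p (\<Delta>, \<gamma>) \<sigma> S' \<and> realized L p sat_states (C \<Psi>) S'"
          using \<sigma> unfolding edge_def by blast
      qed simp
    qed
  qed
qed

text \<open>Deletability is antimonotone in the tableau: a set that admits no deletion by itself
  loses no state inside any larger tableau, whatever the order of deletions.\<close>

lemma sat_states_final:
  assumes "final_tableau L p \<eta> T"
  shows "sat_states \<subseteq> T"
proof -
  have "(elim_step L p)\<^sup>*\<^sup>* (initial_tableau L p \<eta>) T" using assms unfolding final_tableau_def by blast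
  moreover have "sat_states \<subseteq> initial_tableau L p \<eta>"
    unfolding sat_states_def initial_tableau_def by blast
  moreover have "\<nexists>F'. elim_step L p sat_states F'"
    using sat_states_not_eliminated unfolding elim_step_def by blast
  ultimately show ?thesis by (rule final_below)
qed

lemma sat_state_ex:
  assumes s: "s \<in> St M" "sat M s \<eta>"
  shows "\<exists>S\<in>sat_states. \<eta> \<in> fst S"
proof -
  obtain g where g: "\<And>\<xi>. gamma_formula \<xi> \<Longrightarrow> sat M s \<xi> \<Longrightarrow> g \<xi> \<in> gamma_comps p \<xi> \<and> sat M s (g \<xi>)"
    using true_links_ex[OF s(1)] by blast
  have "true_at M s {\<eta>}" using s(2) by simp
  then obtain \<Delta> \<gamma> where S: "sr_edge p {\<eta>} (\<Delta>, \<gamma>)" "{\<eta>} \<subseteq> \<Delta>" "true_at M s \<Delta>"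
    using true_expansion[OF s(1) _ g] by blast
  have "tableau_state L p \<eta> (\<Delta>, \<gamma>)"
    using prestate_tableau_state.sr[OF prestate_tableau_state.init S(1)] .
  then have "(\<Delta>, \<gamma>) \<in> sat_states" using S(3) s(1) by (auto simp: sat_states_def)
  then show ?thesis using S(2) by force
qed

end

end

theorem theorem2:
  fixes \<eta> :: "('ag::finite, 'p) sform"
    and p :: 'p
    and L :: "('ag, 'p) lister"
    and T :: "('ag, 'p) tstate set"
  assumes "listing L"
    and "final_tableau L p \<eta> T"
    and "\<exists>(M :: ('ag, 'p, 's, 'c) cgm) s. is_cgm M \<and> s \<in> St M \<and> sat M s \<eta>"
  shows "open_tableau \<eta> T"
proof -
  obtain M :: "('ag, 'p, 's, 'c) cgm" and s where M: "is_cgm M" "s \<in> St M" "sat M s \<eta>"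
    using assms(3) by blast
  show ?thesis
    using sat_state_ex[OF M(1) assms(1) M(2,3), of p] sat_states_final[OF M(1) assms(1,2)]
    unfolding open_tableau_def by blast
qed

end
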